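(* Let $\alpha$ be a continuous rotationally symmetric norm. Let $\mathcal{M}$ be a Hilbert space (with its own norm $\|\cdot\|_{\mathcal{M}}$) which is a vector subspace of $H^\alpha$, such that $T_z(\mathcal{M})\subset\mathcal{M}$ and $T_z$ acts as an isometry on $\mathcal{M}$ (with respect to $\|\cdot\|_{\mathcal{M}}$). Then there exists $\phi\in H^2\cap H^\alpha$ such that \[ \mathcal{M}=\phi H^2 . \] Further, $\|\phi g\|_{\mathcal{M}}=\|g\|_{H^2}$ for all $g\in H^2$.
   Context: Let $\mathbb{T}$ be the unit circle in $\mathbb{C}$ with normalized Lebesgue measure $m$; $L^p$ ($1\le p\le\infty$) are the Lebesgue spaces of $(\mathbb{T},m)$, and $H^p\subset L^p$ the Hardy spaces (functions in $L^p$ whose Fourier coefficients of negative index vanish). A rotationally symmetric norm is a norm $\alpha$ on $L^\infty$ such that (1) $\alpha(1)=1$; (2) $\alpha(|f|)=\alpha(f)$ for all $f\in L^\infty$; (3) $\alpha(f_w)=\alpha(f)$ for all $w\in\mathbb{T}$, $f\in L^\infty$, where $f_w(z)=f(\overline{w}z)$. It is extended to all complex measurable functions on $\mathbb{T}$ by $\alpha(f)=\sup\{\alpha(s): s \text{ a simple function},\ |s|\le|f|\}\in[0,\infty]$. It is continuous if $\alpha(\chi_{E_k})\to0$ for every sequence of measurable sets $E_k\subset\mathbb{T}$ with $m(E_k)\to0^+$, where $\chi_{E}$ denotes the characteristic function of $E$. Put $\mathcal{L}^\alpha=\{f \text{ measurable}:\alpha(f)<\infty\}$, a Banach space under $\alpha$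 contained in $L^1$; $L^\alpha$ is the $\alpha$-closure of $L^\infty$ in $\mathcal{L}^\alpha$, and $H^\alpha$ is the $\alpha$-closure of $H^\infty$. $T_z$ is the operator of multiplication by the coordinate function $z$. No relation between the norm of $\mathcal{M}$ and $\alpha$ is assumed (the containment of $\mathcal{M}$ in $H^\alpha$ is only algebraic).
   Formalization: The identity ‖φg‖_M = ‖g‖_{H²} is stated only for M ≠ {0}: for M = {0} the equation M = φH² forces φ = 0, so the identity fails at g = 1; the existence of φ is still proved for every M, including {0}. *)

theory Defs
  imports "HOL-Probability.Probability"
begin

text \<open>The unit circle with normalized Lebesgue measure (on its Borel sets; every Lebesgue measurable
  function or set agrees almost everywhere with a Borel one, and everything below is considered
  modulo null sets).\<close>

definition circ :: "complex measure" where
  "circ = distr (uniform_measure lborel {0..<2 * pi}) (restrict_space borel (sphere 0 1)) cis"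

lemma space_circ [simp]: "space circ = sphere 0 1"
  by (simp add: circ_def space_restrict_space)

lemma sets_circ [simp]: "sets circ = sets (restrict_space borel (sphere 0 1))"
  by (simp add: circ_def)

interpretation circ: prob_space circ
  unfolding circ_def
proof (rule prob_space.prob_space_distr)
  show "prob_space (uniform_measure lborel {0..<2 * pi})"
    by (rule prob_space_uniform_measure) auto
  have "cis \<in> borel_measurable borel"
    by (intro borel_measurable_continuous_onI continuous_intros)
  then have "cis \<in> borel_measurable (uniform_measure lborel {0..<2 * pi})"
    by simp
  then show "cis \<in> uniform_measure lborel {0..<2 * pi} \<rightarrow>\<^sub>M restrict_space borel (sphere 0 1)"
    by (rule measurable_restrict_space2[rotated]) simp
qed

lemma measurable_circ_id: "(\<lambda>z. z) \<in> borel_measurable circ"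
proof -
  have "(\<lambda>z. z) \<in> borel_measurable (restrict_space borel (sphere 0 1) :: complex measure)"
    by (rule measurable_restrict_space1) simp
  then show ?thesis
    using measurable_cong_sets[OF sets_circ refl] by blast
qed

lemma measurable_circ_powi: "(\<lambda>z. z powi n) \<in> borel_measurable circ"
  using measurable_circ_id by (cases "n \<ge> 0") (simp_all add: power_int_def)

text \<open>Measurable functions on the circle modulo equality almost everywhere.\<close>

definition ae_eq :: "(complex \<Rightarrow> complex) \<Rightarrow> (complex \<Rightarrow> complex) \<Rightarrow> bool" where
  "ae_eq f g \<longleftrightarrow> f \<in> borel_measurable circ \<and> g \<in> borel_measurable circ \<and> (AE z in circ. f z = g z)"

quotient_type l0 = "complex \<Rightarrow> complex" / partial: ae_eq
  morphisms rep_class class_of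
proof (rule part_equivpI)
  show "\<exists>f. ae_eq f f" by (rule exI[of _ "\<lambda>_. 0"]) (simp add: ae_eq_def)
  show "symp ae_eq" by (rule sympI) (auto simp: ae_eq_def)
  show "transp ae_eq" by (rule transpI) (auto simp: ae_eq_def elim: AE_mp)
qed

instantiation l0 :: comm_ring_1
begin

lift_definition zero_l0 :: l0 is "\<lambda>_. 0" by (simp add: ae_eq_def)
lift_definition one_l0 :: l0 is "\<lambda>_. 1" by (simp add: ae_eq_def)
lift_definition plus_l0 :: "l0 \<Rightarrow> l0 \<Rightarrow> l0" is "\<lambda>f g z. f z + g z"
  unfolding ae_eq_def by (elim conjE, intro conjI; ((erule (1) eventually_elim2, simp) | measurable))
lift_definition minus_l0 :: "l0 \<Rightarrow> l0 \<Rightarrow> l0" is "\<lambda>f g z. f z - g z"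
  unfolding ae_eq_def by (elim conjE, intro conjI; ((erule (1) eventually_elim2, simp) | measurable))
lift_definition uminus_l0 :: "l0 \<Rightarrow> l0" is "\<lambda>f z. - f z"
  unfolding ae_eq_def by (elim conjE, intro conjI; ((erule eventually_mono, simp) | measurable))
lift_definition times_l0 :: "l0 \<Rightarrow> l0 \<Rightarrow> l0" is "\<lambda>f g z. f z * g z"
  unfolding ae_eq_def by (elim conjE, intro conjI; ((erule (1) eventually_elim2, simp) | measurable))

instance
proof
  show "(0 :: l0) \<noteq> 1" by transfer (simp add: ae_eq_def)
qed (transfer; simp add: ae_eq_def algebra_simps)+

end

lift_definition scale :: "complex \<Rightarrow> l0 \<Rightarrow> l0" is "\<lambda>c f z. c * f z"
  unfolding ae_eq_def by (elim conjE, intro conjI; ((erule eventually_mono, simp) | measurable))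

interpretation l0: vector_space scale
  by standard (transfer; simp add: ae_eq_def algebra_simps)+

lift_definition modulus :: "l0 \<Rightarrow> l0" is "\<lambda>f z. complex_of_real (cmod (f z))"
  unfolding ae_eq_def by (elim conjE, intro conjI; ((erule eventually_mono, simp) | measurable))

lift_definition modulus_le :: "l0 \<Rightarrow> l0 \<Rightarrow> bool"
  is "\<lambda>f g. AE z in circ. cmod (f z) \<le> cmod (g z)"
  unfolding ae_eq_def by (elim conjE, intro iffI; elim AE_mp; simp)

lift_definition bounded_l0 :: "l0 \<Rightarrow> bool" is "\<lambda>f. \<exists>C. AE z in circ. cmod (f z) \<le> C"
  unfolding ae_eq_def by (elim conjE, intro ex_cong1 iffI; (erule (1) eventually_elim2, simp))

lift_definition square_integrable_l0 :: "l0 \<Rightarrow> bool" is "\<lambda>f. integrable circ (\<lambda>z. (cmod (f z))\<^sup>2)"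
  unfolding ae_eq_def by (elim conjE, rule integrable_cong_AE; ((erule eventually_mono, simp) | measurable))

lift_definition norm_L2 :: "l0 \<Rightarrow> real" is "\<lambda>f. sqrt (LINT z|circ. (cmod (f z))\<^sup>2)"
  unfolding ae_eq_def
  by (elim conjE, rule arg_cong[of _ _ sqrt], rule integral_cong_AE; ((erule eventually_mono, simp) | measurable))

lift_definition fourier :: "l0 \<Rightarrow> int \<Rightarrow> complex" is "\<lambda>f n. LINT z|circ. f z * z powi (- n)"
  unfolding ae_eq_def
  by (elim conjE, rule ext, rule integral_cong_AE; ((erule eventually_mono, simp)
      | (erule borel_measurable_times[OF _ measurable_circ_powi])))

definition Linf :: "l0 set" where "Linf = {f. bounded_l0 f}"
definition L2 :: "l0 set" where "L2 = {f. square_integrable_l0 f}"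

definition Hinf :: "l0 set" where "Hinf = {f \<in> Linf. \<forall>n<0. fourier f n = 0}"
definition H2 :: "l0 set" where "H2 = {f \<in> L2. \<forall>n<0. fourier f n = 0}"

text \<open>A rotationally symmetric norm is a norm on the subspace \<open>Linf\<close>; the value of \<open>\<alpha>\<close> outside
  \<open>Linf\<close> is never used.  Rotation is written on representatives; \<open>class_of\<close> is only applied to measurable functions.\<close>

locale rotsym_norm =
  fixes \<alpha> :: "l0 \<Rightarrow> real"
  assumes nonneg: "f \<in> Linf \<Longrightarrow> 0 \<le> \<alpha> f"
    and definite: "f \<in> Linf \<Longrightarrow> \<alpha> f = 0 \<longleftrightarrow> f = 0"
    and homogeneous: "f \<in> Linf \<Longrightarrow> \<alpha> (scale c f) = cmod c * \<alpha> f"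
    and triangle: "f \<in> Linf \<Longrightarrow> g \<in> Linf \<Longrightarrow> \<alpha> (f + g) \<le> \<alpha> f + \<alpha> g"
    and normalized: "\<alpha> 1 = 1"
    and modulus_invariant: "f \<in> Linf \<Longrightarrow> \<alpha> (modulus f) = \<alpha> f"
    and rotation_invariant: "F \<in> borel_measurable circ \<Longrightarrow> class_of F \<in> Linf \<Longrightarrow> cmod w = 1
      \<Longrightarrow> \<alpha> (class_of (\<lambda>z. F (cnj w * z))) = \<alpha> (class_of F)"

locale continuous_rotsym_norm = rotsym_norm +
  assumes continuous: "(\<And>k. E k \<in> sets circ) \<Longrightarrow> (\<lambda>k. measure circ (E k)) \<longlonglongrightarrow> 0
      \<Longrightarrow> (\<lambda>k. \<alpha> (class_of (indicator (E k)))) \<longlonglongrightarrow> 0"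

text \<open>The extension of \<open>\<alpha>\<close> to all measurable functions and the spaces built from it.\<close>

definition simple_l0 :: "l0 set" where
  "simple_l0 = class_of ` {s. simple_function circ s}"

definition norm_ext :: "(l0 \<Rightarrow> real) \<Rightarrow> l0 \<Rightarrow> ennreal" where
  "norm_ext \<alpha> f = (SUP s\<in>{s \<in> simple_l0. modulus_le s f}. ennreal (\<alpha> s))"

definition finite_norm :: "(l0 \<Rightarrow> real) \<Rightarrow> l0 set" where
  "finite_norm \<alpha> = {f. norm_ext \<alpha> f < \<infinity>}"

definition norm_closure :: "(l0 \<Rightarrow> real) \<Rightarrow> l0 set \<Rightarrow> l0 set" where
  "norm_closure \<alpha> X = {f \<in> finite_norm \<alpha>. \<forall>\<epsilon>>0. \<exists>g\<in>X. norm_ext \<alpha> (f - g) < ennreal \<epsilon>}"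

definition Halpha :: "(l0 \<Rightarrow> real) \<Rightarrow> l0 set" where
  "Halpha \<alpha> = norm_closure \<alpha> Hinf"

definition T_z :: "l0 \<Rightarrow> l0" where
  "T_z f = class_of (\<lambda>z. z) * f"

definition ip_norm :: "(l0 \<Rightarrow> l0 \<Rightarrow> complex) \<Rightarrow> l0 \<Rightarrow> real" where
  "ip_norm ip f = sqrt (Re (ip f f))"

text \<open>A complex Hilbert space whose underlying vector space is a linear subspace \<open>M\<close> of \<open>l0\<close>; the
  inner product \<open>ip\<close> (linear in its first argument) is unrelated to any other structure on \<open>l0\<close>.\<close>

locale hilbert_subspace =
  fixes M :: "l0 set" and ip :: "l0 \<Rightarrow> l0 \<Rightarrow> complex"
  assumes subspace: "l0.subspace M"
    and ip_add: "f \<in> M \<Longrightarrow> g \<in> M \<Longrightarrow> h \<in> M \<Longrightarrow> ip (f + g) h = ip f h + ip g h"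
    and ip_scale: "f \<in> M \<Longrightarrow> h \<in> M \<Longrightarrow> ip (scale c f) h = c * ip f h"
    and ip_sym: "f \<in> M \<Longrightarrow> g \<in> M \<Longrightarrow> ip f g = cnj (ip g f)"
    and ip_pos: "f \<in> M \<Longrightarrow> f \<noteq> 0 \<Longrightarrow> 0 < Re (ip f f)"
    and complete: "(\<And>n. \<sigma> n \<in> M)
      \<Longrightarrow> (\<And>\<epsilon>. \<epsilon> > 0 \<Longrightarrow> \<exists>N. \<forall>m\<ge>N. \<forall>n\<ge>N. ip_norm ip (\<sigma> m - \<sigma> n) < \<epsilon>)
      \<Longrightarrow> \<exists>f\<in>M. (\<lambda>n. ip_norm ip (\<sigma> n - f)) \<longlonglongrightarrow> 0"

end

theory Submission
  imports Defs
begin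

text \<open>The norm \<open>\<alpha>\<close> matters only for the inclusion of \<open>M\<close> in \<open>H1\<close>. It dominates the norm of \<open>L1\<close> up to a constant
  (\<open>norm_L1_le\<close>): averages of rotations of \<open>\<bar>f\<bar>\<close> have norm at most \<open>\<alpha> f\<close> and approach the constant
  \<open>\<integral>\<bar>f\<bar>\<close> in measure, and by continuity a constant keeps at least half of its norm when it is cut off on a
  sufficiently small set. So the closure of \<open>Hinf\<close> under
  \<open>\<alpha>\<close> consists of integrable functions without Fourier coefficients of negative index (\<open>Halpha_subset_H1\<close>).

  The inner product of \<open>M\<close> is unrelated to \<open>L1\<close>, and yet the inclusion of \<open>M\<close> in \<open>L1\<close> is bounded (\<open>L1_bounded\<close>). A
  gliding hump shows it: unit vectors of \<open>M\<close> with large norm in \<open>L1\<close>, suitably weighted and shifted far apart by powers of the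
  isometry \<open>T_z\<close>, would add up to an element of \<open>M\<close> that is not integrable.

  The rest follows Wold and Beurling. Let \<open>\<phi>\<close> be a unit vector of \<open>M\<close> orthogonal to \<open>T_z ` M\<close>. The vectors
  \<open>z ^ n * \<phi>\<close> are orthonormal, so multiplication by \<open>\<phi>\<close> is an isometry from the polynomials, with the norm of \<open>L2\<close>,
  into \<open>M\<close>. Boundedness into \<open>L1\<close> then forces \<open>\<phi>\<close> into \<open>L2\<close> (\<open>wandering_L2\<close>) and identifies the extension of the
  isometry to \<open>H2\<close> with multiplication by \<open>\<phi>\<close> (\<open>wandering_mult_H2\<close>). A second such vector \<open>\<psi>\<close>, orthogonal to \<open>\<phi>\<close>,
  cannot exist, because \<open>\<phi> * \<psi>\<close> would lie in the orthogonal spaces \<open>\<phi> H2\<close> and \<open>\<psi> H2\<close> and have the norm of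
  \<open>\<psi>\<close> in \<open>L2\<close> (\<open>no_orthogonal_wandering\<close>). Hence an element of \<open>M\<close> orthogonal to \<open>\<phi> H2\<close> is
  divisible by every power of \<open>z\<close>, which a nonzero function in \<open>H1\<close> is not, and \<open>M\<close> is \<open>\<phi> H2\<close>
  (\<open>wandering_generates\<close>). If \<open>M\<close> is zero, \<open>\<phi> = 0\<close> does.\<close>

section \<open>The circle measure\<close>

lemma measurable_cis_circ: "cis \<in> borel \<rightarrow>\<^sub>M circ"
proof -
  have "cis \<in> borel_measurable borel"
    by (intro borel_measurable_continuous_onI continuous_intros)
  then have "cis \<in> borel \<rightarrow>\<^sub>M restrict_space borel (sphere 0 1)"
    by (rule measurable_restrict_space2[rotated]) simp
  then show ?thesis
    using measurable_cong_sets[OF refl sets_circ] by blast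
qed

lemma measurable_circ_powi' [measurable]: "(\<lambda>z. z powi n) \<in> borel_measurable circ"
  by (rule measurable_circ_powi)

lemma circ_eq_distr: "circ = distr (uniform_measure lborel {0..<2 * pi}) circ cis"
  by (subst (1) circ_def, rule distr_cong) auto

lemma continuous_on_circ_measurable:
  "continuous_on (sphere 0 1) f \<Longrightarrow> f \<in> borel_measurable circ"
  by (subst measurable_cong_sets[OF sets_circ refl]) (rule borel_measurable_continuous_on_restrict)

lemma measurable_rotation:
  assumes "cmod w = 1" shows "(\<lambda>z. w * z) \<in> circ \<rightarrow>\<^sub>M circ"
proof -
  have "(\<lambda>z. w * z) \<in> restrict_space borel (sphere 0 1) \<rightarrow>\<^sub>M restrict_space borel (sphere 0 1)"
    by (rule measurable_restrict_space3) (auto simp: assms norm_mult)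
  then show ?thesis
    using measurable_cong_sets[OF sets_circ sets_circ] by blast
qed

lemma nn_integral_circ:
  assumes [measurable]: "F \<in> borel_measurable circ"
  shows "(\<integral>\<^sup>+z. F z \<partial>circ) = (\<integral>\<^sup>+t. F (cis t) * indicator {0..<2 * pi} t \<partial>lborel) / ennreal (2 * pi)"
proof -
  have [measurable]: "(\<lambda>t. F (cis t)) \<in> borel_measurable borel"
    by (rule measurable_compose[OF measurable_cis_circ assms])
  have "(\<integral>\<^sup>+z. F z \<partial>circ) = (\<integral>\<^sup>+z. F z \<partial>distr (uniform_measure lborel {0..<2 * pi}) circ cis)"
    using circ_eq_distr by simp
  also have "\<dots> = (\<integral>\<^sup>+t. F (cis t) \<partial>uniform_measure lborel {0..<2 * pi})"
    by (rule nn_integral_distr)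
       (simp_all add: measurable_cis_circ measurable_cong_sets[OF sets_uniform_measure refl])
  also have "\<dots> = (\<integral>\<^sup>+t. F (cis t) * indicator {0..<2 * pi} t \<partial>lborel) / ennreal (2 * pi)"
    by (subst nn_integral_uniform_measure) auto
  finally show ?thesis .
qed

text \<open>A translation moves the part of a period that leaves \<open>{0..<T}\<close> to the other end.\<close>

lemma nn_integral_period_shift:
  fixes g :: "real \<Rightarrow> ennreal"
  assumes [measurable]: "g \<in> borel_measurable borel" and per: "\<And>t. g (t + T) = g t"
    and s: "0 \<le> s" "s < T"
  shows "(\<integral>\<^sup>+t. g (s + t) * indicator {0..<T} t \<partial>lborel) = (\<integral>\<^sup>+t. g t * indicator {0..<T} t \<partial>lborel)"
proof -
  have "(\<integral>\<^sup>+t. g (s + t) * indicator {0..<T} t \<partial>lborel)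
      = (\<integral>\<^sup>+t. g (s + 1 * t) * indicator {s..<T + s} (s + 1 * t) \<partial>lborel)"
    by (intro nn_integral_cong) (auto split: split_indicator)
  also have "\<dots> = (\<integral>\<^sup>+t. g t * indicator {s..<T + s} t \<partial>lborel)"
    using nn_integral_real_affine[of "\<lambda>t. g t * indicator {s..<T + s} t" 1 s] by simp
  also have "\<dots> = (\<integral>\<^sup>+t. g t * indicator {s..<T} t + g t * indicator {T..<T + s} t \<partial>lborel)"
    using s by (intro nn_integral_cong) (auto split: split_indicator)
  also have "\<dots> = (\<integral>\<^sup>+t. g t * indicator {s..<T} t \<partial>lborel) + (\<integral>\<^sup>+t. g t * indicator {T..<T + s} t \<partial>lborel)"
    by (rule nn_integral_add) auto
  also have "(\<integral>\<^sup>+t. g t * indicator {T..<T + s} t \<partial>lborel)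
      = (\<integral>\<^sup>+t. g (T + 1 * t) * indicator {T..<T + s} (T + 1 * t) \<partial>lborel)"
    using nn_integral_real_affine[of "\<lambda>t. g t * indicator {T..<T + s} t" 1 T] by simp
  also have "\<dots> = (\<integral>\<^sup>+t. g t * indicator {0..<s} t \<partial>lborel)"
    using per by (intro nn_integral_cong) (auto split: split_indicator simp: add.commute)
  also have "(\<integral>\<^sup>+t. g t * indicator {s..<T} t \<partial>lborel) + \<dots>
      = (\<integral>\<^sup>+t. g t * indicator {s..<T} t + g t * indicator {0..<s} t \<partial>lborel)"
    by (rule nn_integral_add[symmetric]) auto
  also have "\<dots> = (\<integral>\<^sup>+t. g t * indicator {0..<T} t \<partial>lborel)"
    using s by (intro nn_integral_cong) (auto split: split_indicator)
  finally show ?thesis .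
qed

lemma nn_integral_rotate:
  assumes [measurable]: "F \<in> borel_measurable circ" and w: "cmod w = 1"
  shows "(\<integral>\<^sup>+z. F (w * z) \<partial>circ) = (\<integral>\<^sup>+z. F z \<partial>circ)"
proof -
  obtain s where s: "w = cis s" "0 \<le> s" "s < 2 * pi"
    using w by (metis Arg2pi cis_conv_exp is_Arg_def mult_1 of_real_1)
  have m1: "(\<lambda>z. F (w * z)) \<in> borel_measurable circ"
    by (rule measurable_compose[OF measurable_rotation[OF w] assms(1)])
  have [measurable]: "(\<lambda>t. F (cis t)) \<in> borel_measurable borel"
    by (rule measurable_compose[OF measurable_cis_circ assms(1)])
  have "(\<integral>\<^sup>+z. F (w * z) \<partial>circ)
      = (\<integral>\<^sup>+t. F (cis (s + t)) * indicator {0..<2 * pi} t \<partial>lborel) / ennreal (2 * pi)"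
    by (subst nn_integral_circ[OF m1]) (simp add: s(1) flip: cis_mult)
  also have "(\<integral>\<^sup>+t. F (cis (s + t)) * indicator {0..<2 * pi} t \<partial>lborel)
      = (\<integral>\<^sup>+t. F (cis t) * indicator {0..<2 * pi} t \<partial>lborel)"
    using s by (intro nn_integral_period_shift) (auto simp flip: cis_mult)
  also have "\<dots> / ennreal (2 * pi) = (\<integral>\<^sup>+z. F z \<partial>circ)"
    by (rule nn_integral_circ[symmetric]) simp
  finally show ?thesis .
qed

lemma distr_rotate:
  assumes w: "cmod w = 1" shows "distr circ circ (\<lambda>z. w * z) = circ"
proof (rule measure_eqI)
  fix A assume "A \<in> sets (distr circ circ (\<lambda>z. w * z))"
  then have A: "A \<in> sets circ" by simp
  then have [measurable]: "(indicator A :: complex \<Rightarrow> ennreal) \<in> borel_measurable circ" by (rule borel_measurable_indicator)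
  have "emeasure (distr circ circ (\<lambda>z. w * z)) A = (\<integral>\<^sup>+z. indicator A z \<partial>distr circ circ (\<lambda>z. w * z))"
    using A by (subst nn_integral_indicator) auto
  also have "\<dots> = (\<integral>\<^sup>+z. indicator A (w * z) \<partial>circ)"
    by (subst nn_integral_distr) (simp_all add: measurable_rotation[OF w])
  also have "\<dots> = emeasure circ A"
    using A by (subst nn_integral_rotate[OF _ w]) (simp_all del: sets_circ)
  finally show "emeasure (distr circ circ (\<lambda>z. w * z)) A = emeasure circ A" .
qed simp

lemma integral_rotate:
  fixes F :: "complex \<Rightarrow> 'a::{banach, second_countable_topology}"
  assumes [measurable]: "F \<in> borel_measurable circ" and w: "cmod w = 1"
  shows "(LINT z|circ. F (w * z)) = (LINT z|circ. F z)"
  by (subst (2) distr_rotate[OF w, symmetric], subst integral_distr) (auto simp: measurable_rotation[OF w])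

lemma integrable_rotate:
  fixes F :: "complex \<Rightarrow> 'a::{banach, second_countable_topology}"
  assumes "integrable circ F" and w: "cmod w = 1"
  shows "integrable circ (\<lambda>z. F (w * z))"
  by (rule integrable_distr[OF measurable_rotation[OF w]]) (simp add: distr_rotate[OF w] assms)

lemma AE_circ_sphere: "(\<And>z. cmod z = 1 \<Longrightarrow> P z) \<Longrightarrow> AE z in circ. P z"
  by (rule AE_I2) simp

lemma norm_powi_sphere: "cmod z = 1 \<Longrightarrow> cmod (z powi n) = 1"
  by (simp add: norm_power_int)

lemma integrable_circ_bounded:
  fixes f :: "complex \<Rightarrow> 'a::{banach, second_countable_topology}"
  assumes "f \<in> borel_measurable circ" "AE z in circ. norm (f z) \<le> C"
  shows "integrable circ f"
  by (rule circ.integrable_const_bound[of _ C]) (use assms in auto)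

text \<open>For \<open>n \<noteq> 0\<close> there is a rotation that multiplies \<open>z powi n\<close> by \<open>-1\<close>.\<close>

lemma integral_powi: "(LINT z|circ. z powi n) = (if n = 0 then 1 else 0)"
proof (cases "n = 0")
  case True
  then show ?thesis using circ.prob_space by simp
next
  case False
  define w where "w = cis (pi / of_int n)"
  have w: "cmod w = 1" by (simp add: w_def)
  have "w powi n = cis (of_int n * (pi / of_int n))"
    unfolding w_def by (simp add: cis_power_int)
  also have "\<dots> = -1" using False by (simp add: cis_pi)
  finally have wn: "w powi n = -1" .
  have "(LINT z|circ. z powi n) = (LINT z|circ. (w * z) powi n)"
    by (rule integral_rotate[symmetric]) (auto simp: w)
  also have "\<dots> = - (LINT z|circ. z powi n)"
    by (simp add: power_int_mult_distrib wn)
  finally show ?thesis using False by simp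
qed

section \<open>Trigonometric polynomials\<close>

definition trig_sum :: "nat \<Rightarrow> (int \<Rightarrow> complex) \<Rightarrow> complex \<Rightarrow> complex" where
  "trig_sum N c z = (\<Sum>n = - int N..int N. c n * z powi n)"

text \<open>Only the values on the circle matter, so that for instance \<open>cnj z\<close> counts as \<open>z powi (- 1)\<close>.\<close>

definition trig :: "(complex \<Rightarrow> complex) \<Rightarrow> bool" where
  "trig q \<longleftrightarrow> (\<exists>N c. \<forall>z. cmod z = 1 \<longrightarrow> q z = trig_sum N c z)"

lemma trig_sum_mono:
  assumes "N \<le> N'"
  shows "trig_sum N c z = trig_sum N' (\<lambda>n. if \<bar>n\<bar> \<le> int N then c n else 0) z"
  unfolding trig_sum_def by (rule sum.mono_neutral_cong_left) (use assms in auto)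

lemma trig_cong: "trig p \<Longrightarrow> (\<And>z. cmod z = 1 \<Longrightarrow> p z = q z) \<Longrightarrow> trig q"
  unfolding trig_def by metis

lemma trig_monom: "trig (\<lambda>z. c * z powi n)"
proof -
  have "c * z powi n = trig_sum (nat \<bar>n\<bar>) (\<lambda>k. if k = n then c else 0) z" for z
    unfolding trig_sum_def by (subst sum.remove[of _ n]) auto
  then show ?thesis unfolding trig_def by blast
qed

lemma trig_add: assumes "trig p" "trig q" shows "trig (\<lambda>z. p z + q z)"
proof -
  obtain N c N' c' where 1: "\<And>z. cmod z = 1 \<Longrightarrow> p z = trig_sum N c z"
    "\<And>z. cmod z = 1 \<Longrightarrow> q z = trig_sum N' c' z"
    using assms unfolding trig_def by metis
  define K where "K = max N N'"
  have "p z + q z = trig_sum K (\<lambda>n. (if \<bar>n\<bar> \<le> int N then c n else 0) + (if \<bar>n\<bar> \<le> int N' then c' n else 0)) z"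
    if "cmod z = 1" for z
    using 1[OF that] trig_sum_mono[of N K c z] trig_sum_mono[of N' K c' z]
    by (simp add: K_def trig_sum_def sum.distrib distrib_right)
  then show ?thesis unfolding trig_def by blast
qed

lemma trig_const: "trig (\<lambda>_. c)"
  using trig_monom[of c 0] by simp

lemma trig_sum_fun: "(\<And>i. i \<in> I \<Longrightarrow> trig (p i)) \<Longrightarrow> trig (\<lambda>z. \<Sum>i\<in>I. p i z)"
  by (induction I rule: infinite_finite_induct) (auto intro: trig_add trig_const)

lemma trig_mult: assumes "trig p" "trig q" shows "trig (\<lambda>z. p z * q z)"
proof -
  obtain N c N' c' where 1: "\<And>z. cmod z = 1 \<Longrightarrow> p z = trig_sum N c z"
    "\<And>z. cmod z = 1 \<Longrightarrow> q z = trig_sum N' c' z"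
    using assms unfolding trig_def by metis
  have "trig (\<lambda>z. \<Sum>i = - int N..int N. \<Sum>j = - int N'..int N'. (c i * c' j) * z powi (i + j))"
    by (intro trig_sum_fun trig_monom)
  then show ?thesis
  proof (rule trig_cong)
    fix z :: complex assume z: "cmod z = 1"
    then have "z \<noteq> 0" by auto
    then show "(\<Sum>i = - int N..int N. \<Sum>j = - int N'..int N'. (c i * c' j) * z powi (i + j)) = p z * q z"
      unfolding 1[OF z] trig_sum_def sum_product
      by (intro sum.cong refl) (simp add: power_int_add mult_ac)
  qed
qed

lemma trig_cmult: "trig p \<Longrightarrow> trig (\<lambda>z. c * p z)"
  using trig_mult[OF trig_const] .

lemma trig_cnj: "trig (\<lambda>z. cnj z)"
proof (rule trig_cong[OF trig_monom[of 1 "-1"]])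
  fix z :: complex assume "cmod z = 1"
  then show "1 * z powi - 1 = cnj z"
    by (simp add: power_int_minus inverse_complex.code complex_eq_iff cmod_def)
qed

lemma trig_measurable: assumes "trig q" shows "q \<in> borel_measurable circ"
proof -
  obtain N c where "\<forall>z. cmod z = 1 \<longrightarrow> q z = trig_sum N c z"
    using assms unfolding trig_def by metis
  moreover have "trig_sum N c \<in> borel_measurable circ" unfolding trig_sum_def[abs_def] by measurable
  ultimately show ?thesis by (subst measurable_cong[of _ _ "trig_sum N c"]) auto
qed

lemma trig_bounded: assumes "trig q" shows "\<exists>C. \<forall>z. cmod z = 1 \<longrightarrow> cmod (q z) \<le> C"
proof -
  obtain N c where q: "\<forall>z. cmod z = 1 \<longrightarrow> q z = trig_sum N c z"
    using assms unfolding trig_def by metis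
  show ?thesis
  proof (intro exI allI impI)
    fix z assume z: "cmod z = 1"
    have "cmod (q z) \<le> (\<Sum>n = - int N..int N. cmod (c n * z powi n))"
      using q z unfolding trig_sum_def by (metis norm_sum)
    also have "\<dots> = (\<Sum>n = - int N..int N. cmod (c n))"
      using z by (simp add: norm_mult norm_powi_sphere)
    finally show "cmod (q z) \<le> (\<Sum>n = - int N..int N. cmod (c n))" .
  qed
qed

lemma trig_integrable: assumes "trig q" shows "integrable circ q"
proof -
  obtain C where "\<forall>z. cmod z = 1 \<longrightarrow> cmod (q z) \<le> C" using trig_bounded[OF assms] ..
  then show ?thesis
    by (intro integrable_circ_bounded[of _ C] trig_measurable assms AE_circ_sphere) auto
qed

lemma real_polynomial_trig:
  fixes p :: "complex \<Rightarrow> real"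
  assumes "real_polynomial_function p" shows "trig (\<lambda>z. complex_of_real (p z))"
  using assms
proof (induction rule: real_polynomial_function.induct)
  case (linear f)
  interpret bounded_linear f by fact
  have eq: "complex_of_real (f z) = (of_real (f 1) / 2 - of_real (f \<i>) * \<i> / 2) * z powi 1
      + (of_real (f 1) / 2 + of_real (f \<i>) * \<i> / 2) * cnj z" for z
  proof -
    have "f z = f (Re z *\<^sub>R 1 + Im z *\<^sub>R \<i>)"
      by (rule arg_cong[of _ _ f]) (simp add: complex_eq_iff)
    also have "\<dots> = Re z * f 1 + Im z * f \<i>" by (simp only: add scaleR real_scaleR_def)
    finally show ?thesis by (simp add: complex_eq_iff field_simps)
  qed
  show ?case
    by (rule trig_cong[OF _ eq[symmetric]]) (intro trig_add trig_monom trig_cmult trig_cnj)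
qed (auto intro: trig_const trig_add trig_mult)

lemma continuous_trig_approx:
  fixes f :: "complex \<Rightarrow> complex"
  assumes f: "continuous_on (sphere 0 1) f" and e: "e > 0"
  shows "\<exists>q. trig q \<and> (\<forall>z. cmod z = 1 \<longrightarrow> cmod (f z - q z) < e)"
proof -
  obtain g where g: "polynomial_function g" "\<And>x. x \<in> sphere 0 1 \<Longrightarrow> norm (f x - g x) < e"
    using Stone_Weierstrass_polynomial_function[OF _ f e] by auto
  have "real_polynomial_function (Re \<circ> g)" "real_polynomial_function (Im \<circ> g)"
    using g(1) bounded_linear_Re bounded_linear_Im unfolding polynomial_function_def by blast+
  then have "trig (\<lambda>z. complex_of_real (Re (g z)) + \<i> * complex_of_real (Im (g z)))"
    by (intro trig_add trig_cmult) (auto dest: real_polynomial_trig simp: o_def)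
  then have "trig g" by (simp flip: complex_eq)
  then show ?thesis using g(2) by (intro exI[of _ g]) auto
qed

lemma borel_measurable_cnj [measurable (raw)]:
  "f \<in> borel_measurable N \<Longrightarrow> (\<lambda>x. cnj (f x)) \<in> borel_measurable N"
  by (rule measurable_compose[OF _ borel_measurable_continuous_onI]) (auto intro: continuous_intros)

lemma borel_measurable_complex_of_real [measurable (raw)]:
  "f \<in> borel_measurable N \<Longrightarrow> (\<lambda>x. complex_of_real (f x)) \<in> borel_measurable N"
  by (rule measurable_compose[OF _ borel_measurable_continuous_onI]) (auto intro: continuous_intros)

lemma measure_circ_sphere [simp]: "measure circ (sphere 0 1) = 1"
  using circ.prob_space by simp

lemma trig_approx_continuous_L1:
  assumes f: "continuous_on (sphere 0 1) f" and e: "e > 0"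
  shows "\<exists>q. trig q \<and> (LINT z|circ. cmod (f z - q z)) < e"
proof -
  obtain q where q: "trig q" "\<And>z. cmod z = 1 \<Longrightarrow> cmod (f z - q z) < e / 2"
    using continuous_trig_approx[OF f, of "e / 2"] e by auto
  have [measurable]: "f \<in> borel_measurable circ" "q \<in> borel_measurable circ"
    using f continuous_on_circ_measurable trig_measurable q(1) by blast+
  have bd: "AE z in circ. cmod (f z - q z) \<le> e / 2"
    by (rule AE_circ_sphere) (rule less_imp_le[OF q(2)])
  have "(LINT z|circ. cmod (f z - q z)) \<le> (LINT z|circ. e / 2)"
    by (rule integral_mono_AE[OF integrable_circ_bounded[of _ "e / 2"] _ bd]) (use bd in auto)
  also have "\<dots> < e" using e by simp
  finally show ?thesis using q(1) by auto
qed

lemma integral_norm_diff_triangle: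
  fixes f g h :: "'b \<Rightarrow> complex"
  assumes "integrable N f" "integrable N g" "integrable N h"
  shows "(LINT z|N. cmod (f z - h z)) \<le> (LINT z|N. cmod (f z - g z)) + (LINT z|N. cmod (g z - h z))"
proof -
  have "(LINT z|N. cmod (f z - h z)) \<le> (LINT z|N. cmod (f z - g z) + cmod (g z - h z))"
    using assms
    by (intro integral_mono)
       (auto intro: norm_diff_triangle_ineq norm_triangle_le simp: norm_triangle_sub
             intro!: order_trans[OF _ norm_triangle_ineq])
  also have "\<dots> = (LINT z|N. cmod (f z - g z)) + (LINT z|N. cmod (g z - h z))"
    using assms by (intro Bochner_Integration.integral_add) auto
  finally show ?thesis .
qed

text \<open>By inner regularity a Borel set contains a compact set of almost the same measure, and the
  indicator of a compact set is a decreasing limit of continuous functions.\<close>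

lemma continuous_approx_indicator_L1:
  assumes A: "A \<in> sets circ" and e: "e > 0"
  shows "\<exists>f. continuous_on (sphere 0 1) f \<and> (LINT z|circ. cmod (indicator A z - f z)) < e"
proof -
  define \<mu> where "\<mu> = distr circ borel (\<lambda>z. z)"
  note [measurable] = measurable_circ_id
  interpret \<mu>: prob_space \<mu> unfolding \<mu>_def by (rule circ.prob_space_distr) measurable
  have AS: "A \<subseteq> sphere 0 1" "A \<in> sets borel"
    using A by (auto simp: sets_restrict_space)
  have K_sets: "K \<in> sets circ" if "K \<subseteq> A" "compact K" for K
    using that AS by (auto simp: sets_restrict_space intro!: image_eqI[of _ _ K] borel_compact)
  have em: "emeasure \<mu> K = emeasure circ K" if "K \<subseteq> A" "K \<in> sets borel" for K
  proof -
    have "emeasure \<mu> K = emeasure circ ((\<lambda>z. z) -` K \<inter> space circ)"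
      unfolding \<mu>_def by (rule emeasure_distr) (use that in auto)
    also have "(\<lambda>z. z) -` K \<inter> space circ = K" using that AS by auto
    finally show ?thesis .
  qed
  have "emeasure circ A = (SUP K \<in> {K. K \<subseteq> A \<and> compact K}. emeasure \<mu> K)"
    using em[OF order_refl AS(2)] inner_regular[of \<mu> A] AS(2) by (simp add: \<mu>_def \<mu>.emeasure_finite[unfolded \<mu>_def])
  also have "\<dots> = (SUP K \<in> {K. K \<subseteq> A \<and> compact K}. emeasure circ K)"
    by (intro SUP_cong refl em) (auto intro: borel_compact)
  finally have sup: "emeasure circ A = \<dots>" .
  have "\<exists>K. K \<subseteq> A \<and> compact K \<and> measure circ A - e / 2 < measure circ K"
  proof (cases "measure circ A - e / 2 < 0")
    case True
    then show ?thesis by (intro exI[of _ "{}"]) auto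
  next
    case False
    have "ennreal (measure circ A - e / 2) < emeasure circ A"
      using e False by (simp add: circ.emeasure_eq_measure ennreal_less_iff)
    then obtain K where "K \<subseteq> A" "compact K" "ennreal (measure circ A - e / 2) < emeasure circ K"
      unfolding sup less_SUP_iff by auto
    then show ?thesis using False by (auto simp: circ.emeasure_eq_measure ennreal_less_iff)
  qed
  then obtain K where K: "K \<subseteq> A" "compact K" "measure circ A - e / 2 < measure circ K" by blast
  have Ks: "K \<in> sets circ" using K_sets K by blast
  show ?thesis
  proof (cases "K = {}")
    case True
    then have "measure circ A < e / 2" using K(3) by simp
    moreover have "(LINT z|circ. cmod (indicator A z - 0)) = measure circ A"
    proof -
      have "(LINT z|circ. cmod (indicator A z - 0)) = (LINT z|circ. indicator A z)"
        by (intro Bochner_Integration.integral_cong) (auto split: split_indicator)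
      then show ?thesis using A AS(1) by (simp add: Int_absorb2 del: sets_circ)
    qed
    ultimately show ?thesis using e by (intro exI[of _ "\<lambda>_. 0"]) auto
  next
    case False
    define f where "f n z = complex_of_real (max 0 (1 - real n * setdist {z} K))" for n z
    have cont: "continuous_on (sphere 0 1) (f n)" for n
      unfolding f_def by (intro continuous_intros continuous_on_setdist)
    have [measurable]: "f n \<in> borel_measurable circ" for n
      by (rule continuous_on_circ_measurable[OF cont])
    have [measurable]: "indicator A \<in> borel_measurable circ" "indicator K \<in> borel_measurable circ"
      using A Ks by (auto intro: borel_measurable_indicator simp del: sets_circ)
    have bd: "cmod (f n z) \<le> 1" for n z
      using setdist_pos_le[of "{z}" K] by (auto simp: f_def max_def)
    have ptw: "(\<lambda>n. f n z) \<longlonglongrightarrow> indicator K z" for z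
    proof (cases "z \<in> K")
      case True
      then show ?thesis by (simp add: f_def setdist_sing_in_set)
    next
      case nz: False
      have "setdist {z} K > 0"
        using nz K(2) False setdist_eq_0_sing_1[of z K] setdist_pos_le[of "{z}" K]
        by (auto simp: compact_imp_closed less_le)
      then obtain N where N: "1 < real N * setdist {z} K" using reals_Archimedean3 by blast
      have "f n z = 0" if "n \<ge> N" for n
      proof -
        have "real N * setdist {z} K \<le> real n * setdist {z} K"
          using that setdist_pos_le by (intro mult_right_mono) auto
        with N show ?thesis by (simp add: f_def)
      qed
      then have "(\<lambda>n. f n z) \<longlonglongrightarrow> 0"
        by (intro tendsto_eventually eventually_sequentiallyI[of N]) auto
      then show ?thesis using nz by simp
    qed
    have "(\<lambda>n. LINT z|circ. cmod (indicator K z - f n z)) \<longlonglongrightarrow> (LINT z|circ. 0)"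
    proof (rule integral_dominated_convergence[where w = "\<lambda>_. 2"])
      show "AE z in circ. (\<lambda>n. cmod (indicator K z - f n z)) \<longlonglongrightarrow> 0"
      proof (rule AE_I2)
        fix z
        have "(\<lambda>n. indicator K z - f n z) \<longlonglongrightarrow> indicator K z - indicator K z"
          by (intro tendsto_diff tendsto_const ptw)
        then show "(\<lambda>n. cmod (indicator K z - f n z)) \<longlonglongrightarrow> 0" by (simp add: tendsto_norm_zero)
      qed
      show "AE z in circ. norm (cmod (indicator K z - f n z)) \<le> 2" for n
      proof (rule AE_I2)
        fix z
        have "cmod (indicator K z - f n z) \<le> cmod (indicator K z) + cmod (f n z)" by (rule norm_triangle_ineq4)
        also have "\<dots> \<le> 2" using bd[of n z] by (auto split: split_indicator)
        finally show "norm (cmod (indicator K z - f n z)) \<le> 2" by simp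
      qed
    qed auto
    then obtain n where n: "(LINT z|circ. cmod (indicator K z - f n z)) < e / 2"
      using order_tendstoD(2)[of _ 0 sequentially "e / 2"] e
      by (auto simp: eventually_sequentially)
    have int: "integrable circ (f n)" "integrable circ (indicator A :: _ \<Rightarrow> complex)" "integrable circ (indicator K :: _ \<Rightarrow> complex)"
      by (intro integrable_circ_bounded[of _ 1]; auto simp: bd split: split_indicator)+
    have "(LINT z|circ. cmod (indicator A z - indicator K z)) = (LINT z|circ. indicator (A - K) z)"
      using K(1) by (intro Bochner_Integration.integral_cong) (auto split: split_indicator)
    also have "\<dots> = measure circ (A - K)"
      using A Ks AS(1) by (subst Bochner_Integration.integral_indicator)
        (auto simp del: sets_circ intro!: arg_cong[of _ _ "measure circ"])
    also have "\<dots> = measure circ A - measure circ K"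
      by (rule circ.finite_measure_Diff[OF A Ks K(1)])
    also have "\<dots> < e / 2" using K(3) by simp
    finally have "(LINT z|circ. cmod (indicator A z - f n z)) < e"
      using integral_norm_diff_triangle[OF int(2) int(3) int(1)] n by simp
    with cont show ?thesis by blast
  qed
qed

theorem trig_dense_L1:
  assumes "integrable circ f" and "e > 0"
  shows "\<exists>q. trig q \<and> (LINT z|circ. cmod (f z - q z)) < e"
  using assms
proof (induction arbitrary: e rule: integrable_induct)
  case (base A c)
  have "0 < e / (2 * (cmod c + 1))"
    using base(3) by (simp add: add_nonneg_pos)
  then obtain f where f: "continuous_on (sphere 0 1) f"
    "(LINT z|circ. cmod (indicator A z - f z)) < e / (2 * (cmod c + 1))"
    using continuous_approx_indicator_L1[OF base(1)] by blast
  have [measurable]: "f \<in> borel_measurable circ"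
    by (rule continuous_on_circ_measurable[OF f(1)])
  have cf: "continuous_on (sphere 0 1) (\<lambda>z. c * f z)"
    using f(1) by (intro continuous_intros)
  obtain q where q: "trig q" "(LINT z|circ. cmod (c * f z - q z)) < e / 2"
    using trig_approx_continuous_L1[OF cf, of "e / 2"] base(3) by auto
  have "bounded (f ` sphere 0 1)"
    using f(1) by (intro compact_imp_bounded compact_continuous_image) auto
  then obtain B where "\<forall>z\<in>sphere 0 1. cmod (f z) \<le> B" by (auto simp: bounded_iff)
  then have if_: "integrable circ f"
    by (intro integrable_circ_bounded[of _ B]) (auto intro!: AE_circ_sphere)
  have iA: "integrable circ (indicator A :: _ \<Rightarrow> complex)"
    by (rule integrable_circ_bounded[of _ 1])
       (use base(1) in \<open>auto simp del: sets_circ split: split_indicator\<close>)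
  have eq: "cmod (indicator A z *\<^sub>R c - c * f z) = cmod c * cmod (indicator A z - f z)" for z
    by (auto simp flip: norm_mult split: split_indicator simp: right_diff_distrib)
  have "(LINT z|circ. cmod (indicator A z *\<^sub>R c - c * f z)) = cmod c * (LINT z|circ. cmod (indicator A z - f z))"
    unfolding eq by simp
  also have "\<dots> \<le> cmod c * (e / (2 * (cmod c + 1)))"
    using f(2) by (intro mult_left_mono) auto
  also have "\<dots> \<le> e / 2"
    using base(3) norm_ge_zero[of c] by (simp add: divide_le_eq field_simps del: norm_ge_zero)
  finally have "(LINT z|circ. cmod (indicator A z *\<^sub>R c - q z)) < e"
    using integral_norm_diff_triangle[of circ "\<lambda>z. indicator A z *\<^sub>R c" "\<lambda>z. c * f z" q] q if_ base(1,2)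
      trig_integrable[OF q(1)] by (simp del: sets_circ)
  with q(1) show ?case by blast
next
  case (add f g)
  obtain p q where pq: "trig p" "(LINT z|circ. cmod (f z - p z)) < e / 2"
     "trig q" "(LINT z|circ. cmod (g z - q z)) < e / 2"
    using add.IH(1)[of "e / 2"] add.IH(2)[of "e / 2"] add.prems by auto
  note [simp] = trig_integrable[OF pq(1)] trig_integrable[OF pq(3)] add.hyps
  have "(LINT z|circ. cmod (f z + g z - (p z + q z))) \<le> (LINT z|circ. cmod (f z - p z) + cmod (g z - q z))"
    by (intro integral_mono) (auto intro: norm_diff_triangle_ineq)
  also have "\<dots> = (LINT z|circ. cmod (f z - p z)) + (LINT z|circ. cmod (g z - q z))"
    by (intro Bochner_Integration.integral_add) auto
  also have "\<dots> < e" using pq by simp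
  finally show ?case using trig_add[OF pq(1,3)] by blast
next
  case (lim f s)
  have "(\<lambda>i. LINT z|circ. cmod (f z - s i z)) \<longlonglongrightarrow> (LINT z|circ. 0)"
  proof (rule integral_dominated_convergence[where w = "\<lambda>z. 3 * cmod (f z)"])
    show "AE z in circ. (\<lambda>i. cmod (f z - s i z)) \<longlonglongrightarrow> 0"
    proof (rule AE_I2)
      fix z assume "z \<in> space circ"
      then have "(\<lambda>i. f z - s i z) \<longlonglongrightarrow> f z - f z" by (intro tendsto_diff tendsto_const lim)
      then show "(\<lambda>i. cmod (f z - s i z)) \<longlonglongrightarrow> 0" by (simp add: tendsto_norm_zero)
    qed
    show "AE z in circ. norm (cmod (f z - s i z)) \<le> 3 * cmod (f z)" for i
    proof (rule AE_I2)
      fix z assume "z \<in> space circ"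
      then have "cmod (s i z) \<le> 2 * cmod (f z)" by (rule lim)
      then show "norm (cmod (f z - s i z)) \<le> 3 * cmod (f z)"
        using norm_triangle_ineq4[of "f z" "s i z"] by simp
    qed
  qed (use lim in auto)
  then have "eventually (\<lambda>i. (LINT z|circ. cmod (f z - s i z)) < e / 2) sequentially"
    using lim.prems by (intro order_tendstoD(2)[of _ 0]) auto
  then obtain i where i: "(LINT z|circ. cmod (f z - s i z)) < e / 2"
    by (auto simp: eventually_sequentially)
  obtain q where q: "trig q" "(LINT z|circ. cmod (s i z - q z)) < e / 2"
    using lim.IH[of "e / 2" i] lim.prems by auto
  have "(LINT z|circ. cmod (f z - q z)) < e"
    using integral_norm_diff_triangle[of circ f "s i" q] i q lim trig_integrable[OF q(1)] by simp
  with q(1) show ?case by blast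
qed

text \<open>The approximants of a function with values in the unit disc can be kept in the unit disc:
  the metric projection of the plane onto the disc is nonexpansive, so it spoils neither
  continuity nor the quality of an approximation; a final factor close to \<open>1\<close> makes room for the
  error of a uniform approximation.\<close>

lemma trig_approx_bounded_L1:
  assumes h: "h \<in> borel_measurable circ" "\<And>z. cmod z = 1 \<Longrightarrow> cmod (h z) \<le> 1" and e: "e > 0"
  shows "\<exists>q. trig q \<and> (\<forall>z. cmod z = 1 \<longrightarrow> cmod (q z) \<le> 1) \<and> (LINT z|circ. cmod (h z - q z)) < e"
proof -
  have ih: "integrable circ h"
    by (rule integrable_circ_bounded[of _ 1]) (auto intro: h AE_circ_sphere)
  obtain p where p: "trig p" "(LINT z|circ. cmod (h z - p z)) < e / 2"
    using trig_dense_L1[OF ih, of "e / 2"] e by auto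
  define P where "P = closest_point (cball (0::complex) 1)"
  have P_lip: "cmod (P x - P y) \<le> cmod (x - y)" for x y
    using closest_point_lipschitz[of "cball (0::complex) 1" x y] by (simp add: P_def dist_norm)
  have P_id: "P x = x" if "cmod x \<le> 1" for x
    using that closest_point_self[of x "cball 0 1"] by (simp add: P_def)
  have P_bd: "cmod (P x) \<le> 1" for x
    using closest_point_in_set[of "cball (0::complex) 1" x] by (simp add: P_def)
  obtain N c where Nc: "\<forall>z. cmod z = 1 \<longrightarrow> p z = trig_sum N c z"
    using p(1) unfolding trig_def by metis
  have "continuous_on (sphere 0 1) (trig_sum N c)"
    unfolding trig_sum_def[abs_def] by (intro continuous_intros) auto
  then have "continuous_on (sphere 0 1) p"
    by (rule continuous_on_eq) (use Nc in auto)
  then have cP: "continuous_on (sphere 0 1) (\<lambda>z. P (p z))"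
    unfolding P_def using continuous_on_closest_point[of "cball (0::complex) 1" UNIV]
    by (auto intro: continuous_on_compose2)
  define d where "d = min (e / 8) 1"
  have d: "0 < d" "d \<le> 1" "d \<le> e / 8" using e by (auto simp: d_def)
  obtain q0 where q0: "trig q0" "\<And>z. cmod z = 1 \<Longrightarrow> cmod (P (p z) - q0 z) < d"
    using continuous_trig_approx[OF cP d(1)] by blast
  define q where "q z = of_real (1 - d) * q0 z" for z
  have tq: "trig q" unfolding q_def by (rule trig_cmult[OF q0(1)])
  have q0b: "cmod (q0 z) < 1 + d" if "cmod z = 1" for z
    using q0(2)[OF that] P_bd[of "p z"] norm_triangle_ineq2[of "q0 z" "P (p z)"]
    by (simp add: norm_minus_commute)
  have qb: "cmod (q z) \<le> 1" if "cmod z = 1" for z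
  proof -
    have "cmod (q z) = (1 - d) * cmod (q0 z)" using d by (simp add: q_def norm_mult del: of_real_diff)
    also have "\<dots> \<le> (1 - d) * (1 + d)" using d q0b[OF that] by (intro mult_left_mono) auto
    also have "\<dots> \<le> 1" using d by (simp add: algebra_simps)
    finally show ?thesis .
  qed
  have close: "cmod (h z - q z) \<le> cmod (h z - p z) + 3 * d" if z: "cmod z = 1" for z
  proof -
    have "q0 z - q z = of_real d * q0 z" by (simp add: q_def algebra_simps)
    then have "cmod (q0 z - q z) = d * cmod (q0 z)" using d by (simp add: norm_mult)
    also have "\<dots> \<le> d * 2" using d q0b[OF z] by (intro mult_left_mono) auto
    finally have 1: "cmod (q0 z - q z) \<le> 2 * d" by simp
    have 2: "cmod (h z - P (p z)) \<le> cmod (h z - p z)"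
      using P_lip[of "h z" "p z"] P_id[OF h(2)[OF z]] by simp
    have "h z - q z = (h z - P (p z)) + (P (p z) - q0 z) + (q0 z - q z)" by simp
    then have "cmod (h z - q z) \<le> cmod (h z - P (p z)) + cmod (P (p z) - q0 z) + cmod (q0 z - q z)"
      by (metis norm_triangle_mono norm_triangle_ineq order_refl)
    then show ?thesis using 1 2 q0(2)[OF z] by linarith
  qed
  have "(LINT z|circ. cmod (h z - q z)) \<le> (LINT z|circ. cmod (h z - p z) + 3 * d)"
    by (intro integral_mono) (auto intro: close simp: ih trig_integrable p(1) tq)
  also have "\<dots> = (LINT z|circ. cmod (h z - p z)) + 3 * d"
    by (subst Bochner_Integration.integral_add) (auto simp: ih trig_integrable p(1))
  also have "\<dots> < e" using p(2) d e by simp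
  finally show ?thesis using tq qb by blast
qed

lemma bounded_trig_approx_AE:
  assumes h: "h \<in> borel_measurable circ" "\<And>z. cmod z = 1 \<Longrightarrow> cmod (h z) \<le> 1"
  shows "\<exists>q. (\<forall>n. trig (q n) \<and> (\<forall>z. cmod z = 1 \<longrightarrow> cmod (q n z) \<le> 1)) \<and> (AE z in circ. (\<lambda>n. q n z) \<longlonglongrightarrow> h z)"
proof -
  have "\<exists>q. trig q \<and> (\<forall>z. cmod z = 1 \<longrightarrow> cmod (q z) \<le> 1) \<and> (LINT z|circ. cmod (h z - q z)) < inverse (real (Suc n))" for n
    by (rule trig_approx_bounded_L1) (use h in auto)
  then obtain q where q: "\<And>n. trig (q n)" "\<And>n z. cmod z = 1 \<Longrightarrow> cmod (q n z) \<le> 1"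
    "\<And>n. (LINT z|circ. cmod (h z - q n z)) < inverse (real (Suc n))" by metis
  have ih: "integrable circ h"
    by (rule integrable_circ_bounded[of _ 1]) (auto intro: h AE_circ_sphere)
  have "(\<lambda>n. LINT z|circ. cmod (h z - q n z)) \<longlonglongrightarrow> 0"
    by (rule tendsto_sandwich[OF _ _ tendsto_const LIMSEQ_inverse_real_of_nat])
       (use q(3) in \<open>auto intro!: always_eventually less_imp_le\<close>)
  then obtain r where r: "strict_mono r" "AE z in circ. (\<lambda>n. h z - q (r n) z) \<longlonglongrightarrow> 0"
    using tendsto_L1_AE_subseq[of circ "\<lambda>n z. h z - q n z"] ih trig_integrable[OF q(1)] by auto
  have "AE z in circ. (\<lambda>n. q (r n) z) \<longlonglongrightarrow> h z"
    using r(2)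
  proof eventually_elim
    case (elim z)
    from tendsto_diff[OF tendsto_const[of "h z"] elim] show ?case by simp
  qed
  then show ?thesis using q(1,2) by (intro exI[of _ "\<lambda>n. q (r n)"]) auto
qed

lemma integral_bounded_limit:
  fixes f :: "complex \<Rightarrow> complex"
  assumes f: "integrable circ f"
    and q: "\<And>n. q n \<in> borel_measurable circ" "\<And>n z. cmod z = 1 \<Longrightarrow> cmod (q n z) \<le> 1"
    and h: "h \<in> borel_measurable circ" and lim: "AE z in circ. (\<lambda>n. q n z) \<longlonglongrightarrow> h z"
  shows "(\<lambda>n. LINT z|circ. f z * q n z) \<longlonglongrightarrow> (LINT z|circ. f z * h z)"
proof (rule integral_dominated_convergence[where w = "\<lambda>z. cmod (f z)"])
  note [measurable] = q(1) h borel_measurable_integrable[OF f]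
  show "(\<lambda>z. f z * h z) \<in> borel_measurable circ" "\<And>n. (\<lambda>z. f z * q n z) \<in> borel_measurable circ"
    by measurable
  show "AE z in circ. (\<lambda>n. f z * q n z) \<longlonglongrightarrow> f z * h z"
    using lim by eventually_elim (intro tendsto_intros)
  show "AE z in circ. norm (f z * q n z) \<le> cmod (f z)" for n
    by (rule AE_circ_sphere) (simp add: norm_mult mult_left_le q(2))
qed (use f in auto)

text \<open>The norm of \<open>f\<close> in \<open>L1\<close> is the pairing of \<open>f\<close> with \<open>cnj (sgn f)\<close>. Replacing this bounded function by
  trigonometric polynomials makes the norm visible to pairings that involve only finitely many Fourier
  coefficients of \<open>f\<close>.\<close>

lemma trig_norming:
  assumes f: "integrable circ f" and K: "K < (LINT z|circ. cmod (f z))"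
  shows "\<exists>q. trig q \<and> (\<forall>z. cmod z = 1 \<longrightarrow> cmod (q z) \<le> 1) \<and> K < cmod (LINT z|circ. f z * q z)"
proof -
  define h where "h z = cnj (f z) / of_real (cmod (f z))" for z
  note [measurable] = borel_measurable_integrable[OF f]
  have mh [measurable]: "h \<in> borel_measurable circ"
    unfolding h_def by measurable
  have hb: "cmod (h z) \<le> 1" for z by (simp add: h_def norm_divide)
  have fh: "f z * h z = of_real (cmod (f z))" for z
    by (cases "f z = 0") (simp_all add: h_def mult_ac power2_eq_square flip: complex_norm_square)
  obtain q where q: "\<And>n. trig (q n)" "\<And>n z. cmod z = 1 \<Longrightarrow> cmod (q n z) \<le> 1"
     "AE z in circ. (\<lambda>n. q n z) \<longlonglongrightarrow> h z"
    using bounded_trig_approx_AE[OF mh hb] by metis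
  have "(\<lambda>n. LINT z|circ. f z * q n z) \<longlonglongrightarrow> (LINT z|circ. f z * h z)"
    by (rule integral_bounded_limit[OF f trig_measurable[OF q(1)] q(2) mh q(3)])
  then have "(\<lambda>n. cmod (LINT z|circ. f z * q n z)) \<longlonglongrightarrow> cmod (LINT z|circ. f z * h z)"
    by (rule tendsto_norm)
  moreover have "(LINT z|circ. f z * h z) = of_real (LINT z|circ. cmod (f z))"
    unfolding fh by (rule integral_complex_of_real)
  ultimately have "(\<lambda>n. cmod (LINT z|circ. f z * q n z)) \<longlonglongrightarrow> (LINT z|circ. cmod (f z))"
    by (simp add: integral_nonneg_AE)
  then have "eventually (\<lambda>n. K < cmod (LINT z|circ. f z * q n z)) sequentially"
    by (rule order_tendstoD(1)[OF _ K])
  then obtain n where "K < cmod (LINT z|circ. f z * q n z)" by (auto simp: eventually_sequentially)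
  then show ?thesis using q by blast
qed

lemma integral_times_trig_sum:
  assumes "integrable circ f"
  shows "(LINT z|circ. f z * trig_sum N c z) = (\<Sum>n = - int N..int N. c n * (LINT z|circ. f z * z powi n))"
proof -
  have i: "integrable circ (\<lambda>z. f z * z powi n)" for n
    by (rule Bochner_Integration.integrable_bound[OF integrable_norm[OF assms]])
       (use assms in \<open>auto intro!: AE_circ_sphere simp: norm_mult norm_powi_sphere\<close>)
  have "(LINT z|circ. f z * trig_sum N c z) = (LINT z|circ. (\<Sum>n = - int N..int N. c n * (f z * z powi n)))"
    unfolding trig_sum_def by (simp add: sum_distrib_left mult_ac)
  also have "\<dots> = (\<Sum>n = - int N..int N. c n * (LINT z|circ. f z * z powi n))"
    by (subst Bochner_Integration.integral_sum) (auto simp: i)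
  finally show ?thesis .
qed

theorem fourier_uniqueness:
  assumes f: "integrable circ f" and 0: "\<And>n. (LINT z|circ. f z * z powi n) = 0"
  shows "AE z in circ. f z = 0"
proof -
  have "(LINT z|circ. cmod (f z)) \<le> 0"
  proof (rule ccontr)
    assume "\<not> (LINT z|circ. cmod (f z)) \<le> 0"
    then obtain q where q: "trig q" "0 < cmod (LINT z|circ. f z * q z)"
      using trig_norming[OF f, of 0] by auto
    obtain N c where Nc: "\<forall>z. cmod z = 1 \<longrightarrow> q z = trig_sum N c z"
      using q(1) unfolding trig_def by metis
    have "(LINT z|circ. f z * q z) = (LINT z|circ. f z * trig_sum N c z)"
      by (rule Bochner_Integration.integral_cong) (use Nc in auto)
    also have "\<dots> = 0" by (subst integral_times_trig_sum[OF f]) (simp add: 0)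
    finally show False using q(2) by simp
  qed
  then have "(LINT z|circ. cmod (f z)) = 0" by (simp add: order_antisym integral_nonneg_AE)
  then show ?thesis
    using integral_nonneg_eq_0_iff_AE[of circ "\<lambda>z. cmod (f z)"] f by auto
qed

section \<open>Representatives and the space of integrable classes\<close>

lemma rep_measurable [measurable]: "rep_class f \<in> borel_measurable circ"
  using Quotient_rep_reflp[OF Quotient_l0, of f] by (simp add: ae_eq_def)

lemma class_of_rep [simp]: "class_of (rep_class f) = f"
  by (rule Quotient_abs_rep[OF Quotient_l0])

lemma ae_eq_refl: "F \<in> borel_measurable circ \<Longrightarrow> ae_eq F F"
  by (simp add: ae_eq_def)

lemma rep_class_of: "F \<in> borel_measurable circ \<Longrightarrow> AE z in circ. rep_class (class_of F) z = F z"
  using Quotient_rep_abs[OF Quotient_l0 ae_eq_refl] by (auto simp: ae_eq_def)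

lemma l0_eqI: "(AE z in circ. rep_class f z = rep_class g z) \<Longrightarrow> f = g"
  using Quotient_rel_rep[OF Quotient_l0, of f g] by (auto simp: ae_eq_def)

lemma l0_class_eqI:
  "F \<in> borel_measurable circ \<Longrightarrow> (AE z in circ. rep_class f z = F z) \<Longrightarrow> f = class_of F"
  by (rule l0_eqI, drule rep_class_of, erule (1) eventually_elim2) simp

lemma rep_plus: "AE z in circ. rep_class (f + g) z = rep_class f z + rep_class g z"
  using rep_class_of[of "\<lambda>z. rep_class f z + rep_class g z"]
    plus_l0.abs_eq[OF ae_eq_refl ae_eq_refl, OF rep_measurable[of f] rep_measurable[of g]] by simp

lemma rep_minus: "AE z in circ. rep_class (f - g) z = rep_class f z - rep_class g z"
  using rep_class_of[of "\<lambda>z. rep_class f z - rep_class g z"]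
    minus_l0.abs_eq[OF ae_eq_refl ae_eq_refl, OF rep_measurable[of f] rep_measurable[of g]] by simp

lemma rep_times: "AE z in circ. rep_class (f * g) z = rep_class f z * rep_class g z"
  using rep_class_of[of "\<lambda>z. rep_class f z * rep_class g z"]
    times_l0.abs_eq[OF ae_eq_refl ae_eq_refl, OF rep_measurable[of f] rep_measurable[of g]] by simp

lemma rep_scale: "AE z in circ. rep_class (scale c f) z = c * rep_class f z"
  using rep_class_of[of "\<lambda>z. c * rep_class f z"]
    scale.abs_eq[OF ae_eq_refl, OF rep_measurable[of f]] by simp

lemma rep_modulus: "AE z in circ. rep_class (modulus f) z = of_real (cmod (rep_class f z))"
  using rep_class_of[of "\<lambda>z. complex_of_real (cmod (rep_class f z))"]
    modulus.abs_eq[OF ae_eq_refl, OF rep_measurable[of f]] by simp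

lemma rep_zero: "AE z in circ. rep_class 0 z = 0"
  using rep_class_of[of "\<lambda>z. 0"] by (simp add: zero_l0_def)

lemma rep_one: "AE z in circ. rep_class 1 z = 1"
  using rep_class_of[of "\<lambda>z. 1"] by (simp add: one_l0_def)

lemma scale_1: "scale c 1 * f = scale c f"
  by (rule l0_eqI) (use rep_times[of "scale c 1" f] rep_scale[of c 1] rep_one rep_scale[of c f] in \<open>eventually_elim, simp\<close>)

lemma scale_mult_left: "scale c (f * g) = scale c f * g"
  by (metis scale_1 mult.assoc)

lemma scale_mult_right: "scale c (f * g) = f * scale c g"
  by (metis scale_mult_left mult.commute)

definition norm_L1 :: "l0 \<Rightarrow> real" where "norm_L1 f = (LINT z|circ. cmod (rep_class f z))"
definition L1 :: "l0 set" where "L1 = {f. integrable circ (rep_class f)}"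
definition H1 :: "l0 set" where "H1 = {f \<in> L1. \<forall>n<0. fourier f n = 0}"

lemma L1_D: "f \<in> L1 \<Longrightarrow> integrable circ (rep_class f)"
  by (simp add: L1_def)

lemma L1_AE: "integrable circ F \<Longrightarrow> (AE z in circ. rep_class f z = F z) \<Longrightarrow> f \<in> L1"
  unfolding L1_def by (auto intro: integrable_cong_AE_imp elim: eventually_mono)

lemma L1_diff: "f \<in> L1 \<Longrightarrow> g \<in> L1 \<Longrightarrow> f - g \<in> L1"
  by (rule L1_AE[OF _ rep_minus]) (simp add: L1_D)

lemma fourier_eq: "fourier f n = (LINT z|circ. rep_class f z * z powi (- n))"
  by (simp add: fourier.rep_eq)

lemma integrable_mult_powi:
  assumes "integrable circ f" shows "integrable circ (\<lambda>z. f z * z powi n)"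
  by (rule Bochner_Integration.integrable_bound[OF integrable_norm[OF assms]])
     (use assms in \<open>auto intro!: AE_circ_sphere simp: norm_mult norm_powi_sphere\<close>)

lemma fourier_diff:
  assumes "f \<in> L1" "g \<in> L1" shows "fourier (f - g) n = fourier f n - fourier g n"
proof -
  have "fourier (f - g) n = (LINT z|circ. rep_class f z * z powi (- n) - rep_class g z * z powi (- n))"
    unfolding fourier_eq
    by (rule integral_cong_AE)
       (use rep_minus[of f g] in \<open>auto elim!: eventually_mono simp: left_diff_distrib\<close>)
  also have "\<dots> = fourier f n - fourier g n"
    unfolding fourier_eq
    by (intro Bochner_Integration.integral_diff integrable_mult_powi L1_D assms)
  finally show ?thesis .
qed

lemma cmod_fourier_le:
  assumes "f \<in> L1" shows "cmod (fourier f n) \<le> norm_L1 f"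
proof -
  have "cmod (fourier f n) \<le> (LINT z|circ. cmod (rep_class f z * z powi (- n)))"
    unfolding fourier_eq by (rule integral_norm_bound)
  also have "\<dots> = norm_L1 f"
    unfolding norm_L1_def
    by (intro Bochner_Integration.integral_cong) (auto simp: norm_mult norm_powi_sphere)
  finally show ?thesis .
qed

lemma fourier_L1_lim:
  assumes "\<And>n. g n \<in> L1" "f \<in> L1" "(\<lambda>n. norm_L1 (g n - f)) \<longlonglongrightarrow> 0"
  shows "(\<lambda>n. fourier (g n) j) \<longlonglongrightarrow> fourier f j"
proof -
  have "(\<lambda>n. fourier (g n) j - fourier f j) \<longlonglongrightarrow> 0"
    by (rule Lim_null_comparison[OF _ assms(3)])
       (use cmod_fourier_le[OF L1_diff[OF assms(1,2)]] fourier_diff[OF assms(1,2)] in auto)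
  then show ?thesis by (simp add: LIM_zero_iff)
qed

lemma fourier_eqI:
  assumes "f \<in> L1" "g \<in> L1" "\<And>n. fourier f n = fourier g n" shows "f = g"
proof -
  have "AE z in circ. rep_class (f - g) z = 0"
  proof (rule fourier_uniqueness)
    show "integrable circ (rep_class (f - g))" by (intro L1_D L1_diff assms)
    show "(LINT z|circ. rep_class (f - g) z * z powi n) = 0" for n
      using fourier_diff[OF assms(1,2), of "- n"] assms(3)[of "- n"] by (simp add: fourier_eq)
  qed
  then have "f - g = 0" by (intro l0_eqI) (use rep_zero in \<open>auto elim: eventually_elim2\<close>)
  then show ?thesis by simp
qed

lemma zero_if_fourier_zero: "f \<in> L1 \<Longrightarrow> (\<And>n. fourier f n = 0) \<Longrightarrow> f = 0"
  by (rule fourier_eqI) (auto simp: fourier_eq L1_def intro: L1_AE[of "\<lambda>_. 0"] integral_eq_zero_AE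
       integrable_cong_AE_imp[of _ "\<lambda>_. 0"] intro!: eventually_mono[OF rep_zero])

lemma norm_L1_nonneg: "0 \<le> norm_L1 f"
  by (simp add: norm_L1_def)

lemma norm_L1_eq_0: assumes "f \<in> L1" "norm_L1 f = 0" shows "f = 0"
  using cmod_fourier_le[OF assms(1)] assms by (intro zero_if_fourier_zero) auto

lemma L1_lim_unique:
  assumes "\<And>n. g n \<in> L1" "a \<in> L1" "b \<in> L1"
    "(\<lambda>n. norm_L1 (g n - a)) \<longlonglongrightarrow> 0" "(\<lambda>n. norm_L1 (g n - b)) \<longlonglongrightarrow> 0"
  shows "a = b"
proof (rule fourier_eqI)
  show "fourier a n = fourier b n" for n
    by (rule LIMSEQ_unique[OF fourier_L1_lim[OF assms(1,2,4)] fourier_L1_lim[OF assms(1,3,5)]])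
qed fact+

text \<open>The monomials, which act on classes by multiplication as the powers of \<open>T_z\<close>.\<close>

definition zp :: "int \<Rightarrow> l0" where "zp n = class_of (\<lambda>z. z powi n)"

lemma rep_zp: "AE z in circ. rep_class (zp n) z = z powi n"
  unfolding zp_def by (rule rep_class_of) measurable

lemma T_z_zp: "T_z f = zp 1 * f"
  by (simp add: T_z_def zp_def)

lemma zp_add: "zp (m + n) = zp m * zp n"
proof (rule l0_eqI)
  have "AE z in circ. z \<noteq> (0 :: complex)" by (rule AE_circ_sphere) auto
  with rep_zp[of "m + n"] rep_times[of "zp m" "zp n"] rep_zp[of m] rep_zp[of n]
  show "AE z in circ. rep_class (zp (m + n)) z = rep_class (zp m * zp n) z"
    by eventually_elim (simp add: power_int_add)
qed

lemma zp_0 [simp]: "zp 0 = 1"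
  by (simp add: zp_def one_l0_def)

lemma rep_zp_mult: "AE z in circ. rep_class (zp n * f) z = rep_class f z * z powi n"
  using rep_zp[of n] rep_times[of "zp n" f] by eventually_elim simp

lemma fourier_zp_mult: "fourier (zp m * f) n = fourier f (n - m)"
  unfolding fourier_eq
proof (rule integral_cong_AE)
  have "AE z in circ. z \<noteq> (0 :: complex)" by (rule AE_circ_sphere) auto
  with rep_zp_mult[of m f]
  show "AE z in circ. rep_class (zp m * f) z * z powi - n = rep_class f z * z powi - (n - m)"
    by eventually_elim (simp flip: power_int_add)
qed measurable

section \<open>Rotationally symmetric norms dominate the norm of \<open>L1\<close>\<close>

lemma Linf_iff: "f \<in> Linf \<longleftrightarrow> (\<exists>C. AE z in circ. cmod (rep_class f z) \<le> C)"
  by (simp add: Linf_def bounded_l0.rep_eq)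

lemma Linf_class_of:
  assumes "F \<in> borel_measurable circ" "AE z in circ. cmod (F z) \<le> C" shows "class_of F \<in> Linf"
  unfolding Linf_iff
  by (rule exI[of _ C]) (use rep_class_of[OF assms(1)] assms(2) in \<open>eventually_elim, simp\<close>)

lemma Linf_scale: assumes "f \<in> Linf" shows "scale c f \<in> Linf"
proof -
  obtain C where "AE z in circ. cmod (rep_class f z) \<le> C" using assms by (auto simp: Linf_iff)
  with rep_scale[of c f] have "AE z in circ. cmod (rep_class (scale c f) z) \<le> cmod c * C"
    by eventually_elim (simp add: norm_mult mult_left_mono)
  then show ?thesis by (auto simp: Linf_iff)
qed

lemma Linf_add: assumes "f \<in> Linf" "g \<in> Linf" shows "f + g \<in> Linf"
proof -
  obtain C D where "AE z in circ. cmod (rep_class f z) \<le> C" "AE z in circ. cmod (rep_class g z) \<le> D"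
    using assms by (auto simp: Linf_iff)
  with rep_plus[of f g] have "AE z in circ. cmod (rep_class (f + g) z) \<le> C + D"
    by eventually_elim (simp add: norm_triangle_mono)
  then show ?thesis by (auto simp: Linf_iff)
qed

lemma Linf_L1: "f \<in> Linf \<Longrightarrow> f \<in> L1"
  unfolding Linf_iff L1_def by (auto intro: integrable_circ_bounded)

lemma modulus_le_iff: "modulus_le f g \<longleftrightarrow> (AE z in circ. cmod (rep_class f z) \<le> cmod (rep_class g z))"
  by (simp add: modulus_le.rep_eq)

context rotsym_norm
begin

text \<open>If \<open>0 \<le> f \<le> g\<close> then \<open>f\<close> is the mean of the two functions \<open>f \<plusminus> \<i> sqrt (g\<^sup>2 - f\<^sup>2)\<close>, both of
  modulus \<open>g\<close>.\<close>

lemma norm_mono: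
  assumes f: "f \<in> Linf" and g: "g \<in> Linf" and le: "modulus_le f g"
  shows "\<alpha> f \<le> \<alpha> g"
proof -
  define F G where "F z = cmod (rep_class f z)" and "G z = cmod (rep_class g z)" for z
  define D where "D z = sqrt ((G z)\<^sup>2 - (F z)\<^sup>2)" for z
  have [measurable]: "F \<in> borel_measurable circ" "G \<in> borel_measurable circ" "D \<in> borel_measurable circ"
    unfolding F_def G_def D_def by measurable
  define a b where "a = class_of (\<lambda>z. Complex (F z) (D z))" and "b = class_of (\<lambda>z. Complex (F z) (- D z))"
  have [measurable]: "(\<lambda>z. Complex (F z) (D z)) \<in> borel_measurable circ" "(\<lambda>z. Complex (F z) (- D z)) \<in> borel_measurable circ"
    unfolding complex_eq Complex_eq by measurable
  have ra: "AE z in circ. rep_class a z = Complex (F z) (D z)"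
    and rb: "AE z in circ. rep_class b z = Complex (F z) (- D z)"
    unfolding a_def b_def by (rule rep_class_of; measurable)+
  have le': "AE z in circ. F z \<le> G z" using le by (simp add: modulus_le_iff F_def G_def)
  have mod: "cmod (Complex x (sqrt (y\<^sup>2 - x\<^sup>2))) = y" "cmod (Complex x (- sqrt (y\<^sup>2 - x\<^sup>2))) = y"
    if "0 \<le> x" "x \<le> y" for x y
    using that by (simp_all add: complex_norm power_mono)
  have ma: "modulus a = modulus g"
    by (rule l0_eqI) (use rep_modulus[of a] rep_modulus[of g] ra le' in
      \<open>eventually_elim, simp add: D_def mod F_def G_def\<close>)
  have mb: "modulus b = modulus g"
    by (rule l0_eqI) (use rep_modulus[of b] rep_modulus[of g] rb le' in
      \<open>eventually_elim, simp add: D_def mod F_def G_def\<close>)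
  obtain C where C: "AE z in circ. cmod (rep_class g z) \<le> C" using g by (auto simp: Linf_iff)
  have a: "a \<in> Linf"
    unfolding Linf_iff by (rule exI[of _ C]) (use C ra le' in \<open>eventually_elim, simp add: D_def mod F_def G_def\<close>)
  have b: "b \<in> Linf"
    unfolding Linf_iff by (rule exI[of _ C]) (use C rb le' in \<open>eventually_elim, simp add: D_def mod F_def G_def\<close>)
  have f_eq: "modulus f = scale (1 / 2) (a + b)"
    by (rule l0_eqI) (use rep_modulus[of f] rep_scale[of "1 / 2" "a + b"] rep_plus[of a b] ra rb in
      \<open>eventually_elim, simp add: F_def complex_eq_iff\<close>)
  have "\<alpha> f = \<alpha> (scale (1 / 2) (a + b))" using modulus_invariant[OF f] f_eq by simp
  also have "\<dots> = \<alpha> (a + b) / 2" by (subst homogeneous) (simp_all add: Linf_add a b)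
  also have "\<dots> \<le> (\<alpha> a + \<alpha> b) / 2" using triangle[OF a b] by simp
  also have "\<alpha> a = \<alpha> g" using modulus_invariant[OF a] modulus_invariant[OF g] ma by simp
  also have "\<alpha> b = \<alpha> g" using modulus_invariant[OF b] modulus_invariant[OF g] mb by simp
  finally show ?thesis by simp
qed

lemma norm_sum_rotations:
  assumes [measurable]: "F \<in> borel_measurable circ" and C: "\<And>z. cmod z = 1 \<Longrightarrow> cmod (F z) \<le> C"
    and w: "\<And>k. cmod (w k) = 1"
  shows "\<alpha> (class_of (\<lambda>z. \<Sum>k<n. F (w k * z))) \<le> real n * \<alpha> (class_of F)"
proof -
  have m [measurable]: "(\<lambda>z. F (w k * z)) \<in> borel_measurable circ" for k
    by (rule measurable_compose[OF measurable_rotation[OF w] assms(1)])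
  have FL: "class_of F \<in> Linf" by (rule Linf_class_of[of _ C]) (auto intro: AE_circ_sphere C)
  have FkL: "class_of (\<lambda>z. F (w k * z)) \<in> Linf" for k
    by (rule Linf_class_of[of _ C]) (auto intro!: AE_circ_sphere C simp: norm_mult w)
  show ?thesis
  proof (induction n)
    case 0
    have "class_of (\<lambda>z. 0) = 0" by (simp add: zero_l0_def)
    moreover have "0 \<in> Linf" by (auto simp: Linf_iff intro!: exI[of _ 0] eventually_mono[OF rep_zero])
    ultimately show ?case using definite[of 0] by simp
  next
    case (Suc n)
    have SL: "class_of (\<lambda>z. \<Sum>k<n. F (w k * z)) \<in> Linf"
    proof (rule Linf_class_of[of _ "real n * C"])
      show "AE z in circ. cmod (\<Sum>k<n. F (w k * z)) \<le> real n * C"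
        by (rule AE_circ_sphere, rule order_trans[OF norm_sum], rule order_trans[OF sum_bounded_above[of _ _ C]])
           (auto intro!: C simp: norm_mult w)
    qed measurable
    have "class_of (\<lambda>z. \<Sum>k<Suc n. F (w k * z)) = class_of (\<lambda>z. \<Sum>k<n. F (w k * z)) + class_of (\<lambda>z. F (w n * z))"
      by (subst plus_l0.abs_eq) (auto intro!: ae_eq_refl)
    then have "\<alpha> (class_of (\<lambda>z. \<Sum>k<Suc n. F (w k * z)))
        \<le> \<alpha> (class_of (\<lambda>z. \<Sum>k<n. F (w k * z))) + \<alpha> (class_of (\<lambda>z. F (w n * z)))"
      using triangle[OF SL FkL[of n]] by simp
    also have "\<alpha> (class_of (\<lambda>z. F (w n * z))) = \<alpha> (class_of F)"
      using rotation_invariant[OF assms(1) FL, of "cnj (w n)"] w by simp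
    finally show ?case using Suc by (simp add: algebra_simps)
  qed
qed

end

lemma sum_roots_powi:
  assumes "0 < n" "\<bar>j\<bar> < int n" "j \<noteq> 0"
  shows "(\<Sum>k<n. cis (2 * pi * real k / real n) powi j) = 0"
proof -
  define \<zeta> where "\<zeta> = cis (2 * pi * of_int j / real n)"
  have "\<zeta> \<noteq> 1"
  proof
    assume "\<zeta> = 1"
    then have "cos (2 * pi * of_int j / real n) = 1" by (simp add: \<zeta>_def complex_eq_iff)
    then obtain m :: int where "2 * pi * of_int j / real n = of_int m * (2 * pi)"
      unfolding cos_one_2pi_int by auto
    then have "real_of_int j = of_int (m * int n)" using assms(1) by (simp add: field_simps)
    then have "j = m * int n" by (simp only: of_int_eq_iff)
    with assms show False by (auto simp: abs_mult zero_less_mult_iff mult_less_cancel_right2)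
  qed
  have "\<zeta> ^ n = cis (2 * pi * of_int j)"
    using assms(1) by (simp add: \<zeta>_def Complex.DeMoivre)
  also have "\<dots> = 1" by (rule cis_multiple_2pi) simp
  finally have "\<zeta> ^ n = 1" .
  have "(\<Sum>k<n. cis (2 * pi * real k / real n) powi j) = (\<Sum>k<n. \<zeta> ^ k)"
    by (rule sum.cong) (auto simp: \<zeta>_def cis_power_int Complex.DeMoivre field_simps)
  also have "\<dots> = 0" using \<open>\<zeta> \<noteq> 1\<close> \<open>\<zeta> ^ n = 1\<close> by (simp add: geometric_sum)
  finally show ?thesis .
qed

text \<open>Averaging over the rotations by the \<open>n\<close>-th roots of unity annihilates every frequency that is not
  a multiple of \<open>n\<close>, and for \<open>n\<close> above the degree only the constant term survives.\<close>

lemma trig_average_roots: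
  assumes "trig p"
  shows "\<exists>n>0. \<forall>z. cmod z = 1 \<longrightarrow>
    (\<Sum>k<n. p (cis (2 * pi * real k / real n) * z)) = of_nat n * (LINT z|circ. p z)"
proof -
  obtain N c where p: "\<And>z. cmod z = 1 \<Longrightarrow> p z = trig_sum N c z"
    using assms unfolding trig_def by metis
  define n where "n = Suc N"
  have "(LINT z|circ. p z) = (LINT z|circ. 1 * trig_sum N c z)"
    by (rule Bochner_Integration.integral_cong) (auto simp: p)
  also have "\<dots> = (\<Sum>j = - int N..int N. c j * (if j = 0 then 1 else 0))"
    by (subst integral_times_trig_sum) (auto simp: integral_powi)
  also have "\<dots> = c 0" by (subst sum.remove[of _ 0]) auto
  finally have I: "(LINT z|circ. p z) = c 0" .
  have "(\<Sum>k<n. p (cis (2 * pi * real k / real n) * z)) = of_nat n * c 0" if z: "cmod z = 1" for z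
  proof -
    have "(\<Sum>k<n. p (cis (2 * pi * real k / real n) * z))
        = (\<Sum>k<n. \<Sum>j = - int N..int N. c j * z powi j * cis (2 * pi * real k / real n) powi j)"
      by (rule sum.cong) (auto simp: p z norm_mult trig_sum_def power_int_mult_distrib mult_ac)
    also have "\<dots> = (\<Sum>j = - int N..int N. c j * z powi j * (\<Sum>k<n. cis (2 * pi * real k / real n) powi j))"
      by (subst sum.swap) (simp add: sum_distrib_left)
    also have "\<dots> = (\<Sum>j = - int N..int N. if j = 0 then of_nat n * c 0 else 0)"
      by (rule sum.cong) (auto simp: n_def sum_roots_powi simp del: of_nat_Suc sum.lessThan_Suc)
    also have "\<dots> = of_nat n * c 0" by (subst sum.remove[of _ 0]) auto
    finally show ?thesis .
  qed
  then show ?thesis using I by (intro exI[of _ n]) (auto simp: n_def)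
qed

context continuous_rotsym_norm
begin

lemma uniformly_continuous_indicator:
  assumes "e > 0"
  shows "\<exists>d>0. \<forall>E\<in>sets circ. measure circ E < d \<longrightarrow> \<alpha> (class_of (indicator E)) < e"
proof (rule ccontr)
  assume neg: "\<not> ?thesis"
  have "\<exists>E\<in>sets circ. measure circ E < inverse (real (Suc n)) \<and> \<not> \<alpha> (class_of (indicator E)) < e" for n
    using neg by (metis inverse_positive_iff_positive of_nat_0_less_iff zero_less_Suc)
  then obtain E where E: "\<And>n. E n \<in> sets circ" "\<And>n. measure circ (E n) < inverse (real (Suc n))"
    "\<And>n. \<not> \<alpha> (class_of (indicator (E n))) < e" by metis
  have "(\<lambda>k. measure circ (E k)) \<longlonglongrightarrow> 0"
    by (rule tendsto_sandwich[OF _ _ tendsto_const LIMSEQ_inverse_real_of_nat])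
       (use E(2) in \<open>auto intro!: always_eventually less_imp_le\<close>)
  then have "(\<lambda>k. \<alpha> (class_of (indicator (E k)))) \<longlonglongrightarrow> 0"
    by (rule continuous[OF E(1)])
  then have "eventually (\<lambda>k. \<alpha> (class_of (indicator (E k))) < e) sequentially"
    by (rule order_tendstoD(2)[OF _ assms])
  with E(3) show False by simp
qed

text \<open>An average of sufficiently many rotations of \<open>\<bar>f\<bar>\<close> is close in \<open>L1\<close>, hence in measure, to the constant
  \<open>I = norm_L1 f\<close>. So it is at least \<open>I / 2\<close> off a set \<open>E\<close> so small that its indicator has norm
  less than \<open>1 / 2\<close>, and \<open>1 \<le> \<chi>\<^sub>E + (2 / I) * average\<close> gives the bound.\<close>

theorem norm_L1_le:
  assumes f: "f \<in> Linf"
  shows "norm_L1 f \<le> 4 * \<alpha> f"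
proof (cases "norm_L1 f = 0")
  case True
  then show ?thesis using nonneg[OF f] by simp
next
  case False
  define I where "I = norm_L1 f"
  have I: "I > 0" using False norm_L1_nonneg[of f] by (simp add: I_def)
  obtain C where C: "AE z in circ. cmod (rep_class f z) \<le> C" using f by (auto simp: Linf_iff)
  \<comment> \<open>\<open>F\<close> is the modulus of \<open>f\<close>, altered on a null set so as to be bounded and nonnegative everywhere.\<close>
  define F where "F z = complex_of_real (max 0 (min C (cmod (rep_class f z))))" for z
  have F_AE: "AE z in circ. F z = of_real (cmod (rep_class f z))"
    using C by eventually_elim (simp add: F_def)
  have [measurable]: "F \<in> borel_measurable circ" unfolding F_def by measurable
  have FC: "cmod (F z) \<le> \<bar>C\<bar>" for z
    unfolding F_def norm_of_real by linarith
  have F_class: "class_of F = modulus f"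
    by (rule l0_class_eqI[symmetric]) (use rep_modulus[of f] F_AE in \<open>auto elim: eventually_elim2\<close>)
  have iF: "integrable circ F" by (rule integrable_circ_bounded[of _ "\<bar>C\<bar>"]) (auto simp: FC)
  have intF: "(LINT z|circ. F z) = of_real I"
  proof -
    have "(LINT z|circ. F z) = (LINT z|circ. complex_of_real (cmod (rep_class f z)))"
      by (rule integral_cong_AE) (use F_AE in auto)
    then show ?thesis by (simp add: I_def norm_L1_def)
  qed
  obtain d where d: "d > 0" "\<And>E. E \<in> sets circ \<Longrightarrow> measure circ E < d \<Longrightarrow> \<alpha> (class_of (indicator E)) < 1 / 2"
    using uniformly_continuous_indicator[of "1 / 2"] by auto
  \<comment> \<open>By Markov's inequality an average within \<open>2 * e\<close> of \<open>I\<close> in \<open>L1\<close> deviates from \<open>I\<close> by \<open>I / 2\<close> only on a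
    set of measure at most \<open>2 * e / (I / 2) = d / 2\<close>.\<close>
  define e where "e = d * I / 8"
  have "e > 0" using d I by (simp add: e_def)
  obtain p where p: "trig p" "(LINT z|circ. cmod (F z - p z)) < e"
    using trig_dense_L1[OF iF \<open>e > 0\<close>] by blast
  obtain n where n: "n > 0" "\<And>z. cmod z = 1 \<Longrightarrow>
     (\<Sum>k<n. p (cis (2 * pi * real k / real n) * z)) = of_nat n * (LINT z|circ. p z)"
    using trig_average_roots[OF p(1)] by blast
  define w where "w k = cis (2 * pi * real k / real n)" for k
  have w: "cmod (w k) = 1" for k by (simp add: w_def)
  define A where "A z = (\<Sum>k<n. F (w k * z)) / of_nat n" for z
  have rot [measurable]: "(\<lambda>z. G (w k * z)) \<in> borel_measurable circ" if "G \<in> borel_measurable circ"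
    for k and G :: "complex \<Rightarrow> complex"
    by (rule measurable_compose[OF measurable_rotation[OF w] that])
  note [measurable] = trig_measurable[OF p(1)]
  have mA [measurable]: "A \<in> borel_measurable circ" unfolding A_def by measurable
  define J where "J = (LINT z|circ. p z)"
  have "cmod (of_real I - J) = cmod (LINT z|circ. F z - p z)"
    unfolding J_def intF[symmetric]
    by (subst Bochner_Integration.integral_diff) (auto simp: iF trig_integrable p(1))
  also have "\<dots> \<le> (LINT z|circ. cmod (F z - p z))" by (rule integral_norm_bound)
  finally have IJ: "cmod (of_real I - J) < e" using p(2) by simp
  have i1: "integrable circ (\<lambda>z. cmod (F (w k * z) - p (w k * z)))" for k
    by (rule integrable_rotate[OF _ w, of "\<lambda>z. cmod (F z - p z)"]) (auto simp: iF trig_integrable p(1))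
  have A_close: "cmod (A z - of_real I) \<le> (\<Sum>k<n. cmod (F (w k * z) - p (w k * z))) / real n + e"
    if z: "cmod z = 1" for z
  proof -
    have "A z - of_real I = (\<Sum>k<n. F (w k * z) - p (w k * z)) / of_nat n + (J - of_real I)"
      using n(1) n(2)[OF z] by (simp add: A_def sum_subtractf w_def J_def diff_divide_distrib)
    also have "cmod \<dots> \<le> cmod ((\<Sum>k<n. F (w k * z) - p (w k * z)) / of_nat n) + cmod (J - of_real I)"
      by (rule norm_triangle_ineq)
    also have "\<dots> \<le> (\<Sum>k<n. cmod (F (w k * z) - p (w k * z))) / real n + e"
      using IJ by (intro add_mono) (auto simp: norm_divide norm_minus_commute intro!: divide_right_mono norm_sum)
    finally show ?thesis .
  qed
  have iA: "integrable circ (\<lambda>z. cmod (A z - of_real I))"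
  proof (intro integrable_norm Bochner_Integration.integrable_diff integrable_const)
    show "integrable circ A" unfolding A_def
      by (intro integrable_divide Bochner_Integration.integrable_sum integrable_rotate iF w)
  qed auto
  have "(LINT z|circ. cmod (A z - of_real I))
      \<le> (LINT z|circ. (\<Sum>k<n. cmod (F (w k * z) - p (w k * z))) / real n + e)"
    by (rule integral_mono[OF iA]) (auto intro!: A_close Bochner_Integration.integrable_sum i1)
  also have "\<dots> = (\<Sum>k<n. (LINT z|circ. cmod (F (w k * z) - p (w k * z)))) / real n + e"
    by (subst Bochner_Integration.integral_add) (auto intro!: Bochner_Integration.integrable_sum i1 simp: i1)
  also have "\<dots> = (\<Sum>k<n. (LINT z|circ. cmod (F z - p z))) / real n + e"
    by (subst integral_rotate[OF _ w, of "\<lambda>z. cmod (F z - p z)"]) auto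
  also have "\<dots> < 2 * e" using n(1) p(2) by simp
  finally have A_L1: "(LINT z|circ. cmod (A z - of_real I)) < 2 * e" .
  define E where "E = {z \<in> space circ. I / 2 \<le> cmod (A z - of_real I)}"
  have E [measurable]: "E \<in> sets circ" unfolding E_def by measurable
  have "measure circ E \<le> (LINT z|circ. cmod (A z - of_real I)) / (I / 2)"
    unfolding E_def by (rule integral_Markov_inequality_measure[OF iA, of "{}"]) (use I in auto)
  also have "\<dots> < 2 * e / (I / 2)" using A_L1 I by (intro divide_strict_right_mono) auto
  also have "\<dots> < d" using I d by (simp add: e_def field_simps)
  finally have aE: "\<alpha> (class_of (indicator E)) < 1 / 2" by (rule d(2)[OF E])
  define S where "S z = (\<Sum>k<n. F (w k * z))" for z
  have mS [measurable]: "S \<in> borel_measurable circ" unfolding S_def by measurable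
  have aS: "\<alpha> (class_of S) \<le> real n * \<alpha> f"
    using norm_sum_rotations[of F "\<bar>C\<bar>" w n] FC w unfolding S_def F_class modulus_invariant[OF f] by simp
  have SL: "class_of S \<in> Linf"
  proof (rule Linf_class_of[OF mS, of "real n * \<bar>C\<bar>"], rule AE_I2)
    fix z show "cmod (S z) \<le> real n * \<bar>C\<bar>" unfolding S_def
      by (rule order_trans[OF norm_sum], rule order_trans[OF sum_bounded_above[of _ _ "\<bar>C\<bar>"]]) (auto simp: FC)
  qed
  have mi [measurable]: "(indicator E :: complex \<Rightarrow> complex) \<in> borel_measurable circ"
    using E by (rule borel_measurable_indicator)
  have EL: "class_of (indicator E) \<in> Linf"
    by (rule Linf_class_of[OF mi, of 1]) (auto split: split_indicator)
  define c where "c = complex_of_real (2 / (I * real n))"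
  have cL: "scale c (class_of S) \<in> Linf" by (rule Linf_scale[OF SL])
  have one: "1 \<in> Linf" by (auto simp: Linf_iff intro!: exI[of _ 1] eventually_mono[OF rep_one])
  have F_real: "F z = of_real (cmod (F z))" for z
    by (simp add: F_def)
  have "modulus_le 1 (class_of (indicator E) + scale c (class_of S))"
    unfolding modulus_le_iff
    using rep_one rep_plus[of "class_of (indicator E)" "scale c (class_of S)"] rep_scale[of c "class_of S"]
      rep_class_of[OF mS] rep_class_of[OF mi] AE_space[of circ]
  proof eventually_elim
    case (elim z)
    have SA: "c * S z = of_real (2 / I) * A z"
      using n(1) I by (simp add: c_def S_def A_def field_simps)
    have A_eq: "A z = of_real (\<Sum>k<n. cmod (F (w k * z)) / real n)"
      unfolding A_def using F_real by (simp add: sum_divide_distrib) 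
    have A_ge: "Re (A z) \<ge> 0" unfolding A_eq by (simp add: sum_nonneg)
    have "1 \<le> Re (indicator E z + of_real (2 / I) * A z)"
    proof (cases "z \<in> E")
      case True
      then show ?thesis using A_ge I by simp
    next
      case nE: False
      then have "cmod (A z - of_real I) < I / 2" using elim(6) by (auto simp: E_def)
      then have "I / 2 < Re (A z)" using abs_Re_le_cmod[of "A z - of_real I"] by simp
      then show ?thesis using nE I by (simp add: field_simps)
    qed
    also have "\<dots> \<le> cmod (indicator E z + c * S z)" unfolding SA by (rule complex_Re_le_cmod)
    finally show ?case by (simp add: elim)
  qed
  then have "1 \<le> \<alpha> (class_of (indicator E) + scale c (class_of S))"
    using norm_mono[OF one Linf_add[OF EL cL]] normalized by simp
  also have "\<dots> \<le> \<alpha> (class_of (indicator E)) + \<alpha> (scale c (class_of S))"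
    by (rule triangle[OF EL cL])
  also have "\<alpha> (scale c (class_of S)) = 2 / (I * real n) * \<alpha> (class_of S)"
    using I n(1) by (simp add: homogeneous[OF SL] c_def norm_divide norm_mult)
  also have "\<dots> \<le> 2 / (I * real n) * (real n * \<alpha> f)"
    using aS I by (intro mult_left_mono) auto
  also have "\<dots> = 2 / I * \<alpha> f" using n(1) by simp
  finally have "1 / 2 \<le> 2 / I * \<alpha> f" using aE by linarith
  then show ?thesis using I by (simp add: field_simps I_def)
qed

text \<open>Simple functions that converge to \<open>f\<close> from within the disc of radius \<open>2 * cmod (f z)\<close> are
  halved before \<open>norm_ext\<close> sees them; this is where the factor comes from.\<close>

lemma nn_integral_le_norm_ext:
  "(\<integral>\<^sup>+z. ennreal (cmod (rep_class f z)) \<partial>circ) \<le> 8 * norm_ext \<alpha> f"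
proof -
  obtain s where s_all: "\<forall>i. simple_function circ (s i)"
      "\<forall>z\<in>space circ. (\<lambda>i. s i z) \<longlonglongrightarrow> rep_class f z"
      "\<forall>i. \<forall>z\<in>space circ. dist (s i z) 0 \<le> 2 * dist (rep_class f z) 0"
    using borel_measurable_implies_sequence_metric[OF rep_measurable[of f], of 0] by blast
  then have s: "simple_function circ (s i)"
      "z \<in> space circ \<Longrightarrow> (\<lambda>i. s i z) \<longlonglongrightarrow> rep_class f z"
      "z \<in> space circ \<Longrightarrow> cmod (s i z) \<le> 2 * cmod (rep_class f z)" for i z
    by (simp_all add: dist_norm)
  note [measurable] = borel_measurable_simple_function[OF s(1)]
  have bd: "(\<integral>\<^sup>+z. ennreal (cmod (s i z)) \<partial>circ) \<le> 8 * norm_ext \<alpha> f" for i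
  proof -
    define t where "t z = s i z / 2" for z
    have t: "simple_function circ t" unfolding t_def by (rule simple_function_compose1[OF s(1)])
    have mt [measurable]: "t \<in> borel_measurable circ" by (rule borel_measurable_simple_function[OF t])
    have "finite (cmod ` t ` space circ)" using simple_functionD(1)[OF t] by simp
    then have tb: "cmod (t z) \<le> Max (cmod ` t ` space circ)" if "z \<in> space circ" for z
      using that by (intro Max_ge) auto
    have tL: "class_of t \<in> Linf" by (rule Linf_class_of[OF mt], rule AE_I2, erule tb)
    have it: "integrable circ t" by (rule integrable_circ_bounded[OF mt], rule AE_I2, erule tb)
    have "modulus_le (class_of t) f"
      unfolding modulus_le_iff using rep_class_of[OF mt] AE_space[of circ]
    proof eventually_elim
      case (elim z)
      then show ?case using s(3)[of z i] by (simp only: t_def norm_divide) simp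
    qed
    then have "ennreal (\<alpha> (class_of t)) \<le> norm_ext \<alpha> f"
      unfolding norm_ext_def using t by (intro SUP_upper) (auto simp: simple_l0_def)
    moreover have "(\<integral>\<^sup>+z. ennreal (cmod (t z)) \<partial>circ) \<le> 4 * ennreal (\<alpha> (class_of t))"
    proof -
      have "(\<integral>\<^sup>+z. ennreal (cmod (t z)) \<partial>circ) = ennreal (LINT z|circ. cmod (t z))"
        by (rule nn_integral_eq_integral) (auto simp: it)
      also have "(LINT z|circ. cmod (t z)) = norm_L1 (class_of t)"
        unfolding norm_L1_def
        by (rule integral_cong_AE) (use rep_class_of[OF mt] in \<open>auto elim!: eventually_mono\<close>)
      also have "ennreal \<dots> \<le> ennreal (4 * \<alpha> (class_of t))"
        by (intro ennreal_leI norm_L1_le tL)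
      finally show ?thesis using nonneg[OF tL] by (simp add: ennreal_mult)
    qed
    moreover have "(\<integral>\<^sup>+z. ennreal (cmod (s i z)) \<partial>circ) = 2 * (\<integral>\<^sup>+z. ennreal (cmod (t z)) \<partial>circ)"
    proof -
      have "ennreal (cmod (s i z)) = 2 * ennreal (cmod (t z))" for z
      proof -
        have "ennreal (cmod (s i z)) = ennreal (2 * cmod (t z))" by (simp add: t_def norm_divide)
        then show ?thesis by (subst (asm) ennreal_mult) auto
      qed
      then show ?thesis by (simp add: nn_integral_cmult)
    qed
    ultimately have "(\<integral>\<^sup>+z. ennreal (cmod (s i z)) \<partial>circ) \<le> 2 * (4 * norm_ext \<alpha> f)"
      by (elim ssubst, intro mult_left_mono, elim order_trans, intro mult_left_mono) simp_all
    then show ?thesis by (simp add: mult.assoc[symmetric])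
  qed
  have "(\<integral>\<^sup>+z. ennreal (cmod (rep_class f z)) \<partial>circ) = (\<integral>\<^sup>+z. liminf (\<lambda>i. ennreal (cmod (s i z))) \<partial>circ)"
  proof (rule nn_integral_cong)
    fix z assume "z \<in> space circ"
    then have "(\<lambda>i. ennreal (cmod (s i z))) \<longlonglongrightarrow> ennreal (cmod (rep_class f z))"
      by (intro tendsto_ennrealI tendsto_norm s)
    then show "ennreal (cmod (rep_class f z)) = liminf (\<lambda>i. ennreal (cmod (s i z)))"
      by (intro lim_imp_Liminf[symmetric]) auto
  qed
  also have "\<dots> \<le> liminf (\<lambda>i. \<integral>\<^sup>+z. ennreal (cmod (s i z)) \<partial>circ)"
    by (rule nn_integral_liminf) measurable
  also have "\<dots> \<le> 8 * norm_ext \<alpha> f"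
    using bd by (intro Liminf_le) (auto intro: always_eventually)
  finally show ?thesis .
qed

theorem Halpha_subset_H1: "Halpha \<alpha> \<subseteq> H1"
proof
  have L1I: "f \<in> L1" and norm_le: "norm_L1 f \<le> 8 * enn2real (norm_ext \<alpha> f)" if "norm_ext \<alpha> f < \<infinity>" for f
  proof -
    have fin: "8 * norm_ext \<alpha> f < \<infinity>" using that by (simp add: ennreal_mult_less_top)
    have "(\<integral>\<^sup>+z. ennreal (cmod (rep_class f z)) \<partial>circ) < \<infinity>"
      by (rule le_less_trans[OF nn_integral_le_norm_ext fin])
    then have i: "integrable circ (rep_class f)" by (intro integrableI_bounded) auto
    then show "f \<in> L1" by (simp add: L1_def)
    have "ennreal (norm_L1 f) \<le> 8 * norm_ext \<alpha> f"
      using nn_integral_le_norm_ext[of f] i unfolding norm_L1_def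
      by (subst (asm) nn_integral_eq_integral) auto
    then have "enn2real (ennreal (norm_L1 f)) \<le> enn2real (8 * norm_ext \<alpha> f)"
      using fin by (intro enn2real_mono) auto
    then show "norm_L1 f \<le> 8 * enn2real (norm_ext \<alpha> f)" by (simp add: enn2real_mult norm_L1_nonneg)
  qed
  fix f assume "f \<in> Halpha \<alpha>"
  then have f: "norm_ext \<alpha> f < \<infinity>" "\<And>e. e > 0 \<Longrightarrow> \<exists>g\<in>Hinf. norm_ext \<alpha> (f - g) < ennreal e"
    by (auto simp: Halpha_def norm_closure_def finite_norm_def)
  have "cmod (fourier f n) \<le> e" if "n < 0" "e > 0" for n e
  proof -
    obtain g where g: "g \<in> Hinf" "norm_ext \<alpha> (f - g) < ennreal (e / 8)"
      using f(2)[of "e / 8"] \<open>e > 0\<close> by auto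
    then have fin: "norm_ext \<alpha> (f - g) < \<infinity>" using less_top_ennreal less_trans
      by (metis ennreal_less_top infinity_ennreal_def)
    have "enn2real (norm_ext \<alpha> (f - g)) \<le> e / 8"
      using g(2) that by (intro enn2real_leI) auto
    then have "norm_L1 (f - g) \<le> e" using norm_le[OF fin] by simp
    moreover have "fourier (f - g) n = fourier f n"
      using g(1) that Linf_L1 by (subst fourier_diff[OF L1I[OF f(1)]]) (auto simp: Hinf_def)
    ultimately show ?thesis using cmod_fourier_le[OF L1I[OF fin], of n] by simp
  qed
  then have "fourier f n = 0" if "n < 0" for n
    using that by (metis dense_ge norm_le_zero_iff)
  then show "f \<in> H1" using L1I[OF f(1)] by (simp add: H1_def)
qed

end

section \<open>Hilbert spaces of classes\<close>

context hilbert_subspace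
begin

abbreviation nrm :: "l0 \<Rightarrow> real" where "nrm \<equiv> ip_norm ip"

lemma zero_mem: "0 \<in> M" using l0.subspace_0[OF subspace] .
lemma add_mem: "f \<in> M \<Longrightarrow> g \<in> M \<Longrightarrow> f + g \<in> M" using l0.subspace_add[OF subspace] .
lemma diff_mem: "f \<in> M \<Longrightarrow> g \<in> M \<Longrightarrow> f - g \<in> M" using l0.subspace_diff[OF subspace] .
lemma scale_mem: "f \<in> M \<Longrightarrow> scale c f \<in> M" using l0.subspace_scale[OF subspace] .
lemma sum_mem: "(\<And>i. i \<in> I \<Longrightarrow> f i \<in> M) \<Longrightarrow> (\<Sum>i\<in>I. f i) \<in> M" using l0.subspace_sum[OF subspace] .

lemma ip_zero_left: "h \<in> M \<Longrightarrow> ip 0 h = 0"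
  using ip_scale[OF zero_mem, of h 0] by simp

lemma ip_diff: assumes "f \<in> M" "g \<in> M" "h \<in> M" shows "ip (f - g) h = ip f h - ip g h"
  using ip_add[OF diff_mem[OF assms(1,2)] assms(2,3)] by (simp add: eq_diff_eq)

lemma ip_sum_left:
  "(\<And>i. i \<in> I \<Longrightarrow> f i \<in> M) \<Longrightarrow> h \<in> M \<Longrightarrow> ip (\<Sum>i\<in>I. f i) h = (\<Sum>i\<in>I. ip (f i) h)"
  by (induction I rule: infinite_finite_induct) (auto simp: ip_zero_left ip_add sum_mem)

lemma ip_zero_right: "h \<in> M \<Longrightarrow> ip h 0 = 0"
  using ip_sym[OF _ zero_mem] ip_zero_left by simp

lemma ip_add_right: "f \<in> M \<Longrightarrow> g \<in> M \<Longrightarrow> h \<in> M \<Longrightarrow> ip h (f + g) = ip h f + ip h g"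
  by (metis add_mem complex_cnj_add ip_add ip_sym)

lemma ip_diff_right: "f \<in> M \<Longrightarrow> g \<in> M \<Longrightarrow> h \<in> M \<Longrightarrow> ip h (f - g) = ip h f - ip h g"
  by (metis diff_mem complex_cnj_diff ip_diff ip_sym)

lemma ip_scale_right: "f \<in> M \<Longrightarrow> h \<in> M \<Longrightarrow> ip h (scale c f) = cnj c * ip h f"
  by (metis scale_mem complex_cnj_mult ip_scale ip_sym)

lemma ip_self: assumes "f \<in> M" shows "ip f f = of_real ((nrm f)\<^sup>2)"
proof -
  have "0 \<le> Re (ip f f)"
    using ip_pos[OF assms] ip_zero_left[OF zero_mem] by (cases "f = 0") auto
  moreover have "Im (ip f f) = 0" using ip_sym[OF assms assms] by (simp add: complex_eq_iff)
  ultimately show ?thesis by (simp add: ip_norm_def complex_eq_iff)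
qed

lemma nrm_sq: "f \<in> M \<Longrightarrow> (nrm f)\<^sup>2 = Re (ip f f)"
  by (simp add: ip_self)

lemma nrm_nonneg: "f \<in> M \<Longrightarrow> 0 \<le> nrm f"
  using ip_pos[of f] ip_zero_left[OF zero_mem] by (cases "f = 0") (auto simp: ip_norm_def)

lemma nrm_zero: "nrm 0 = 0"
  by (simp add: ip_norm_def ip_zero_left zero_mem)

lemma nrm_eq_0: "f \<in> M \<Longrightarrow> nrm f = 0 \<Longrightarrow> f = 0"
  using ip_pos[of f] by (auto simp: ip_norm_def)

lemma nrm_scale: assumes "f \<in> M" shows "nrm (scale c f) = cmod c * nrm f"
proof -
  have "ip (scale c f) (scale c f) = c * cnj c * ip f f"
    using assms by (simp add: ip_scale ip_scale_right scale_mem)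
  also have "\<dots> = of_real ((cmod c * nrm f)\<^sup>2)"
    using ip_self[OF assms] complex_norm_square[of c] by (simp add: power_mult_distrib)
  finally have "ip (scale c f) (scale c f) = of_real ((cmod c * nrm f)\<^sup>2)" .
  then have "(nrm (scale c f))\<^sup>2 = (cmod c * nrm f)\<^sup>2"
    using nrm_sq[OF scale_mem[OF assms]] by simp
  then show ?thesis
    using assms by (simp add: nrm_nonneg scale_mem)
qed

lemma nrm_minus_commute: "f \<in> M \<Longrightarrow> g \<in> M \<Longrightarrow> nrm (f - g) = nrm (g - f)"
  using nrm_scale[OF diff_mem[of f g], of "-1"] by simp

lemma nrm_add_sq:
  assumes "f \<in> M" "g \<in> M" shows "(nrm (f + g))\<^sup>2 = (nrm f)\<^sup>2 + (nrm g)\<^sup>2 + 2 * Re (ip f g)"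
  using assms ip_sym[OF assms] by (simp add: nrm_sq add_mem ip_add ip_add_right)

lemma nrm_diff_sq:
  assumes "f \<in> M" "g \<in> M" shows "(nrm (f - g))\<^sup>2 = (nrm f)\<^sup>2 + (nrm g)\<^sup>2 - 2 * Re (ip f g)"
  using assms ip_sym[OF assms] by (simp add: nrm_sq diff_mem ip_diff ip_diff_right)

text \<open>Subtracting from \<open>f\<close> its component along \<open>g\<close>.\<close>

lemma nrm_subtract_component:
  assumes f: "f \<in> M" and g: "g \<in> M" and g0: "nrm g > 0"
  shows "\<exists>c. (nrm (f - scale c g))\<^sup>2 = (nrm f)\<^sup>2 - (cmod (ip f g))\<^sup>2 / (nrm g)\<^sup>2"
proof
  define c where "c = ip f g / of_real ((nrm g)\<^sup>2)"
  have "ip f (scale c g) = cnj c * ip f g" by (rule ip_scale_right[OF g f])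
  also have "\<dots> = of_real ((cmod (ip f g))\<^sup>2 / (nrm g)\<^sup>2)"
    by (simp add: c_def complex_norm_square mult_ac del: of_real_power)
  finally have ip: "Re (ip f (scale c g)) = (cmod (ip f g))\<^sup>2 / (nrm g)\<^sup>2" by simp
  have "nrm (scale c g) = cmod (ip f g) / nrm g"
    using g0 by (simp add: nrm_scale[OF g] c_def norm_divide norm_mult power2_eq_square)
  then have n: "(nrm (scale c g))\<^sup>2 = (cmod (ip f g))\<^sup>2 / (nrm g)\<^sup>2" by (simp add: power_divide)
  show "(nrm (f - scale c g))\<^sup>2 = (nrm f)\<^sup>2 - (cmod (ip f g))\<^sup>2 / (nrm g)\<^sup>2"
    using nrm_diff_sq[OF f scale_mem[OF g, of c]] ip n by simp
qed

lemma cauchy_schwarz: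
  assumes f: "f \<in> M" and g: "g \<in> M" shows "cmod (ip f g) \<le> nrm f * nrm g"
proof (cases "g = 0")
  case True
  then show ?thesis using f by (simp add: ip_zero_right nrm_zero)
next
  case False
  then have g0: "nrm g > 0" using nrm_eq_0[OF g] nrm_nonneg[OF g] by linarith
  obtain c where c: "(nrm (f - scale c g))\<^sup>2 = (nrm f)\<^sup>2 - (cmod (ip f g))\<^sup>2 / (nrm g)\<^sup>2"
    using nrm_subtract_component[OF f g g0] by blast
  then have "(cmod (ip f g))\<^sup>2 / (nrm g)\<^sup>2 \<le> (nrm f)\<^sup>2"
    using zero_le_power2[of "nrm (f - scale c g)"] by linarith
  then have "(cmod (ip f g))\<^sup>2 \<le> (nrm f * nrm g)\<^sup>2"
    using g0 by (simp add: power_mult_distrib field_simps)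
  moreover have "0 \<le> nrm f * nrm g" using nrm_nonneg[OF f] nrm_nonneg[OF g] by simp
  ultimately show ?thesis by (rule power2_le_imp_le)
qed

lemma nrm_triangle:
  assumes f: "f \<in> M" and g: "g \<in> M" shows "nrm (f + g) \<le> nrm f + nrm g"
proof (rule power2_le_imp_le)
  have "Re (ip f g) \<le> nrm f * nrm g"
    using cauchy_schwarz[OF f g] complex_Re_le_cmod order_trans by blast
  then show "(nrm (f + g))\<^sup>2 \<le> (nrm f + nrm g)\<^sup>2"
    using nrm_add_sq[OF f g] by (simp add: power2_sum)
qed (simp add: f g nrm_nonneg)

lemma nrm_triangle_diff:
  assumes "f \<in> M" "g \<in> M" "h \<in> M" shows "nrm (f - h) \<le> nrm (f - g) + nrm (g - h)"
  using nrm_triangle[OF diff_mem[OF assms(1,2)] diff_mem[OF assms(2,3)]] by simp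

lemma nrm_sum_le:
  assumes "\<And>i. i \<in> I \<Longrightarrow> f i \<in> M" shows "nrm (\<Sum>i\<in>I. f i) \<le> (\<Sum>i\<in>I. nrm (f i))"
  using assms
proof (induction I rule: infinite_finite_induct)
  case (insert i I)
  then show ?case using nrm_triangle[of "f i" "\<Sum>i\<in>I. f i"] by (simp add: sum_mem)
qed (simp_all add: nrm_zero)

lemma ip_lim:
  assumes "\<And>n. s n \<in> M" "f \<in> M" "g \<in> M" "(\<lambda>n. nrm (s n - f)) \<longlonglongrightarrow> 0"
  shows "(\<lambda>n. ip (s n) g) \<longlonglongrightarrow> ip f g"
proof -
  have "(\<lambda>n. nrm (s n - f) * nrm g) \<longlonglongrightarrow> 0" using tendsto_mult_left_zero[OF assms(4)] .
  then have "(\<lambda>n. ip (s n) g - ip f g) \<longlonglongrightarrow> 0"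
    by (rule Lim_null_comparison[rotated])
       (use assms cauchy_schwarz[OF diff_mem] in \<open>auto simp flip: ip_diff\<close>)
  then show ?thesis by (simp add: LIM_zero_iff)
qed

lemma nrm_lim:
  assumes "\<And>n. s n \<in> M" "f \<in> M" "(\<lambda>n. nrm (s n - f)) \<longlonglongrightarrow> 0"
  shows "(\<lambda>n. nrm (s n)) \<longlonglongrightarrow> nrm f"
proof -
  have "norm (nrm (s n) - nrm f) \<le> nrm (s n - f)" for n
    using nrm_triangle[OF diff_mem[OF assms(1)[of n] assms(2)] assms(2)]
      nrm_triangle[OF diff_mem[OF assms(2) assms(1)[of n]] assms(1)[of n]]
      nrm_minus_commute[OF assms(1)[of n] assms(2)] by (simp add: abs_le_iff)
  then have "(\<lambda>n. nrm (s n) - nrm f) \<longlonglongrightarrow> 0"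
    by (intro Lim_null_comparison[OF _ assms(3)]) auto
  then show ?thesis by (simp add: LIM_zero_iff)
qed

lemma lim_unique:
  assumes "\<And>n. s n \<in> M" "f \<in> M" "g \<in> M" "(\<lambda>n. nrm (s n - f)) \<longlonglongrightarrow> 0" "(\<lambda>n. nrm (s n - g)) \<longlonglongrightarrow> 0"
  shows "f = g"
proof -
  have "(\<lambda>n. nrm (s n - f) + nrm (s n - g)) \<longlonglongrightarrow> 0"
    using tendsto_add[OF assms(4,5)] by simp
  moreover have "nrm (f - g) \<le> nrm (s n - f) + nrm (s n - g)" for n
    using nrm_triangle_diff[OF assms(2) assms(1) assms(3), of n] nrm_minus_commute[OF assms(2) assms(1), of n] by simp
  ultimately have "nrm (f - g) \<le> 0" by (intro LIMSEQ_le_const) auto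
  then have "nrm (f - g) = 0" using nrm_nonneg[OF diff_mem[OF assms(2,3)]] by simp
  then show ?thesis using nrm_eq_0[OF diff_mem[OF assms(2,3)]] by simp
qed

lemma convergent_Cauchy:
  assumes "\<And>n. s n \<in> M" "f \<in> M" "(\<lambda>n. nrm (s n - f)) \<longlonglongrightarrow> 0" "\<epsilon> > 0"
  shows "\<exists>N. \<forall>m\<ge>N. \<forall>n\<ge>N. nrm (s m - s n) < \<epsilon>"
proof -
  have "eventually (\<lambda>n. nrm (s n - f) < \<epsilon> / 2) sequentially"
    using assms(4) by (intro order_tendstoD(2)[OF assms(3)]) simp
  then obtain N where N: "\<And>n. n \<ge> N \<Longrightarrow> nrm (s n - f) < \<epsilon> / 2"
    by (auto simp: eventually_sequentially)
  have "nrm (s m - s n) < \<epsilon>" if "m \<ge> N" "n \<ge> N" for m n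
    using nrm_triangle_diff[OF assms(1)[of m] assms(2) assms(1)[of n]] N[OF that(1)] N[OF that(2)]
      nrm_minus_commute[OF assms(2) assms(1)[of n]] by simp
  then show ?thesis by blast
qed

lemma absolutely_convergent:
  assumes u: "\<And>n. u n \<in> M" and b: "\<And>n. nrm (u n) \<le> b n" "summable b"
  shows "\<exists>f\<in>M. (\<lambda>n. nrm ((\<Sum>i<n. u i) - f)) \<longlonglongrightarrow> 0"
proof (rule complete)
  fix \<epsilon> :: real assume "\<epsilon> > 0"
  then obtain N where N: "\<And>m n. m \<ge> N \<Longrightarrow> norm (sum b {m..<n}) < \<epsilon>"
    using b(2) unfolding summable_Cauchy by metis
  have le: "nrm ((\<Sum>i<n. u i) - (\<Sum>i<m. u i)) < \<epsilon>" if "N \<le> m" "m \<le> n" for m n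
  proof -
    have "(\<Sum>i<n. u i) - (\<Sum>i<m. u i) = (\<Sum>i=m..<n. u i)"
      using that by (simp add: lessThan_atLeast0 sum_diff_nat_ivl)
    then have "nrm ((\<Sum>i<n. u i) - (\<Sum>i<m. u i)) \<le> (\<Sum>i=m..<n. nrm (u i))"
      using nrm_sum_le[of "{m..<n}" u] u by simp
    also have "\<dots> \<le> (\<Sum>i=m..<n. b i)" by (intro sum_mono b)
    also have "\<dots> < \<epsilon>" using N[OF that(1), of n] by simp
    finally show ?thesis .
  qed
  show "\<exists>N. \<forall>m\<ge>N. \<forall>n\<ge>N. nrm ((\<Sum>i<m. u i) - (\<Sum>i<n. u i)) < \<epsilon>"
  proof (intro exI[of _ N] allI impI)
    fix m n assume "N \<le> m" "N \<le> n"
    then show "nrm ((\<Sum>i<m. u i) - (\<Sum>i<n. u i)) < \<epsilon>"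
      using le[of m n] le[of n m] nrm_minus_commute[of "\<Sum>i<m. u i" "\<Sum>i<n. u i"]
      by (cases "m \<le> n") (auto simp: sum_mem u)
  qed
qed (simp add: sum_mem u)

text \<open>Minimizing sequences for the distance to \<open>W\<close> are Cauchy by the parallelogram law.\<close>

theorem orthogonal_projection:
  assumes W: "l0.subspace W" "W \<subseteq> M"
    and closed: "\<And>s f. (\<And>n. s n \<in> W) \<Longrightarrow> f \<in> M \<Longrightarrow> (\<lambda>n. nrm (s n - f)) \<longlonglongrightarrow> 0 \<Longrightarrow> f \<in> W"
    and f: "f \<in> M"
  shows "\<exists>w\<in>W. \<forall>v\<in>W. ip (f - w) v = 0"
proof -
  have WM: "w \<in> W \<Longrightarrow> w \<in> M" for w using W(2) by blast
  note W0 = l0.subspace_0[OF W(1)] and Wadd = l0.subspace_add[OF W(1)] and Wscale = l0.subspace_scale[OF W(1)]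
  define d where "d = Inf ((\<lambda>w. (nrm (f - w))\<^sup>2) ` W)"
  have bdd: "bdd_below ((\<lambda>w. (nrm (f - w))\<^sup>2) ` W)" by (rule bdd_belowI2[of _ 0]) simp
  have d_le: "d \<le> (nrm (f - w))\<^sup>2" if "w \<in> W" for w
    unfolding d_def by (rule cInf_lower[OF _ bdd]) (use that in auto)
  have "\<exists>w\<in>W. (nrm (f - w))\<^sup>2 < d + inverse (real (Suc n))" for n
  proof -
    have "Inf ((\<lambda>w. (nrm (f - w))\<^sup>2) ` W) < d + inverse (real (Suc n))" by (simp add: d_def[symmetric])
    then show ?thesis using cInf_lessD[of "(\<lambda>w. (nrm (f - w))\<^sup>2) ` W"] W0 by auto
  qed
  then obtain s where s: "\<And>n. s n \<in> W" "\<And>n. (nrm (f - s n))\<^sup>2 < d + inverse (real (Suc n))" by metis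
  have sM: "s n \<in> M" "f - s n \<in> M" for n using s WM f diff_mem by auto
  have par: "(nrm (s m - s n))\<^sup>2 \<le> 2 * inverse (real (Suc m)) + 2 * inverse (real (Suc n))" for m n
  proof -
    define a b where "a = f - s m" and "b = f - s n"
    have ab: "a \<in> M" "b \<in> M" using sM by (auto simp: a_def b_def)
    have mid: "scale (1 / 2) (s m + s n) \<in> W" by (intro Wscale Wadd s)
    have "a + b = scale 2 (f - scale (1 / 2) (s m + s n))"
      by (simp add: a_def b_def l0.scale_right_diff_distrib l0.scale_right_distrib
           l0.scale_left_distrib[of 1 1, simplified] algebra_simps)
    then have "(nrm (a + b))\<^sup>2 = 4 * (nrm (f - scale (1 / 2) (s m + s n)))\<^sup>2"
      using nrm_scale[OF diff_mem[OF f WM[OF mid]], of 2] by (simp add: power_mult_distrib)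
    then have "4 * d \<le> (nrm (a + b))\<^sup>2" using d_le[OF mid] by simp
    moreover have "(nrm (a - b))\<^sup>2 + (nrm (a + b))\<^sup>2 = 2 * (nrm a)\<^sup>2 + 2 * (nrm b)\<^sup>2"
      using nrm_add_sq[OF ab] nrm_diff_sq[OF ab] by simp
    moreover have "nrm (a - b) = nrm (s m - s n)"
      using nrm_minus_commute[OF sM(1)[of m] sM(1)[of n]] by (simp add: a_def b_def)
    ultimately show ?thesis using s(2)[of m] s(2)[of n] by (simp add: a_def b_def)
  qed
  have "\<exists>w\<in>M. (\<lambda>n. nrm (s n - w)) \<longlonglongrightarrow> 0"
  proof (rule complete[OF sM(1)])
    fix \<epsilon> :: real assume e: "\<epsilon> > 0"
    then obtain N where N: "inverse (real (Suc N)) < \<epsilon>\<^sup>2 / 4"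
      using reals_Archimedean[of "\<epsilon>\<^sup>2 / 4"] by auto
    show "\<exists>N. \<forall>m\<ge>N. \<forall>n\<ge>N. nrm (s m - s n) < \<epsilon>"
    proof (intro exI[of _ N] allI impI)
      fix m n assume mn: "N \<le> m" "N \<le> n"
      have "inverse (real (Suc m)) \<le> inverse (real (Suc N))" "inverse (real (Suc n)) \<le> inverse (real (Suc N))"
        using mn by (auto intro!: le_imp_inverse_le)
      then have "(nrm (s m - s n))\<^sup>2 < \<epsilon>\<^sup>2" using par[of m n] N by linarith
      then show "nrm (s m - s n) < \<epsilon>" using e by (meson less_imp_le power2_less_imp_less)
    qed
  qed
  then obtain w where w: "w \<in> M" "(\<lambda>n. nrm (s n - w)) \<longlonglongrightarrow> 0" by blast
  have wW: "w \<in> W" by (rule closed[OF s(1) w])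
  have "(\<lambda>n. nrm ((f - s n) - (f - w))) \<longlonglongrightarrow> 0"
    using w(2) nrm_minus_commute[OF w(1) sM(1)] by (simp add: algebra_simps)
  then have "(\<lambda>n. nrm (f - s n)) \<longlonglongrightarrow> nrm (f - w)"
    by (intro nrm_lim sM diff_mem f w)
  then have "(\<lambda>n. (nrm (f - s n))\<^sup>2) \<longlonglongrightarrow> (nrm (f - w))\<^sup>2" by (intro tendsto_intros)
  moreover have "(\<lambda>n. d + inverse (real (Suc n))) \<longlonglongrightarrow> d + 0"
    by (intro tendsto_intros LIMSEQ_inverse_real_of_nat)
  ultimately have min: "(nrm (f - w))\<^sup>2 \<le> d + 0"
    by (rule LIMSEQ_le) (use s(2) in \<open>auto intro: less_imp_le\<close>)
  have fw: "f - w \<in> M" by (intro diff_mem f w)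
  have "ip (f - w) v = 0" if v: "v \<in> W" for v
  proof (rule ccontr)
    assume ne: "ip (f - w) v \<noteq> 0"
    have vM: "v \<in> M" using WM[OF v] .
    have v0: "nrm v > 0"
      using ne nrm_nonneg[OF vM] nrm_eq_0[OF vM] ip_zero_right[OF fw] by (cases "nrm v = 0") auto
    obtain c where c: "(nrm ((f - w) - scale c v))\<^sup>2
        = (nrm (f - w))\<^sup>2 - (cmod (ip (f - w) v))\<^sup>2 / (nrm v)\<^sup>2"
      using nrm_subtract_component[OF fw vM v0] by blast
    have "d \<le> (nrm (f - (w + scale c v)))\<^sup>2" by (intro d_le Wadd Wscale wW v)
    also have "f - (w + scale c v) = (f - w) - scale c v" by simp
    also have "(nrm \<dots>)\<^sup>2 = (nrm (f - w))\<^sup>2 - (cmod (ip (f - w) v))\<^sup>2 / (nrm v)\<^sup>2" by (rule c)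
    also have "\<dots> < d"
    proof -
      have "0 < (cmod (ip (f - w) v))\<^sup>2 / (nrm v)\<^sup>2" using ne v0 by simp
      with min show ?thesis by linarith
    qed
    finally show False by simp
  qed
  then show ?thesis using wW by blast
qed

subsection \<open>Orthonormal sequences\<close>

context
  fixes e :: "nat \<Rightarrow> l0"
  assumes e: "\<And>n. e n \<in> M" and on: "\<And>i j. ip (e i) (e j) = (if i = j then 1 else 0)"
begin

lemma comb_mem: "(\<Sum>i\<in>A. scale (c i) (e i)) \<in> M"
  by (intro sum_mem scale_mem e)

lemma ip_comb: "finite A \<Longrightarrow> ip (\<Sum>i\<in>A. scale (c i) (e i)) (e k) = (if k \<in> A then c k else 0)"
  by (subst ip_sum_left) (simp_all add: scale_mem e ip_scale on if_distrib cong: if_cong)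

lemma nrm_comb_sq: "finite A \<Longrightarrow> (nrm (\<Sum>i\<in>A. scale (c i) (e i)))\<^sup>2 = (\<Sum>i\<in>A. (cmod (c i))\<^sup>2)"
proof -
  assume A: "finite A"
  let ?S = "\<Sum>i\<in>A. scale (c i) (e i)"
  have "ip ?S ?S = (\<Sum>k\<in>A. ip (scale (c k) (e k)) ?S)"
    by (rule ip_sum_left) (auto intro: scale_mem e comb_mem)
  also have "\<dots> = (\<Sum>k\<in>A. of_real ((cmod (c k))\<^sup>2))"
  proof (rule sum.cong[OF refl])
    fix k assume "k \<in> A"
    then have "ip (e k) ?S = cnj (c k)"
      using ip_sym[OF e comb_mem, of k c A] ip_comb[OF A, of c k] by simp
    then show "ip (scale (c k) (e k)) ?S = of_real ((cmod (c k))\<^sup>2)"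
      by (simp add: ip_scale e comb_mem complex_norm_square del: of_real_power)
  qed
  finally show ?thesis by (simp add: nrm_sq[OF comb_mem])
qed

lemma bessel:
  assumes f: "f \<in> M" shows "summable (\<lambda>i. (cmod (ip f (e i)))\<^sup>2)"
proof (rule bounded_imp_summable)
  fix n
  define c where "c i = ip f (e i)" for i
  let ?S = "\<Sum>i<Suc n. scale (c i) (e i)"
  have "ip ?S f = (\<Sum>i<Suc n. ip (scale (c i) (e i)) f)"
    by (rule ip_sum_left) (auto intro: scale_mem e f)
  also have "\<dots> = (\<Sum>i<Suc n. of_real ((cmod (c i))\<^sup>2))"
    by (rule sum.cong) (simp_all add: ip_scale e f ip_sym[OF e f] c_def complex_norm_square del: of_real_power)
  finally have "Re (ip ?S f) = (\<Sum>i<Suc n. (cmod (c i))\<^sup>2)" by simp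
  moreover have "(nrm (?S - f))\<^sup>2 = (nrm ?S)\<^sup>2 + (nrm f)\<^sup>2 - 2 * Re (ip ?S f)"
    by (rule nrm_diff_sq[OF comb_mem f])
  moreover have "(nrm ?S)\<^sup>2 = (\<Sum>i<Suc n. (cmod (c i))\<^sup>2)" by (rule nrm_comb_sq) simp
  ultimately have "(\<Sum>i<Suc n. (cmod (c i))\<^sup>2) \<le> (nrm f)\<^sup>2"
    using zero_le_power2[of "nrm (?S - f)"] by linarith
  then show "(\<Sum>i\<le>n. (cmod (ip f (e i)))\<^sup>2) \<le> (nrm f)\<^sup>2"
    by (simp add: c_def lessThan_Suc_atMost)
qed simp

lemma orthonormal_series:
  assumes c: "summable (\<lambda>i. (cmod (c i))\<^sup>2)"
  shows "\<exists>f\<in>M. (\<lambda>n. nrm ((\<Sum>i<n. scale (c i) (e i)) - f)) \<longlonglongrightarrow> 0"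
proof (rule complete)
  fix \<epsilon> :: real assume e0: "\<epsilon> > 0"
  then obtain N where N: "\<And>m n. m \<ge> N \<Longrightarrow> norm (\<Sum>i=m..<n. (cmod (c i))\<^sup>2) < \<epsilon>\<^sup>2"
    using c[unfolded summable_Cauchy, rule_format, of "\<epsilon>\<^sup>2"] by auto
  have le: "nrm ((\<Sum>i<n. scale (c i) (e i)) - (\<Sum>i<m. scale (c i) (e i))) < \<epsilon>" if "N \<le> m" "m \<le> n" for m n
  proof -
    have "(\<Sum>i<n. scale (c i) (e i)) - (\<Sum>i<m. scale (c i) (e i)) = (\<Sum>i=m..<n. scale (c i) (e i))"
      using that by (simp add: lessThan_atLeast0 sum_diff_nat_ivl)
    then have "(nrm ((\<Sum>i<n. scale (c i) (e i)) - (\<Sum>i<m. scale (c i) (e i))))\<^sup>2 = (\<Sum>i=m..<n. (cmod (c i))\<^sup>2)"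
      by (simp add: nrm_comb_sq)
    also have "\<dots> < \<epsilon>\<^sup>2" using N[OF that(1), of n] by simp
    finally show ?thesis using e0 by (meson less_imp_le power2_less_imp_less)
  qed
  show "\<exists>N. \<forall>m\<ge>N. \<forall>n\<ge>N. nrm ((\<Sum>i<m. scale (c i) (e i)) - (\<Sum>i<n. scale (c i) (e i))) < \<epsilon>"
  proof (intro exI[of _ N] allI impI)
    fix m n assume "N \<le> m" "N \<le> n"
    then show "nrm ((\<Sum>i<m. scale (c i) (e i)) - (\<Sum>i<n. scale (c i) (e i))) < \<epsilon>"
      using le[of m n] le[of n m] nrm_minus_commute[of "\<Sum>i<m. scale (c i) (e i)" "\<Sum>i<n. scale (c i) (e i)"]
      by (cases "m \<le> n") (auto simp: comb_mem)
  qed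
qed (rule comb_mem)

end

end

section \<open>The Hilbert space \<open>L2\<close>\<close>

definition ip_L2 :: "l0 \<Rightarrow> l0 \<Rightarrow> complex" where
  "ip_L2 f g = (LINT z|circ. rep_class f z * cnj (rep_class g z))"

lemma L2_iff: "f \<in> L2 \<longleftrightarrow> integrable circ (\<lambda>z. (cmod (rep_class f z))\<^sup>2)"
  by (simp add: L2_def square_integrable_l0.rep_eq)

lemma norm_L2_eq: "norm_L2 f = sqrt (LINT z|circ. (cmod (rep_class f z))\<^sup>2)"
  by (simp add: norm_L2.rep_eq)

lemma square_integrable_mult:
  fixes F G :: "complex \<Rightarrow> complex"
  assumes [measurable]: "F \<in> borel_measurable circ" "G \<in> borel_measurable circ"
    and "integrable circ (\<lambda>z. (cmod (F z))\<^sup>2)" "integrable circ (\<lambda>z. (cmod (G z))\<^sup>2)"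
  shows "integrable circ (\<lambda>z. F z * G z)"
proof (rule Bochner_Integration.integrable_bound)
  show "integrable circ (\<lambda>z. (cmod (F z))\<^sup>2 + (cmod (G z))\<^sup>2)" using assms by simp
  show "AE z in circ. norm (F z * G z) \<le> norm ((cmod (F z))\<^sup>2 + (cmod (G z))\<^sup>2)"
  proof (rule AE_I2)
    fix z
    have "2 * cmod (F z) * cmod (G z) \<le> (cmod (F z))\<^sup>2 + (cmod (G z))\<^sup>2" by (rule sum_squares_bound)
    then show "norm (F z * G z) \<le> norm ((cmod (F z))\<^sup>2 + (cmod (G z))\<^sup>2)"
      by (simp add: norm_mult mult_nonneg_nonneg order_trans[of _ "2 * cmod (F z) * cmod (G z)"])
  qed
qed measurable

lemma L2_AE:
  assumes [measurable]: "F \<in> borel_measurable circ" and "integrable circ (\<lambda>z. (cmod (F z))\<^sup>2)"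
    and "AE z in circ. rep_class f z = F z"
  shows "f \<in> L2"
  unfolding L2_iff
  by (rule integrable_cong_AE_imp[OF assms(2)]) (use assms(3) in \<open>auto elim!: eventually_mono\<close>)

lemma L2_add: assumes "f \<in> L2" "g \<in> L2" shows "f + g \<in> L2"
proof (rule L2_AE[OF _ _ rep_plus])
  show "integrable circ (\<lambda>z. (cmod (rep_class f z + rep_class g z))\<^sup>2)"
  proof (rule Bochner_Integration.integrable_bound)
    show "integrable circ (\<lambda>z. 2 * (cmod (rep_class f z))\<^sup>2 + 2 * (cmod (rep_class g z))\<^sup>2)"
      using assms by (simp add: L2_iff)
    show "AE z in circ. norm ((cmod (rep_class f z + rep_class g z))\<^sup>2)
        \<le> norm (2 * (cmod (rep_class f z))\<^sup>2 + 2 * (cmod (rep_class g z))\<^sup>2)"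
    proof (rule AE_I2)
      fix z
      let ?a = "cmod (rep_class f z)" and ?b = "cmod (rep_class g z)"
      have "(cmod (rep_class f z + rep_class g z))\<^sup>2 \<le> (?a + ?b)\<^sup>2"
        by (intro power_mono norm_triangle_ineq) simp
      also have "\<dots> \<le> 2 * ?a\<^sup>2 + 2 * ?b\<^sup>2"
        using sum_squares_bound[of ?a ?b] by (simp add: power2_sum)
      finally show "norm ((cmod (rep_class f z + rep_class g z))\<^sup>2)
        \<le> norm (2 * (cmod (rep_class f z))\<^sup>2 + 2 * (cmod (rep_class g z))\<^sup>2)" by simp
    qed
  qed measurable
qed measurable

lemma L2_scale: "f \<in> L2 \<Longrightarrow> scale c f \<in> L2"
  by (rule L2_AE[OF _ _ rep_scale]) (auto simp: L2_iff norm_mult power_mult_distrib)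

lemma L2_zero: "0 \<in> L2"
  by (rule L2_AE[OF _ _ rep_zero]) auto

lemma subspace_L2: "l0.subspace L2"
  by (rule l0.subspaceI) (auto intro: L2_add L2_scale L2_zero)

lemma ip_norm_L2: "ip_norm ip_L2 f = norm_L2 f"
proof -
  have "ip_L2 f f = (LINT z|circ. complex_of_real ((cmod (rep_class f z))\<^sup>2))"
    unfolding ip_L2_def complex_norm_square ..
  also have "\<dots> = of_real (LINT z|circ. (cmod (rep_class f z))\<^sup>2)"
    by (rule integral_complex_of_real)
  finally show ?thesis by (simp add: ip_norm_def norm_L2_eq)
qed

lemma integral_norm_sq_le:
  fixes F :: "complex \<Rightarrow> complex"
  assumes [measurable]: "F \<in> borel_measurable circ" and sq: "integrable circ (\<lambda>z. (cmod (F z))\<^sup>2)"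
  shows "integrable circ F" "(LINT z|circ. cmod (F z)) \<le> sqrt (LINT z|circ. (cmod (F z))\<^sup>2)"
proof -
  show i: "integrable circ F"
    using square_integrable_mult[of F "\<lambda>_. 1"] sq by simp
  have "0 \<le> circ.variance (\<lambda>z. cmod (F z))" by (rule circ.variance_positive)
  also have "\<dots> = (LINT z|circ. (cmod (F z))\<^sup>2) - (LINT z|circ. cmod (F z))\<^sup>2"
    by (rule circ.variance_eq) (use i sq in auto)
  finally show "(LINT z|circ. cmod (F z)) \<le> sqrt (LINT z|circ. (cmod (F z))\<^sup>2)"
    by (intro real_le_rsqrt) simp
qed

lemma L2_L1: "f \<in> L2 \<Longrightarrow> f \<in> L1"
  by (simp add: L1_def L2_iff integral_norm_sq_le(1))

lemma norm_L1_le_L2: "f \<in> L2 \<Longrightarrow> norm_L1 f \<le> norm_L2 f"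
  by (simp add: norm_L1_def norm_L2_eq L2_iff integral_norm_sq_le(2))

lemma norm_L2_nonneg: "0 \<le> norm_L2 f"
  by (simp add: norm_L2_eq)

lemma nn_integral_L2:
  assumes "f \<in> L2"
  shows "(\<integral>\<^sup>+z. ennreal ((cmod (rep_class f z))\<^sup>2) \<partial>circ) = ennreal ((norm_L2 f)\<^sup>2)"
  using assms by (simp add: norm_L2_eq L2_iff nn_integral_eq_integral)

lemma norm_L2_le:
  assumes "(\<integral>\<^sup>+z. ennreal ((cmod (rep_class f z))\<^sup>2) \<partial>circ) \<le> ennreal (b\<^sup>2)" "0 \<le> b"
  shows "f \<in> L2" "norm_L2 f \<le> b"
proof -
  have "(\<integral>\<^sup>+z. ennreal ((cmod (rep_class f z))\<^sup>2) \<partial>circ) < \<infinity>"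
    using assms(1) by (rule le_less_trans) simp
  then show L: "f \<in> L2" unfolding L2_iff by (intro integrableI_bounded) auto
  show "norm_L2 f \<le> b"
  proof (rule power2_le_imp_le[OF _ assms(2)])
    show "(norm_L2 f)\<^sup>2 \<le> b\<^sup>2"
      using assms(1) unfolding nn_integral_L2[OF L] by (simp add: ennreal_le_iff)
  qed
qed

text \<open>Riesz and Fischer: a subsequence with increments of size \<open>(1 / 2) ^ k\<close> converges almost everywhere,
  and Fatou's lemma shows that its limit is also the limit in \<open>L2\<close>.\<close>

theorem complete_L2:
  assumes \<sigma>: "\<And>n. \<sigma> n \<in> L2"
    and C: "\<And>\<epsilon>. \<epsilon> > 0 \<Longrightarrow> \<exists>N. \<forall>m\<ge>N. \<forall>n\<ge>N. norm_L2 (\<sigma> m - \<sigma> n) < \<epsilon>"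
  shows "\<exists>f\<in>L2. (\<lambda>n. norm_L2 (\<sigma> n - f)) \<longlonglongrightarrow> 0"
proof -
  have diff: "f - g \<in> L2" if "f \<in> L2" "g \<in> L2" for f g
    using l0.subspace_diff[OF subspace_L2 that] .
  have "\<forall>k. \<exists>N. \<forall>m\<ge>N. \<forall>n\<ge>N. norm_L2 (\<sigma> m - \<sigma> n) < (1 / 2) ^ k"
    by (intro allI C) simp
  then obtain N where N_all: "\<forall>k. \<forall>m\<ge>N k. \<forall>n\<ge>N k. norm_L2 (\<sigma> m - \<sigma> n) < (1 / 2) ^ k"
    by (rule choice[THEN exE])
  then have N: "norm_L2 (\<sigma> m - \<sigma> n) < (1 / 2) ^ k" if "N k \<le> m" "N k \<le> n" for k m n
    using that by blast
  \<comment> \<open>The sum makes \<open>r\<close> monotone with \<open>N k \<le> r k\<close>, and the summand \<open>k\<close> makes it tend to infinity.\<close>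
  define r where "r k = k + (\<Sum>i\<le>k. N i)" for k
  have rN: "N k \<le> r k" for k
    unfolding r_def by (rule trans_le_add2) (rule member_le_sum, auto)
  have r_mono: "r k \<le> r (Suc k)" for k by (simp add: r_def)
  have rk: "k \<le> r k" for k by (simp add: r_def)
  define v where "v k z = rep_class (\<sigma> (r (Suc k))) z - rep_class (\<sigma> (r k)) z" for k z
  have [measurable]: "v k \<in> borel_measurable circ" for k unfolding v_def by measurable
  have v_le: "(\<integral>\<^sup>+z. ennreal (cmod (v k z)) \<partial>circ) \<le> ennreal ((1 / 2) ^ k)" for k
  proof -
    let ?g = "\<sigma> (r (Suc k)) - \<sigma> (r k)"
    have g: "?g \<in> L2" by (intro diff \<sigma>)
    have "(\<integral>\<^sup>+z. ennreal (cmod (v k z)) \<partial>circ) = (\<integral>\<^sup>+z. ennreal (cmod (rep_class ?g z)) \<partial>circ)"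
      by (rule nn_integral_cong_AE) (use rep_minus[of "\<sigma> (r (Suc k))" "\<sigma> (r k)"] in \<open>auto simp: v_def elim!: eventually_mono\<close>)
    also have "\<dots> = ennreal (norm_L1 ?g)"
      using L1_D[OF L2_L1[OF g]] by (simp add: norm_L1_def nn_integral_eq_integral)
    also have "\<dots> \<le> ennreal ((1 / 2) ^ k)"
      using norm_L1_le_L2[OF g] N[of k "r (Suc k)" "r k"] rN[of k] r_mono[of k] by (intro ennreal_leI) auto
    finally show ?thesis .
  qed
  have "(\<integral>\<^sup>+z. (\<Sum>k. ennreal (cmod (v k z))) \<partial>circ) = (\<Sum>k. \<integral>\<^sup>+z. ennreal (cmod (v k z)) \<partial>circ)"
    by (rule nn_integral_suminf) measurable
  also have "\<dots> \<le> (\<Sum>k. ennreal ((1 / 2) ^ k))" by (intro suminf_le v_le) auto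
  also have "\<dots> = ennreal (\<Sum>k. (1 / 2) ^ k)"
    by (rule suminf_ennreal2) (auto intro: summable_geometric)
  also have "\<dots> < \<infinity>" by (simp only: infinity_ennreal_def ennreal_less_top)
  finally have "(\<integral>\<^sup>+z. (\<Sum>k. ennreal (cmod (v k z))) \<partial>circ) \<noteq> \<infinity>" by (rule less_imp_neq)
  then have "AE z in circ. (\<Sum>k. ennreal (cmod (v k z))) \<noteq> \<infinity>"
    by (rule nn_integral_noteq_infinite[rotated]) measurable
  then have conv: "AE z in circ. convergent (\<lambda>k. rep_class (\<sigma> (r k)) z)"
  proof eventually_elim
    case (elim z)
    then have "summable (\<lambda>k. cmod (v k z))" by (intro summable_suminf_not_top) auto
    then have "summable (\<lambda>k. v k z)" by (rule summable_norm_cancel)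
    then have "convergent (\<lambda>n. \<Sum>k<n. v k z)" by (simp add: summable_iff_convergent)
    moreover have "(\<Sum>k<n. v k z) = rep_class (\<sigma> (r n)) z - rep_class (\<sigma> (r 0)) z" for n
      unfolding v_def by (rule sum_lessThan_telescope)
    ultimately have "convergent (\<lambda>n. rep_class (\<sigma> (r n)) z - rep_class (\<sigma> (r 0)) z)" by simp
    then have "convergent (\<lambda>n. (rep_class (\<sigma> (r n)) z - rep_class (\<sigma> (r 0)) z) + rep_class (\<sigma> (r 0)) z)"
      by (intro convergent_add convergent_const)
    then show ?case by simp
  qed
  define F where "F z = lim (\<lambda>k. rep_class (\<sigma> (r k)) z)" for z
  have [measurable]: "F \<in> borel_measurable circ"
    unfolding F_def by (rule borel_measurable_lim_metric) measurable
  define f where "f = class_of F"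
  have rf: "AE z in circ. rep_class f z = F z" unfolding f_def by (rule rep_class_of) measurable
  have close: "f - \<sigma> n \<in> L2 \<and> norm_L2 (f - \<sigma> n) \<le> (1 / 2) ^ k" if n: "N k \<le> n" for k n
  proof -
    have "(\<integral>\<^sup>+z. ennreal ((cmod (rep_class (f - \<sigma> n) z))\<^sup>2) \<partial>circ)
        = (\<integral>\<^sup>+z. liminf (\<lambda>i. ennreal ((cmod (rep_class (\<sigma> (r i)) z - rep_class (\<sigma> n) z))\<^sup>2)) \<partial>circ)"
    proof (rule nn_integral_cong_AE)
      show "AE z in circ. ennreal ((cmod (rep_class (f - \<sigma> n) z))\<^sup>2)
          = liminf (\<lambda>i. ennreal ((cmod (rep_class (\<sigma> (r i)) z - rep_class (\<sigma> n) z))\<^sup>2))"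
        using conv rf rep_minus[of f "\<sigma> n"]
      proof eventually_elim
        case (elim z)
        have "(\<lambda>i. rep_class (\<sigma> (r i)) z) \<longlonglongrightarrow> F z"
          using elim(1) by (simp add: F_def convergent_LIMSEQ_iff)
        then have "(\<lambda>i. ennreal ((cmod (rep_class (\<sigma> (r i)) z - rep_class (\<sigma> n) z))\<^sup>2))
            \<longlonglongrightarrow> ennreal ((cmod (F z - rep_class (\<sigma> n) z))\<^sup>2)"
          by (intro tendsto_ennrealI tendsto_intros)
        from lim_imp_Liminf[OF _ this] show ?case by (simp add: elim)
      qed
    qed
    also have "\<dots> \<le> liminf (\<lambda>i. \<integral>\<^sup>+z. ennreal ((cmod (rep_class (\<sigma> (r i)) z - rep_class (\<sigma> n) z))\<^sup>2) \<partial>circ)"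
      by (rule nn_integral_liminf) measurable
    also have "\<dots> \<le> ennreal (((1 / 2) ^ k)\<^sup>2)"
    proof (rule Liminf_le)
      show "eventually (\<lambda>i. (\<integral>\<^sup>+z. ennreal ((cmod (rep_class (\<sigma> (r i)) z - rep_class (\<sigma> n) z))\<^sup>2) \<partial>circ)
          \<le> ennreal (((1 / 2) ^ k)\<^sup>2)) sequentially"
      proof (rule eventually_sequentiallyI)
        fix i assume "N k \<le> i"
        then have "N k \<le> r i" using rk[of i] by simp
        then have le: "norm_L2 (\<sigma> (r i) - \<sigma> n) < (1 / 2) ^ k" using N n by blast
        have "(\<integral>\<^sup>+z. ennreal ((cmod (rep_class (\<sigma> (r i)) z - rep_class (\<sigma> n) z))\<^sup>2) \<partial>circ)
            = (\<integral>\<^sup>+z. ennreal ((cmod (rep_class (\<sigma> (r i) - \<sigma> n) z))\<^sup>2) \<partial>circ)"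
          by (rule nn_integral_cong_AE) (use rep_minus[of "\<sigma> (r i)" "\<sigma> n"] in \<open>auto elim!: eventually_mono\<close>)
        also have "\<dots> = ennreal ((norm_L2 (\<sigma> (r i) - \<sigma> n))\<^sup>2)" by (intro nn_integral_L2 diff \<sigma>)
        also have "\<dots> \<le> ennreal (((1 / 2) ^ k)\<^sup>2)"
          using le by (intro ennreal_leI power_mono) (auto simp: norm_L2_nonneg)
        finally show "(\<integral>\<^sup>+z. ennreal ((cmod (rep_class (\<sigma> (r i)) z - rep_class (\<sigma> n) z))\<^sup>2) \<partial>circ)
            \<le> ennreal (((1 / 2) ^ k)\<^sup>2)" .
      qed
    qed simp
    finally show ?thesis using norm_L2_le[of "f - \<sigma> n" "(1 / 2) ^ k"] by simp
  qed
  have "f - \<sigma> (N 0) \<in> L2" using close[of 0 "N 0"] by simp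
  then have fL: "f \<in> L2" using L2_add[OF _ \<sigma>[of "N 0"]] by fastforce
  have sym: "norm_L2 (\<sigma> n - f) = norm_L2 (f - \<sigma> n)" for n
    unfolding norm_L2_eq
    by (intro arg_cong[of _ _ sqrt] integral_cong_AE)
       (use rep_minus[of f "\<sigma> n"] rep_minus[of "\<sigma> n" f] in \<open>auto elim!: eventually_elim2 simp: norm_minus_commute\<close>)
  have "(\<lambda>n. norm_L2 (\<sigma> n - f)) \<longlonglongrightarrow> 0"
  proof (rule LIMSEQ_I)
    fix e :: real assume "e > 0"
    then obtain k where k: "(1 / 2) ^ k < e" using real_arch_pow_inv[of e "1 / 2"] by auto
    show "\<exists>no. \<forall>n\<ge>no. norm (norm_L2 (\<sigma> n - f) - 0) < e"
      using close[of k] k by (intro exI[of _ "N k"]) (auto simp: sym norm_L2_nonneg intro: le_less_trans)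
  qed
  with fL show ?thesis by blast
qed

lemma ip_L2_cong:
  assumes "AE z in circ. rep_class f z * cnj (rep_class g z) = G z" "G \<in> borel_measurable circ"
  shows "ip_L2 f g = (LINT z|circ. G z)"
  unfolding ip_L2_def by (rule integral_cong_AE) (use assms in auto)

lemma ip_L2_integrable: "f \<in> L2 \<Longrightarrow> g \<in> L2 \<Longrightarrow> integrable circ (\<lambda>z. rep_class f z * cnj (rep_class g z))"
  by (rule square_integrable_mult) (auto simp: L2_iff)

interpretation HL2: hilbert_subspace L2 ip_L2
proof
  show "l0.subspace L2" by (rule subspace_L2)
  show "ip_L2 (f + g) h = ip_L2 f h + ip_L2 g h" if "f \<in> L2" "g \<in> L2" "h \<in> L2" for f g h
  proof -
    have "ip_L2 (f + g) h = (LINT z|circ. rep_class f z * cnj (rep_class h z) + rep_class g z * cnj (rep_class h z))"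
      by (rule ip_L2_cong) (use rep_plus[of f g] in \<open>auto elim!: eventually_mono simp: distrib_right\<close>)
    also have "\<dots> = ip_L2 f h + ip_L2 g h"
      unfolding ip_L2_def by (intro Bochner_Integration.integral_add ip_L2_integrable that)
    finally show ?thesis .
  qed
  show "ip_L2 (scale c f) h = c * ip_L2 f h" for c f h
  proof -
    have "ip_L2 (scale c f) h = (LINT z|circ. c * (rep_class f z * cnj (rep_class h z)))"
      by (rule ip_L2_cong) (use rep_scale[of c f] in \<open>auto elim!: eventually_mono simp: mult_ac\<close>)
    then show ?thesis by (simp add: ip_L2_def)
  qed
  show "ip_L2 f g = cnj (ip_L2 g f)" for f g
  proof -
    have "(LINT z|circ. rep_class f z * cnj (rep_class g z))
        = (LINT z|circ. cnj (rep_class g z * cnj (rep_class f z)))"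
      by (rule Bochner_Integration.integral_cong) (simp_all add: mult.commute)
    also have "\<dots> = cnj (LINT z|circ. rep_class g z * cnj (rep_class f z))"
      by (rule Bochner_Integration.integral_cnj)
    finally show ?thesis by (simp only: ip_L2_def)
  qed
  show "0 < Re (ip_L2 f f)" if f: "f \<in> L2" "f \<noteq> 0" for f
  proof -
    have "norm_L2 f \<noteq> 0"
    proof
      assume "norm_L2 f = 0"
      then have "norm_L1 f = 0" using norm_L1_le_L2[OF f(1)] norm_L1_nonneg[of f] by simp
      then show False using norm_L1_eq_0[OF L2_L1[OF f(1)]] f(2) by simp
    qed
    then have "0 < norm_L2 f" using norm_L2_nonneg[of f] by simp
    then show ?thesis unfolding ip_norm_L2[symmetric] ip_norm_def by simp
  qed
  show "\<exists>f\<in>L2. (\<lambda>n. ip_norm ip_L2 (\<sigma> n - f)) \<longlonglongrightarrow> 0"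
    if "\<And>n. \<sigma> n \<in> L2" "\<And>\<epsilon>. \<epsilon> > 0 \<Longrightarrow> \<exists>N. \<forall>m\<ge>N. \<forall>n\<ge>N. ip_norm ip_L2 (\<sigma> m - \<sigma> n) < \<epsilon>" for \<sigma>
    using complete_L2 that unfolding ip_norm_L2 by blast
qed

lemma L2_mult_L1:
  assumes f: "f \<in> L2" and g: "g \<in> L2"
  shows "f * g \<in> L1" "norm_L1 (f * g) \<le> norm_L2 f * norm_L2 g"
proof -
  show "f * g \<in> L1"
    by (rule L1_AE[OF square_integrable_mult rep_times]) (use f g in \<open>auto simp: L2_iff\<close>)
  have mod: "modulus h \<in> L2 \<and> norm_L2 (modulus h) = norm_L2 h" if h: "h \<in> L2" for h
  proof
    show "modulus h \<in> L2" by (rule L2_AE[OF _ _ rep_modulus]) (use h in \<open>auto simp: L2_iff\<close>)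
    show "norm_L2 (modulus h) = norm_L2 h"
      unfolding norm_L2_eq
      by (intro arg_cong[of _ _ sqrt] integral_cong_AE)
         (use rep_modulus[of h] in \<open>auto elim!: eventually_mono\<close>)
  qed
  have "ip_L2 (modulus f) (modulus g) = (LINT z|circ. complex_of_real (cmod (rep_class (f * g) z)))"
    by (rule ip_L2_cong)
       (use rep_modulus[of f] rep_modulus[of g] rep_times[of f g] in \<open>eventually_elim, simp add: norm_mult\<close>, measurable)
  also have "\<dots> = of_real (norm_L1 (f * g))" by (simp add: norm_L1_def)
  finally have "norm_L1 (f * g) = cmod (ip_L2 (modulus f) (modulus g))"
    by (simp add: norm_L1_nonneg)
  also have "\<dots> \<le> norm_L2 f * norm_L2 g"
    using HL2.cauchy_schwarz[of "modulus f" "modulus g"] mod f g by (simp add: ip_norm_L2)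
  finally show "norm_L1 (f * g) \<le> norm_L2 f * norm_L2 g" .
qed

lemma zp_L2: "zp n \<in> L2"
  by (rule L2_AE[OF _ _ rep_zp])
     (auto intro!: integrable_circ_bounded[of _ 1] AE_circ_sphere simp: norm_powi_sphere)

lemma ip_L2_zp: "ip_L2 f (zp n) = fourier f n"
  unfolding fourier_eq
proof (rule ip_L2_cong)
  show "AE z in circ. rep_class f z * cnj (rep_class (zp n) z) = rep_class f z * z powi - n"
    using rep_zp[of n] AE_space[of circ]
  proof eventually_elim
    case (elim z)
    then have "cnj z = inverse z" by (simp add: inverse_complex.code complex_eq_iff cmod_def)
    then show ?case by (simp add: elim power_int_minus power_int_inverse)
  qed
qed measurable

lemma fourier_zp: "fourier (zp m) n = (if m = n then 1 else 0)"
proof -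
  have "fourier (zp m) n = (LINT z|circ. z powi (m - n))"
    unfolding fourier_eq
  proof (rule integral_cong_AE)
    have "AE z in circ. z \<noteq> (0 :: complex)" by (rule AE_circ_sphere) auto
    with rep_zp[of m] show "AE z in circ. rep_class (zp m) z * z powi - n = z powi (m - n)"
      by eventually_elim (simp flip: power_int_add)
  qed measurable
  then show ?thesis by (simp add: integral_powi)
qed

lemma zp_orthonormal: "ip_L2 (zp (int i)) (zp (int j)) = (if i = j then 1 else 0)"
  by (simp add: ip_L2_zp fourier_zp)

lemma fourier_L2_lim:
  assumes "\<And>n. s n \<in> L2" "f \<in> L2" "(\<lambda>n. norm_L2 (s n - f)) \<longlonglongrightarrow> 0"
  shows "(\<lambda>n. fourier (s n) j) \<longlonglongrightarrow> fourier f j"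
  using HL2.ip_lim[OF assms(1,2) zp_L2[of j]] assms(3) by (simp add: ip_L2_zp ip_norm_L2)

definition power_sum :: "(nat \<Rightarrow> complex) \<Rightarrow> nat \<Rightarrow> l0" where
  "power_sum c n = (\<Sum>i<n. scale (c i) (zp (int i)))"

lemma power_sum_L2: "power_sum c n \<in> L2"
  unfolding power_sum_def by (intro HL2.sum_mem HL2.scale_mem zp_L2)

lemma norm_L2_power_sum: "(norm_L2 (power_sum c n))\<^sup>2 = (\<Sum>i<n. (cmod (c i))\<^sup>2)"
  using HL2.nrm_comb_sq[OF zp_L2 zp_orthonormal, of "{..<n}" c]
  by (simp add: power_sum_def ip_norm_L2)

lemma fourier_power_sum: "fourier (power_sum c n) j = (if 0 \<le> j \<and> j < int n then c (nat j) else 0)"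
proof -
  have "fourier (power_sum c n) j = (\<Sum>i<n. c i * fourier (zp (int i)) j)"
    unfolding power_sum_def ip_L2_zp[symmetric]
    by (subst HL2.ip_sum_left) (auto simp: HL2.scale_mem zp_L2 HL2.ip_scale)
  also have "\<dots> = (\<Sum>i<n. if i = nat j \<and> 0 \<le> j then c i else 0)"
    by (rule sum.cong) (auto simp: fourier_zp)
  also have "\<dots> = (if 0 \<le> j \<and> j < int n then c (nat j) else 0)"
    by (cases "0 \<le> j") (auto simp: nat_less_iff)
  finally show ?thesis .
qed

lemma power_series_H2:
  assumes "summable (\<lambda>i. (cmod (c i))\<^sup>2)"
  shows "\<exists>g\<in>H2. (\<lambda>n. norm_L2 (power_sum c n - g)) \<longlonglongrightarrow> 0 \<and> (\<forall>i. fourier g (int i) = c i)"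
proof -
  obtain g where g: "g \<in> L2" "(\<lambda>n. norm_L2 (power_sum c n - g)) \<longlonglongrightarrow> 0"
    using HL2.orthonormal_series[OF zp_L2 zp_orthonormal assms] by (auto simp: ip_norm_L2 power_sum_def)
  have lim: "(\<lambda>n. fourier (power_sum c n) j) \<longlonglongrightarrow> fourier g j" for j
    by (rule fourier_L2_lim[OF power_sum_L2 g])
  have "fourier g j = 0" if "j < 0" for j
    using lim[of j] that by (simp add: fourier_power_sum LIMSEQ_const_iff)
  moreover have "fourier g (int i) = c i" for i
  proof -
    have "eventually (\<lambda>n. c i = fourier (power_sum c n) (int i)) sequentially"
      by (rule eventually_sequentiallyI[of "Suc i"]) (simp add: fourier_power_sum)
    then have "(\<lambda>n. fourier (power_sum c n) (int i)) \<longlonglongrightarrow> c i"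
      by (rule tendsto_eventually[OF eventually_mono]) simp
    from LIMSEQ_unique[OF lim this] show ?thesis .
  qed
  ultimately show ?thesis using g by (intro bexI[of _ g]) (auto simp: H2_def)
qed

text \<open>By Bessel's inequality the power series of \<open>g\<close> converges in \<open>L2\<close>; its sum has the Fourier coefficients of
  \<open>g\<close>, hence is \<open>g\<close>.\<close>

lemma H2_power_series:
  assumes g: "g \<in> H2"
  shows "summable (\<lambda>i. (cmod (fourier g (int i)))\<^sup>2)"
    "(\<lambda>n. norm_L2 (power_sum (\<lambda>i. fourier g (int i)) n - g)) \<longlonglongrightarrow> 0"
proof -
  have gL: "g \<in> L2" using g by (simp add: H2_def)
  show s: "summable (\<lambda>i. (cmod (fourier g (int i)))\<^sup>2)"
    using HL2.bessel[OF zp_L2 zp_orthonormal gL] by (simp add: ip_L2_zp)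
  obtain g' where g': "g' \<in> H2" "(\<lambda>n. norm_L2 (power_sum (\<lambda>i. fourier g (int i)) n - g')) \<longlonglongrightarrow> 0"
    "\<And>i. fourier g' (int i) = fourier g (int i)"
    using power_series_H2[OF s] by auto
  have "g' = g"
  proof (rule fourier_eqI)
    show "fourier g' n = fourier g n" for n
      using g'(1) g g'(3)[of "nat n"] by (cases "0 \<le> n") (auto simp: H2_def)
  qed (use g' gL in \<open>auto simp: H2_def L2_L1\<close>)
  with g'(2) show "(\<lambda>n. norm_L2 (power_sum (\<lambda>i. fourier g (int i)) n - g)) \<longlonglongrightarrow> 0" by simp
qed

section \<open>Shift-invariant Hilbert spaces of functions in \<open>H1\<close>\<close>

lemma norm_L1_scale: "norm_L1 (scale c f) = cmod c * norm_L1 f"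
proof -
  have "norm_L1 (scale c f) = (LINT z|circ. cmod c * cmod (rep_class f z))"
    unfolding norm_L1_def
    by (rule integral_cong_AE) (use rep_scale[of c f] in \<open>auto elim!: eventually_mono simp: norm_mult\<close>)
  then show ?thesis by (simp add: norm_L1_def)
qed

text \<open>The norm \<open>\<alpha>\<close> enters the description of \<open>M\<close> only through the inclusion of \<open>M\<close> in \<open>H1\<close>.\<close>

locale shift_isometry = hilbert_subspace +
  assumes M_H1: "M \<subseteq> H1"
    and T_mem: "f \<in> M \<Longrightarrow> T_z f \<in> M"
    and T_isometry: "f \<in> M \<Longrightarrow> ip_norm ip (T_z f) = ip_norm ip f"
begin

lemma M_L1: "f \<in> M \<Longrightarrow> f \<in> L1"
  using M_H1 by (auto simp: H1_def)

lemma zp_Suc: "zp (int (Suc n)) * f = T_z (zp (int n) * f)"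
  by (simp add: T_z_zp zp_add mult.assoc)

lemma zp_mem: "f \<in> M \<Longrightarrow> zp (int n) * f \<in> M"
  by (induction n) (auto simp: zp_Suc T_mem simp del: of_nat_Suc)

lemma nrm_zp: "f \<in> M \<Longrightarrow> nrm (zp (int n) * f) = nrm f"
  by (induction n) (auto simp: zp_Suc T_isometry zp_mem simp del: of_nat_Suc)

text \<open>By polarization the norm determines the inner product.\<close>

lemma ip_zp:
  assumes f: "f \<in> M" and g: "g \<in> M" shows "ip (zp (int n) * f) (zp (int n) * g) = ip f g"
proof -
  have re: "Re (ip (zp (int n) * a) (zp (int n) * b)) = Re (ip a b)" if a: "a \<in> M" and b: "b \<in> M" for a b
    using nrm_add_sq[OF zp_mem[OF a, of n] zp_mem[OF b, of n]] nrm_add_sq[OF a b]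
      nrm_zp[OF add_mem[OF a b], of n] nrm_zp[OF a, of n] nrm_zp[OF b, of n]
    by (simp add: distrib_left)
  have "Im (ip a b) = Re (ip (scale (- \<i>) a) b)" if "a \<in> M" "b \<in> M" for a b
    using ip_scale[OF that, of "- \<i>"] by simp
  then have "Im (ip (zp (int n) * f) (zp (int n) * g)) = Im (ip f g)"
    using re[OF scale_mem[OF f, of "- \<i>"] g] f g by (simp add: zp_mem scale_mult_right)
  with re[OF f g] show ?thesis by (simp add: complex_eq_iff)
qed

definition shifted :: "nat \<Rightarrow> l0 set" where "shifted m = (\<lambda>h. zp (int m) * h) ` M"

lemma shifted_subset: "shifted m \<subseteq> M"
  by (auto simp: shifted_def zp_mem)

lemma subspace_shifted: "l0.subspace (shifted m)"
proof (rule l0.subspaceI)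
  show "0 \<in> shifted m" unfolding shifted_def by (rule image_eqI[OF _ zero_mem]) simp
  show "x + y \<in> shifted m" if "x \<in> shifted m" "y \<in> shifted m" for x y
    using that add_mem unfolding shifted_def by (auto simp flip: distrib_left)
  show "scale c x \<in> shifted m" if "x \<in> shifted m" for c x
    using that scale_mem unfolding shifted_def by (auto simp: scale_mult_right)
qed

lemma shifted_antimono: assumes "m \<le> n" shows "shifted n \<subseteq> shifted m"
proof
  fix x assume "x \<in> shifted n"
  then obtain h where h: "h \<in> M" "x = zp (int n) * h" by (auto simp: shifted_def)
  have "zp (int n) = zp (int m) * zp (int (n - m))"
    using assms by (simp flip: zp_add)
  with h show "x \<in> shifted m"
    unfolding shifted_def by (intro image_eqI[of _ _ "zp (int (n - m)) * h"]) (auto simp: mult.assoc zp_mem)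
qed

text \<open>The range of an isometry is complete.\<close>

lemma shifted_closed:
  assumes s: "\<And>n. s n \<in> shifted m" and f: "f \<in> M" and lim: "(\<lambda>n. nrm (s n - f)) \<longlonglongrightarrow> 0"
  shows "f \<in> shifted m"
proof -
  have "\<exists>h. \<forall>n. h n \<in> M \<and> s n = zp (int m) * h n"
    using s unfolding shifted_def by (intro choice) auto
  then obtain h where h: "\<And>n. h n \<in> M" "\<And>n. s n = zp (int m) * h n" by blast
  have sM: "s n \<in> M" for n using s shifted_subset by blast
  have diff: "nrm (h i - h j) = nrm (s i - s j)" for i j
    using nrm_zp[OF diff_mem[OF h(1) h(1)], of m i j] by (simp add: h(2) right_diff_distrib)
  have "\<exists>g\<in>M. (\<lambda>n. nrm (h n - g)) \<longlonglongrightarrow> 0"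
  proof (rule complete[OF h(1)])
    fix \<epsilon> :: real assume "\<epsilon> > 0"
    then show "\<exists>N. \<forall>i\<ge>N. \<forall>j\<ge>N. nrm (h i - h j) < \<epsilon>"
      unfolding diff by (rule convergent_Cauchy[OF sM f lim])
  qed
  then obtain g where g: "g \<in> M" "(\<lambda>n. nrm (h n - g)) \<longlonglongrightarrow> 0" by blast
  have "nrm (s n - zp (int m) * g) = nrm (h n - g)" for n
    using nrm_zp[OF diff_mem[OF h(1) g(1)], of m n] by (simp add: h(2) right_diff_distrib)
  then have "(\<lambda>n. nrm (s n - zp (int m) * g)) \<longlonglongrightarrow> 0" using g(2) by simp
  then have "f = zp (int m) * g"
    by (rule lim_unique[OF sM f zp_mem[OF g(1)] lim])
  then show ?thesis using g(1) by (simp add: shifted_def)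
qed

text \<open>A division by \<open>z\<close> moves every Fourier coefficient one place down, and finally below index \<open>0\<close>, where
  functions in \<open>H1\<close> have none.\<close>

lemma divisible_zero:
  assumes SM: "S \<subseteq> M" and div: "\<And>h. h \<in> S \<Longrightarrow> \<exists>k\<in>S. h = T_z k" and h: "h \<in> S"
  shows "h = 0"
proof (rule zero_if_fourier_zero)
  show "h \<in> L1" using SM h M_L1 by blast
  have neg: "fourier h n = 0" if "h \<in> S" "n < 0" for h n
    using that SM M_H1 by (auto simp: H1_def)
  have "\<forall>h\<in>S. fourier h (int n) = 0" for n
  proof (induction n)
    case 0
    show ?case
    proof
      fix h assume "h \<in> S"
      then obtain k where "k \<in> S" "h = T_z k" using div by blast
      then show "fourier h (int 0) = 0" using neg[of k "-1"] by (simp add: T_z_zp fourier_zp_mult)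
    qed
  next
    case (Suc n)
    show ?case
    proof
      fix h assume "h \<in> S"
      then obtain k where "k \<in> S" "h = T_z k" using div by blast
      then show "fourier h (int (Suc n)) = 0" using Suc by (simp add: T_z_zp fourier_zp_mult)
    qed
  qed
  then show "fourier h n = 0" for n
    using neg[OF h, of n] h by (cases "0 \<le> n") (auto elim: nonneg_int_cases)
qed

text \<open>Although the two norms are unrelated by hypothesis, the inclusion of \<open>M\<close> in \<open>L1\<close> is bounded. The
  proof is a gliding hump. Were it unbounded, there would be unit vectors \<open>f k\<close> in \<open>M\<close> with huge norm in
  \<open>L1\<close>, detected by trigonometric polynomials \<open>q k\<close>. In the series \<open>\<Sum>k. \<plusminus> (1 / 2) ^ k * z ^ m k * f k\<close>, which converges in
  \<open>M\<close> because \<open>T_z\<close> is isometric, the shifts \<open>m k\<close> can grow so fast that the pairing with the shifted \<open>q k\<close>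
  vanishes on all later terms, exactly and on their sum, as all of these lie in a shifted copy of \<open>M\<close>.
  The sum would then have infinite norm in \<open>L1\<close>. The isometry is what makes the
  shifted copies of \<open>M\<close> closed.\<close>

theorem L1_bounded: "\<exists>C\<ge>0. \<forall>f\<in>M. norm_L1 f \<le> C * nrm f"
proof (rule ccontr)
  assume unbounded: "\<not> ?thesis"
  have "\<exists>f\<in>M. nrm f = 1 \<and> 4 ^ k < norm_L1 f" for k :: nat
  proof -
    obtain f where f: "f \<in> M" "4 ^ k * nrm f < norm_L1 f"
      using unbounded by (metis not_le zero_le_numeral zero_le_power)
    have "f \<noteq> 0"
    proof
      assume "f = 0"
      then have "0 < norm_L1 0" using f(2) by (simp add: nrm_zero)
      then show False using norm_L1_scale[of 0 0] by simp
    qed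
    then have p: "0 < nrm f" using nrm_eq_0[OF f(1)] nrm_nonneg[OF f(1)] by linarith
    show ?thesis
      using f p by (intro bexI[of _ "scale (of_real (1 / nrm f)) f"] scale_mem)
        (auto simp: nrm_scale norm_L1_scale norm_divide field_simps)
  qed
  then obtain f where f: "\<And>k. f k \<in> M" "\<And>k. nrm (f k) = 1" "\<And>k. 4 ^ k < norm_L1 (f k)" by metis
  have "\<exists>q d c. trig q \<and> (\<forall>z. cmod z = 1 \<longrightarrow> cmod (q z) \<le> 1 \<and> q z = trig_sum d c z)
      \<and> 4 ^ k < cmod (LINT z|circ. rep_class (f k) z * q z)" for k
    using trig_norming[OF L1_D[OF M_L1[OF f(1)]], of "4 ^ k" k] f(3)[of k] unfolding trig_def norm_L1_def by metis
  then obtain q d c where q: "\<And>k. trig (q k)" "\<And>k z. cmod z = 1 \<Longrightarrow> cmod (q k z) \<le> 1"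
    "\<And>k z. cmod z = 1 \<Longrightarrow> q k z = trig_sum (d k) (c k) z"
    "\<And>k. 4 ^ k < cmod (LINT z|circ. rep_class (f k) z * q k z)" by metis
  note [measurable] = trig_measurable[OF q(1)]
  \<comment> \<open>The pairing with \<open>q k\<close> sees only frequencies in \<open>{- d k..d k}\<close>, so after the shift by \<open>m k\<close>
    it does not see \<open>shifted (m (Suc k))\<close>.\<close>
  define m where "m k = (\<Sum>i<k. Suc (d i))" for k
  have m_Suc: "m (Suc k) = m k + Suc (d k)" for k by (simp add: m_def)
  have m_mono: "m i \<le> m j" if "i \<le> j" for i j
    unfolding m_def using that by (intro sum_mono2) auto
  define \<Lambda> where "\<Lambda> k g = (LINT z|circ. rep_class g z * (q k z * z powi (- int (m k))))" for k g
  have \<Lambda>_int: "integrable circ (\<lambda>z. rep_class g z * (q k z * z powi (- int (m k))))" if "g \<in> L1" for g k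
    by (rule Bochner_Integration.integrable_bound[OF integrable_norm[OF L1_D[OF that]]])
       (auto intro!: AE_circ_sphere simp: norm_mult norm_powi_sphere q(2) mult_left_le)
  have \<Lambda>_add: "\<Lambda> k (g + h) = \<Lambda> k g + \<Lambda> k h" if "g \<in> L1" "h \<in> L1" for k g h
  proof -
    have "\<Lambda> k (g + h) = (LINT z|circ. rep_class g z * (q k z * z powi (- int (m k)))
        + rep_class h z * (q k z * z powi (- int (m k))))"
      unfolding \<Lambda>_def
      by (rule integral_cong_AE) (use rep_plus[of g h] in \<open>auto elim!: eventually_mono simp: distrib_right\<close>)
    also have "\<dots> = \<Lambda> k g + \<Lambda> k h"
      unfolding \<Lambda>_def by (intro Bochner_Integration.integral_add \<Lambda>_int that)
    finally show ?thesis .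
  qed
  have \<Lambda>_diff: "\<Lambda> k (g - h) = \<Lambda> k g - \<Lambda> k h" if "g \<in> L1" "h \<in> L1" for k g h
    using \<Lambda>_add[OF L1_diff[OF that] that(2), of k] by simp
  have \<Lambda>_scale: "\<Lambda> k (scale a g) = a * \<Lambda> k g" for k a g
  proof -
    have "\<Lambda> k (scale a g) = (LINT z|circ. a * (rep_class g z * (q k z * z powi (- int (m k)))))"
      unfolding \<Lambda>_def
      by (rule integral_cong_AE) (use rep_scale[of a g] in \<open>auto elim!: eventually_mono\<close>)
    then show ?thesis by (simp add: \<Lambda>_def)
  qed
  have \<Lambda>_le: "cmod (\<Lambda> k g) \<le> norm_L1 g" if "g \<in> L1" for k g
  proof -
    have "cmod (\<Lambda> k g) \<le> (LINT z|circ. cmod (rep_class g z * (q k z * z powi (- int (m k)))))"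
      unfolding \<Lambda>_def by (rule integral_norm_bound)
    also have "\<dots> \<le> norm_L1 g"
      unfolding norm_L1_def
      by (rule integral_mono[OF integrable_norm[OF \<Lambda>_int[OF that]] integrable_norm[OF L1_D[OF that]]])
         (auto simp: norm_mult norm_powi_sphere q(2) mult_left_le)
    finally show ?thesis .
  qed
  have \<Lambda>_shift: "\<Lambda> k (zp (int n) * g) = (LINT z|circ. rep_class g z * (q k z * z powi (int n - int (m k))))"
    for k n g
    unfolding \<Lambda>_def
  proof (rule integral_cong_AE)
    have "AE z in circ. z \<noteq> (0 :: complex)" by (rule AE_circ_sphere) auto
    with rep_zp_mult[of "int n" g]
    show "AE z in circ. rep_class (zp (int n) * g) z * (q k z * z powi (- int (m k)))
        = rep_class g z * (q k z * z powi (int n - int (m k)))"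
      by eventually_elim (simp add: power_int_diff power_int_minus divide_inverse mult_ac)
  qed measurable
  have \<Lambda>_zero: "\<Lambda> k g = 0" if g: "g \<in> shifted (m (Suc k))" for k g
  proof -
    obtain h where h: "h \<in> M" "g = zp (int (m (Suc k))) * h" using g by (auto simp: shifted_def)
    let ?n = "int (Suc (d k))"
    have "\<Lambda> k g = (LINT z|circ. (rep_class h z * z powi ?n) * trig_sum (d k) (c k) z)"
      unfolding h(2) \<Lambda>_shift
      by (rule Bochner_Integration.integral_cong) (auto simp: q(3) m_Suc mult_ac)
    also have "\<dots> = (\<Sum>j = - int (d k)..int (d k). c k j * (LINT z|circ. (rep_class h z * z powi ?n) * z powi j))"
      by (rule integral_times_trig_sum) (intro integrable_mult_powi L1_D M_L1 h)
    also have "\<dots> = 0"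
    proof (intro sum.neutral ballI)
      fix j assume "j \<in> {- int (d k)..int (d k)}"
      then have j: "- (?n + j) < 0" by simp
      have "(LINT z|circ. (rep_class h z * z powi ?n) * z powi j) = fourier h (- (?n + j))"
        unfolding fourier_eq
      proof (rule Bochner_Integration.integral_cong[OF refl])
        fix z assume "z \<in> space circ"
        then have "z \<noteq> 0" by auto
        then show "(rep_class h z * z powi ?n) * z powi j = rep_class h z * z powi (- (- (?n + j)))"
          using power_int_add[of z ?n j] by (simp only: mult.assoc minus_minus simp_thms)
      qed
      also have "\<dots> = 0" using h(1) j M_H1 by (auto simp: H1_def)
      finally show "c k j * (LINT z|circ. (rep_class h z * z powi ?n) * z powi j) = 0" by simp
    qed
    finally show ?thesis .
  qed
  define u where "u k = scale ((1 / 2) ^ k) (zp (int (m k)) * f k)" for k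
  have u: "u k \<in> shifted (m k)" for k
    unfolding u_def by (rule l0.subspace_scale[OF subspace_shifted]) (simp add: shifted_def f(1))
  have uM: "u k \<in> M" for k using u shifted_subset by blast
  have u_nrm: "nrm (u k) = (1 / 2) ^ k" for k
    by (simp add: u_def nrm_scale zp_mem nrm_zp f norm_power)
  have u_big: "2 ^ k < cmod (\<Lambda> k (u k))" for k
  proof -
    have "\<Lambda> k (u k) = (1 / 2) ^ k * (LINT z|circ. rep_class (f k) z * q k z)"
      unfolding u_def \<Lambda>_scale \<Lambda>_shift by simp
    then have "cmod (\<Lambda> k (u k)) = (1 / 2) ^ k * cmod (LINT z|circ. rep_class (f k) z * q k z)"
      by (simp add: norm_mult norm_power norm_divide)
    moreover have "(2::real) ^ k = (1 / 2) ^ k * 4 ^ k" by (simp flip: power_mult_distrib)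
    ultimately show ?thesis using q(4)[of k] by simp
  qed
  \<comment> \<open>The sign of the next term is chosen so that the earlier terms cannot cancel its contribution.\<close>
  define S where "S = rec_nat 0 (\<lambda>k s. if cmod (\<Lambda> k (u k)) \<le> cmod (\<Lambda> k (s + u k)) then s + u k else s - u k)"
  have S_Suc: "S (Suc k) = (if cmod (\<Lambda> k (u k)) \<le> cmod (\<Lambda> k (S k + u k)) then S k + u k else S k - u k)" for k
    by (simp add: S_def)
  have S0: "S 0 = 0" by (simp add: S_def)
  have SM: "S k \<in> M" for k
    by (induction k) (auto simp: S0 S_Suc zero_mem intro: add_mem diff_mem uM)
  define v where "v k = S (Suc k) - S k" for k
  have v: "v k = u k \<or> v k = - u k" for k by (auto simp: v_def S_Suc)
  have v_shifted: "v k \<in> shifted (m k)" for k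
    using v[of k] u[of k] l0.subspace_neg[OF subspace_shifted] by auto
  have vM: "v k \<in> M" for k using v_shifted shifted_subset by blast
  have v_nrm: "nrm (v k) \<le> (1 / 2) ^ k" for k
    using v[of k] u_nrm[of k] nrm_scale[OF uM, of "-1" k] by auto
  have S_sum: "S n - S j = (\<Sum>i=j..<n. v i)" if "j \<le> n" for n j
    unfolding v_def using that by (simp add: sum_Suc_diff')
  have S_big: "2 ^ k < cmod (\<Lambda> k (S (Suc k)))" for k
  proof (cases "cmod (\<Lambda> k (u k)) \<le> cmod (\<Lambda> k (S k + u k))")
    case True
    then show ?thesis using u_big[of k] by (simp add: S_Suc)
  next
    case False
    have "2 * cmod (\<Lambda> k (u k)) = cmod (\<Lambda> k (S k + u k) - \<Lambda> k (S k - u k))"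
      by (simp add: \<Lambda>_add \<Lambda>_diff M_L1 SM uM flip: norm_mult_numeral1 mult_2)
    also have "\<dots> \<le> cmod (\<Lambda> k (S k + u k)) + cmod (\<Lambda> k (S k - u k))" by (rule norm_triangle_ineq4)
    finally show ?thesis using False u_big[of k] by (simp add: S_Suc)
  qed
  have "\<exists>g\<in>M. (\<lambda>n. nrm ((\<Sum>i<n. v i) - g)) \<longlonglongrightarrow> 0"
    by (rule absolutely_convergent[OF vM v_nrm]) (simp add: summable_geometric)
  then obtain g where g: "g \<in> M" "(\<lambda>n. nrm (S n - g)) \<longlonglongrightarrow> 0"
    using S_sum[of 0] by (auto simp: S0 lessThan_atLeast0)
  have tail: "g - S (Suc k) \<in> shifted (m (Suc k))" for k
  proof (rule shifted_closed[of "\<lambda>n. S (n + Suc k) - S (Suc k)"])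
    show "S (n + Suc k) - S (Suc k) \<in> shifted (m (Suc k))" for n
      unfolding S_sum[of "Suc k" "n + Suc k", OF le_add2]
      using v_shifted m_mono shifted_antimono
      by (intro l0.subspace_sum[OF subspace_shifted]) (meson atLeastLessThan_iff subsetD)
    show "g - S (Suc k) \<in> M" by (intro diff_mem g SM)
    show "(\<lambda>n. nrm (S (n + Suc k) - S (Suc k) - (g - S (Suc k)))) \<longlonglongrightarrow> 0"
      using LIMSEQ_ignore_initial_segment[OF g(2), of "Suc k"] by simp
  qed
  have "2 ^ k < norm_L1 g" for k
  proof -
    have "\<Lambda> k g = \<Lambda> k (S (Suc k))"
      using \<Lambda>_zero[OF tail[of k]] \<Lambda>_diff[OF M_L1[OF g(1)] M_L1[OF SM[of "Suc k"]], of k] by simp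
    then show ?thesis using S_big[of k] \<Lambda>_le[OF M_L1[OF g(1)], of k] by simp
  qed
  moreover obtain k where "norm_L1 g < 2 ^ k" using real_arch_pow[of 2 "norm_L1 g"] by auto
  ultimately show False by (meson less_asym)
qed

lemma L1_lim:
  assumes s: "\<And>n. s n \<in> M" and f: "f \<in> M" and lim: "(\<lambda>n. nrm (s n - f)) \<longlonglongrightarrow> 0"
  shows "(\<lambda>n. norm_L1 (s n - f)) \<longlonglongrightarrow> 0"
proof -
  obtain C where C: "\<And>g. g \<in> M \<Longrightarrow> norm_L1 g \<le> C * nrm g" using L1_bounded by blast
  have "(\<lambda>n. C * nrm (s n - f)) \<longlonglongrightarrow> 0" using tendsto_mult_right_zero[OF lim] .
  then show ?thesis
    by (rule Lim_null_comparison[rotated]) (use C diff_mem s f in \<open>auto simp: norm_L1_nonneg\<close>)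
qed

end

section \<open>Wandering vectors\<close>

text \<open>Multiplication by a power of \<open>z\<close> makes a trigonometric polynomial analytic and preserves its modulus.\<close>

lemma trig_power_sum:
  assumes "trig q"
  shows "\<exists>N c. AE z in circ. cmod (q z) = cmod (rep_class (power_sum c N) z)"
proof -
  obtain N c where q: "\<And>z. cmod z = 1 \<Longrightarrow> q z = trig_sum N c z"
    using assms unfolding trig_def by metis
  define a where "a i = c (int i - int N)" for i
  define n where "n = Suc (2 * N)"
  have rep: "AE z in circ. rep_class (power_sum a k) z = (\<Sum>i<k. a i * z powi int i)" for k
  proof (induction k)
    case 0
    then show ?case using rep_zero by (simp add: power_sum_def)
  next
    case (Suc k)
    have "power_sum a (Suc k) = power_sum a k + scale (a k) (zp (int k))" by (simp add: power_sum_def)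
    with Suc rep_plus[of "power_sum a k" "scale (a k) (zp (int k))"] rep_scale[of "a k" "zp (int k)"] rep_zp[of "int k"]
    show ?case by auto
  qed
  have "AE z in circ. cmod (q z) = cmod (rep_class (power_sum a n) z)"
    using rep[of n] AE_space[of circ]
  proof eventually_elim
    case (elim z)
    then have z: "cmod z = 1" "z \<noteq> 0" by auto
    have "(\<Sum>i<n. a i * z powi int i) = (\<Sum>j = - int N..int N. c j * z powi (int N + j))"
      by (rule sum.reindex_bij_witness[of _ "\<lambda>j. nat (int N + j)" "\<lambda>i. int i - int N"])
         (auto simp: a_def n_def)
    also have "\<dots> = z powi int N * q z"
      using z by (simp add: q trig_sum_def sum_distrib_left power_int_add mult_ac)
    finally show ?case using elim z by (simp add: norm_mult norm_power)
  qed
  then show ?thesis by blast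
qed

context shift_isometry
begin

text \<open>The orthogonal complement of \<open>T_z ` M\<close>, the wandering subspace of the Wold decomposition.\<close>

definition wandering :: "l0 set" where
  "wandering = {f \<in> M. \<forall>h\<in>M. ip f (T_z h) = 0}"

lemma wandering_ip:
  assumes ij: "i < j" and a: "a \<in> wandering" and b: "b \<in> M"
  shows "ip (zp (int i) * a) (zp (int j) * b) = 0"
proof -
  have aM: "a \<in> M" using a by (simp add: wandering_def)
  obtain k where k: "j = i + Suc k" using ij less_imp_Suc_add by auto
  have "zp (int j) * b = zp (int i) * T_z (zp (int k) * b)"
    by (simp add: k T_z_zp zp_add mult_ac)
  then have "ip (zp (int i) * a) (zp (int j) * b) = ip a (T_z (zp (int k) * b))"
    by (simp add: ip_zp aM T_mem zp_mem b)
  then show ?thesis using a zp_mem[OF b] by (simp add: wandering_def)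
qed

lemma wandering_orthonormal:
  assumes \<phi>: "\<phi> \<in> wandering" "nrm \<phi> = 1"
  shows "ip (zp (int i) * \<phi>) (zp (int j) * \<phi>) = (if i = j then 1 else 0)"
proof -
  have \<phi>M: "\<phi> \<in> M" using \<phi>(1) by (simp add: wandering_def)
  show ?thesis
  proof (cases i j rule: linorder_cases)
    case less
    then show ?thesis using wandering_ip[OF less \<phi>(1) \<phi>M] by simp
  next
    case equal
    then show ?thesis using ip_zp[OF \<phi>M \<phi>M] ip_self[OF \<phi>M] \<phi>(2) by simp
  next
    case greater
    then show ?thesis using wandering_ip[OF greater \<phi>(1) \<phi>M] ip_sym[OF zp_mem[OF \<phi>M] zp_mem[OF \<phi>M], of i j] by simp
  qed
qed

lemma mult_power_sum: "\<phi> * power_sum c n = (\<Sum>i<n. scale (c i) (zp (int i) * \<phi>))"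
  unfolding power_sum_def sum_distrib_left
  by (rule sum.cong) (simp_all only: scale_mult_right[symmetric] mult.commute[of \<phi>])

lemma mult_power_sum_mem: "\<phi> \<in> M \<Longrightarrow> \<phi> * power_sum c n \<in> M"
  unfolding mult_power_sum by (intro sum_mem scale_mem zp_mem)

lemma nrm_mult_power_sum:
  assumes \<phi>: "\<phi> \<in> wandering" "nrm \<phi> = 1"
  shows "nrm (\<phi> * power_sum c n) = norm_L2 (power_sum c n)"
proof -
  have \<phi>M: "\<phi> \<in> M" using \<phi>(1) by (simp add: wandering_def)
  have "(nrm (\<phi> * power_sum c n))\<^sup>2 = (norm_L2 (power_sum c n))\<^sup>2"
    unfolding mult_power_sum norm_L2_power_sum
    by (rule nrm_comb_sq[OF zp_mem[OF \<phi>M] wandering_orthonormal[OF \<phi>]]) simp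
  then show ?thesis
    using nrm_nonneg[OF mult_power_sum_mem[OF \<phi>M]] norm_L2_nonneg by simp
qed

text \<open>Multiplication by \<open>\<phi>\<close> is isometric from the polynomials with the norm of \<open>L2\<close> into \<open>M\<close>, and thus bounded
  into \<open>L1\<close>. The bound depends on moduli alone, so it passes from polynomials to trigonometric polynomials, and
  by dominated convergence to bounded functions. For the truncation \<open>g\<close> of the modulus of \<open>\<phi>\<close> it gives
  \<open>\<integral>g\<^sup>2 \<le> \<integral>\<bar>\<phi>\<bar> g \<le> C (\<integral>g\<^sup>2)\<^bsup>1/2\<^esup>\<close>, hence \<open>\<integral>g\<^sup>2 \<le> C\<^sup>2\<close> at every height of truncation.\<close>

lemma wandering_L2:
  assumes \<phi>: "\<phi> \<in> wandering" "nrm \<phi> = 1"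
  shows "\<phi> \<in> L2"
proof -
  have \<phi>M: "\<phi> \<in> M" using \<phi>(1) by (simp add: wandering_def)
  have i\<phi>: "integrable circ (rep_class \<phi>)" by (rule L1_D[OF M_L1[OF \<phi>M]])
  obtain C where C: "C \<ge> 0" "\<And>f. f \<in> M \<Longrightarrow> norm_L1 f \<le> C * nrm f" using L1_bounded by blast
  have trig_bound: "(LINT z|circ. cmod (rep_class \<phi> z * q z)) \<le> C * sqrt (LINT z|circ. (cmod (q z))\<^sup>2)"
    if q: "trig q" for q
  proof -
    obtain N c where Nc: "AE z in circ. cmod (q z) = cmod (rep_class (power_sum c N) z)"
      using trig_power_sum[OF q] by blast
    note [measurable] = trig_measurable[OF q]
    have "(LINT z|circ. cmod (rep_class \<phi> z * q z)) = norm_L1 (\<phi> * power_sum c N)"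
      unfolding norm_L1_def
      by (rule integral_cong_AE)
         (use Nc rep_times[of \<phi> "power_sum c N"] in \<open>auto elim!: eventually_elim2 simp: norm_mult\<close>)
    also have "\<dots> \<le> C * norm_L2 (power_sum c N)"
      using C(2)[OF mult_power_sum_mem[OF \<phi>M]] by (simp add: nrm_mult_power_sum[OF \<phi>])
    also have "norm_L2 (power_sum c N) = sqrt (LINT z|circ. (cmod (q z))\<^sup>2)"
      unfolding norm_L2_eq
      by (intro arg_cong[of _ _ sqrt] integral_cong_AE) (use Nc in \<open>auto elim!: eventually_mono\<close>)
    finally show ?thesis .
  qed
  have bounded_bound: "(LINT z|circ. cmod (rep_class \<phi> z * h z)) \<le> C * sqrt (LINT z|circ. (cmod (h z))\<^sup>2)"
    if mh [measurable]: "h \<in> borel_measurable circ" and hb: "\<And>z. cmod z = 1 \<Longrightarrow> cmod (h z) \<le> 1" for h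
  proof -
    obtain q where q: "\<And>n. trig (q n)" "\<And>n z. cmod z = 1 \<Longrightarrow> cmod (q n z) \<le> 1"
     "AE z in circ. (\<lambda>n. q n z) \<longlonglongrightarrow> h z"
      using bounded_trig_approx_AE[OF mh hb] by metis
    note [measurable] = trig_measurable[OF q(1)]
    have "(\<lambda>n. LINT z|circ. cmod (rep_class \<phi> z * q n z)) \<longlonglongrightarrow> (LINT z|circ. cmod (rep_class \<phi> z * h z))"
    proof (rule integral_dominated_convergence[where w = "\<lambda>z. cmod (rep_class \<phi> z)"])
      show "AE z in circ. (\<lambda>n. cmod (rep_class \<phi> z * q n z)) \<longlonglongrightarrow> cmod (rep_class \<phi> z * h z)"
        using q(3) by eventually_elim (intro tendsto_intros)
      show "AE z in circ. norm (cmod (rep_class \<phi> z * q n z)) \<le> cmod (rep_class \<phi> z)" for n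
        by (rule AE_circ_sphere) (simp add: norm_mult mult_left_le q(2))
    qed (use i\<phi> in auto)
    moreover have "(\<lambda>n. LINT z|circ. (cmod (q n z))\<^sup>2) \<longlonglongrightarrow> (LINT z|circ. (cmod (h z))\<^sup>2)"
    proof (rule integral_dominated_convergence[where w = "\<lambda>z. 1"])
      show "AE z in circ. (\<lambda>n. (cmod (q n z))\<^sup>2) \<longlonglongrightarrow> (cmod (h z))\<^sup>2"
        using q(3) by eventually_elim (intro tendsto_intros)
      show "AE z in circ. norm ((cmod (q n z))\<^sup>2) \<le> 1" for n
        by (rule AE_circ_sphere) (simp add: power_le_one q(2))
    qed auto
    then have "(\<lambda>n. C * sqrt (LINT z|circ. (cmod (q n z))\<^sup>2)) \<longlonglongrightarrow> C * sqrt (LINT z|circ. (cmod (h z))\<^sup>2)"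
      by (intro tendsto_intros)
    ultimately show ?thesis by (rule LIMSEQ_le) (use trig_bound[OF q(1)] in auto)
  qed
  define g where "g n z = min (cmod (rep_class \<phi> z)) (real n)" for n z
  have [measurable]: "g n \<in> borel_measurable circ" for n unfolding g_def by measurable
  have g0: "0 \<le> g n z" "g n z \<le> real n" "g n z \<le> cmod (rep_class \<phi> z)" for n z by (auto simp: g_def)
  have g_int: "integrable circ (\<lambda>z. (g n z)\<^sup>2)" for n
    by (rule integrable_circ_bounded[of _ "(real n)\<^sup>2"]) (auto simp: g0 intro!: power_mono)
  have trunc: "(LINT z|circ. (g n z)\<^sup>2) \<le> C\<^sup>2" if n: "n > 0" for n
  proof -
    define h where "h z = complex_of_real (g n z / real n)" for z
    have mh [measurable]: "h \<in> borel_measurable circ" unfolding h_def by measurable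
    have hb: "cmod (h z) \<le> 1" for z using n g0[of n z] by (simp add: h_def norm_divide)
    define G where "G = (LINT z|circ. (g n z)\<^sup>2)"
    have G0: "0 \<le> G" by (simp add: G_def)
    have sq: "sqrt (LINT z|circ. (cmod (h z))\<^sup>2) = sqrt G / real n"
    proof -
      have "(cmod (h z))\<^sup>2 = (g n z)\<^sup>2 / (real n)\<^sup>2" for z
        by (simp add: h_def norm_divide power_divide)
      then show ?thesis by (simp add: G_def real_sqrt_divide)
    qed
    have "G / real n = (LINT z|circ. g n z * (g n z / real n))"
      by (simp add: G_def power2_eq_square)
    also have "\<dots> \<le> (LINT z|circ. cmod (rep_class \<phi> z * h z))"
    proof (rule integral_mono)
      show "integrable circ (\<lambda>z. g n z * (g n z / real n))"
        using g_int[of n] by (simp add: power2_eq_square)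
      show "integrable circ (\<lambda>z. cmod (rep_class \<phi> z * h z))"
        by (rule Bochner_Integration.integrable_bound[OF integrable_norm[OF i\<phi>]])
           (auto simp: norm_mult mult_left_le hb)
      show "g n z * (g n z / real n) \<le> cmod (rep_class \<phi> z * h z)" for z
        using n g0[of n z] by (simp add: norm_mult h_def norm_divide mult_right_mono divide_right_mono)
    qed
    also have "\<dots> \<le> C * (sqrt G / real n)" using bounded_bound[OF mh hb] by (simp only: sq)
    finally have "G \<le> C * sqrt G" using n by (simp add: field_simps)
    then have GC: "sqrt G * sqrt G \<le> C * sqrt G" using G0 by simp
    have "sqrt G \<le> C"
    proof (cases "G = 0")
      case False
      then have "0 < sqrt G" using G0 by simp
      with GC show ?thesis by (rule mult_right_le_imp_le)
    qed (use C(1) in simp)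
    then have "(sqrt G)\<^sup>2 \<le> C\<^sup>2" using G0 by (intro power_mono) auto
    then show ?thesis using G0 by (simp add: G_def)
  qed
  have "(\<integral>\<^sup>+z. ennreal ((cmod (rep_class \<phi> z))\<^sup>2) \<partial>circ) = (\<integral>\<^sup>+z. liminf (\<lambda>n. ennreal ((g n z)\<^sup>2)) \<partial>circ)"
  proof (rule nn_integral_cong)
    fix z
    obtain N where "cmod (rep_class \<phi> z) \<le> real N" using real_arch_simple by blast
    then have "eventually (\<lambda>n. ennreal ((g n z)\<^sup>2) = ennreal ((cmod (rep_class \<phi> z))\<^sup>2)) sequentially"
      by (intro eventually_sequentiallyI[of N]) (simp add: g_def min_def)
    then have "(\<lambda>n. ennreal ((g n z)\<^sup>2)) \<longlonglongrightarrow> ennreal ((cmod (rep_class \<phi> z))\<^sup>2)"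
      by (rule tendsto_eventually)
    then show "ennreal ((cmod (rep_class \<phi> z))\<^sup>2) = liminf (\<lambda>n. ennreal ((g n z)\<^sup>2))"
      by (intro lim_imp_Liminf[symmetric]) auto
  qed
  also have "\<dots> \<le> liminf (\<lambda>n. \<integral>\<^sup>+z. ennreal ((g n z)\<^sup>2) \<partial>circ)"
    by (rule nn_integral_liminf) measurable
  also have "\<dots> \<le> ennreal (C\<^sup>2)"
  proof (rule Liminf_le)
    show "eventually (\<lambda>n. (\<integral>\<^sup>+z. ennreal ((g n z)\<^sup>2) \<partial>circ) \<le> ennreal (C\<^sup>2)) sequentially"
      by (rule eventually_sequentiallyI[of 1])
         (use trunc in \<open>simp add: nn_integral_eq_integral[OF g_int] ennreal_leI\<close>)
  qed simp
  finally show ?thesis using norm_L2_le(1)[OF _ C(1)] by blast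
qed

text \<open>The products of \<open>\<phi>\<close> with the partial sums of \<open>g\<close> converge in \<open>M\<close>, hence in \<open>L1\<close>. As \<open>\<phi>\<close> is in \<open>L2\<close>, they
  also converge in \<open>L1\<close> to \<open>\<phi> * g\<close>, which is therefore the limit in \<open>M\<close>.\<close>

lemma wandering_mult_H2:
  assumes \<phi>: "\<phi> \<in> wandering" "nrm \<phi> = 1" and g: "g \<in> H2"
  shows "\<phi> * g \<in> M" "nrm (\<phi> * g) = norm_L2 g"
    "(\<lambda>n. nrm (\<phi> * power_sum (\<lambda>i. fourier g (int i)) n - \<phi> * g)) \<longlonglongrightarrow> 0"
proof -
  have \<phi>M: "\<phi> \<in> M" using \<phi>(1) by (simp add: wandering_def)
  have gL: "g \<in> L2" using g by (simp add: H2_def)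
  let ?P = "power_sum (\<lambda>i. fourier g (int i))"
  note lim = H2_power_series(2)[OF g]
  obtain f where f: "f \<in> M" "(\<lambda>n. nrm (\<phi> * ?P n - f)) \<longlonglongrightarrow> 0"
    using orthonormal_series[OF zp_mem[OF \<phi>M] wandering_orthonormal[OF \<phi>] H2_power_series(1)[OF g]]
    unfolding mult_power_sum by blast
  have "(\<lambda>n. norm_L2 \<phi> * norm_L2 (?P n - g)) \<longlonglongrightarrow> 0"
    using tendsto_mult_right_zero[OF lim] .
  then have "(\<lambda>n. norm_L1 (\<phi> * ?P n - \<phi> * g)) \<longlonglongrightarrow> 0"
    by (rule Lim_null_comparison[rotated])
       (use L2_mult_L1(2)[OF wandering_L2[OF \<phi>] HL2.diff_mem[OF power_sum_L2 gL]]
        in \<open>auto simp: norm_L1_nonneg right_diff_distrib\<close>)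
  then have eq: "f = \<phi> * g"
    by (rule L1_lim_unique[OF M_L1[OF mult_power_sum_mem[OF \<phi>M]] M_L1[OF f(1)]
          L2_mult_L1(1)[OF wandering_L2[OF \<phi>] gL] L1_lim[OF mult_power_sum_mem[OF \<phi>M] f]])
  show "\<phi> * g \<in> M" "(\<lambda>n. nrm (\<phi> * ?P n - \<phi> * g)) \<longlonglongrightarrow> 0" using f eq by auto
  have "(\<lambda>n. nrm (\<phi> * ?P n)) \<longlonglongrightarrow> nrm (\<phi> * g)"
    by (rule nrm_lim[OF mult_power_sum_mem[OF \<phi>M] f(1)[unfolded eq] f(2)[unfolded eq]])
  moreover have "(\<lambda>n. norm_L2 (?P n)) \<longlonglongrightarrow> norm_L2 g"
    using HL2.nrm_lim[OF power_sum_L2 gL] lim by (simp add: ip_norm_L2)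
  ultimately show "nrm (\<phi> * g) = norm_L2 g"
    by (simp add: nrm_mult_power_sum[OF \<phi>] LIMSEQ_unique)
qed

lemma wandering_H2:
  assumes "\<phi> \<in> wandering" "nrm \<phi> = 1" shows "\<phi> \<in> H2"
  using wandering_L2[OF assms] assms(1) M_H1 by (auto simp: wandering_def H2_def H1_def)

text \<open>If \<open>\<phi>\<close> and \<open>\<psi>\<close> were orthogonal, so would be \<open>\<phi> H2\<close> and \<open>\<psi> H2\<close>. Both contain \<open>\<phi> * \<psi>\<close>, whose norm is that of \<open>\<psi>\<close> in
  \<open>L2\<close> and thus not zero.\<close>

lemma no_orthogonal_wandering:
  assumes \<phi>: "\<phi> \<in> wandering" "nrm \<phi> = 1" and \<psi>: "\<psi> \<in> wandering" "nrm \<psi> = 1"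
  shows "ip \<phi> \<psi> \<noteq> 0"
proof
  assume orth: "ip \<phi> \<psi> = 0"
  have \<phi>M: "\<phi> \<in> M" and \<psi>M: "\<psi> \<in> M" using \<phi>(1) \<psi>(1) by (auto simp: wandering_def)
  have mono: "ip (zp (int i) * \<phi>) (zp (int j) * \<psi>) = 0" for i j
  proof (cases i j rule: linorder_cases)
    case less
    then show ?thesis by (rule wandering_ip[OF _ \<phi>(1) \<psi>M])
  next
    case equal
    then show ?thesis using ip_zp[OF \<phi>M \<psi>M] orth by simp
  next
    case greater
    then show ?thesis
      using wandering_ip[OF greater \<psi>(1) \<phi>M] ip_sym[OF zp_mem[OF \<phi>M] zp_mem[OF \<psi>M], of i j] by simp
  qed
  have sums: "ip (\<phi> * power_sum a n) (\<psi> * power_sum b k) = 0" for a b n k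
  proof -
    have 1: "ip (zp (int i) * \<phi>) (\<psi> * power_sum b k) = 0" for i
    proof -
      have "ip (\<psi> * power_sum b k) (zp (int i) * \<phi>) = 0"
        unfolding mult_power_sum
        by (subst ip_sum_left)
           (auto simp: scale_mem zp_mem \<phi>M \<psi>M ip_scale mono ip_sym[of "zp (int _) * \<psi>" "zp (int i) * \<phi>"])
      then show ?thesis using ip_sym[OF zp_mem[OF \<phi>M] mult_power_sum_mem[OF \<psi>M]] by simp
    qed
    show ?thesis
      unfolding mult_power_sum[of \<phi>]
      by (subst ip_sum_left) (auto simp: scale_mem zp_mem \<phi>M mult_power_sum_mem \<psi>M ip_scale 1)
  qed
  note H\<phi> = wandering_H2[OF \<phi>] and H\<psi> = wandering_H2[OF \<psi>]
  note A = wandering_mult_H2[OF \<phi> H\<psi>] and B = wandering_mult_H2[OF \<psi> H\<phi>]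
  have half: "ip (\<phi> * power_sum a n) (\<psi> * \<phi>) = 0" for a n
  proof -
    have "(\<lambda>k. ip (\<psi> * power_sum (\<lambda>i. fourier \<phi> (int i)) k) (\<phi> * power_sum a n)) \<longlonglongrightarrow> ip (\<psi> * \<phi>) (\<phi> * power_sum a n)"
      by (rule ip_lim[OF mult_power_sum_mem[OF \<psi>M] B(1) mult_power_sum_mem[OF \<phi>M] B(3)])
    moreover have "ip (\<psi> * power_sum b k) (\<phi> * power_sum a n) = 0" for b k
      using ip_sym[OF mult_power_sum_mem[OF \<psi>M] mult_power_sum_mem[OF \<phi>M], of b k a n] sums by simp
    ultimately have "ip (\<psi> * \<phi>) (\<phi> * power_sum a n) = 0" by (simp add: LIMSEQ_const_iff)
    then show ?thesis using ip_sym[OF mult_power_sum_mem[OF \<phi>M] B(1)] by simp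
  qed
  have "(\<lambda>n. ip (\<phi> * power_sum (\<lambda>i. fourier \<psi> (int i)) n) (\<psi> * \<phi>)) \<longlonglongrightarrow> ip (\<phi> * \<psi>) (\<psi> * \<phi>)"
    by (rule ip_lim[OF mult_power_sum_mem[OF \<phi>M] A(1) B(1) A(3)])
  then have "ip (\<phi> * \<psi>) (\<psi> * \<phi>) = 0" by (simp only: half LIMSEQ_const_iff)
  then have "ip (\<phi> * \<psi>) (\<phi> * \<psi>) = 0" by (simp only: mult.commute[of \<psi> \<phi>])
  then have "nrm (\<phi> * \<psi>) = 0" by (simp add: ip_norm_def)
  then have "norm_L2 \<psi> = 0" by (simp add: A(2))
  then have "\<psi> = 0" using HL2.nrm_eq_0[of \<psi>] H\<psi> by (simp add: ip_norm_L2 H2_def)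
  then show False using \<psi>(2) by (simp add: nrm_zero)
qed

lemma T_range: "T_z ` M = shifted 1"
  by (simp add: shifted_def T_z_zp)

lemma wandering_decomposition:
  assumes f: "f \<in> M" shows "\<exists>n\<in>wandering. \<exists>h\<in>M. f = n + T_z h"
proof -
  have "\<exists>w\<in>shifted 1. \<forall>v\<in>shifted 1. ip (f - w) v = 0"
    by (rule orthogonal_projection[OF subspace_shifted shifted_subset shifted_closed f])
  then obtain w where w: "w \<in> shifted 1" "\<And>v. v \<in> shifted 1 \<Longrightarrow> ip (f - w) v = 0" by blast
  then have wM: "w \<in> M" using shifted_subset by blast
  obtain h where h: "h \<in> M" "w = T_z h" using w(1) unfolding T_range[symmetric] by blast
  have "f - w \<in> wandering"
    using w(2) diff_mem[OF f wM] unfolding wandering_def T_range[symmetric] by blast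
  then show ?thesis using h by (intro bexI[of _ "f - w"] bexI[of _ h]) auto
qed

text \<open>Without wandering vectors every element of \<open>M\<close> would be divisible by \<open>z\<close> within \<open>M\<close>.\<close>

lemma wandering_unit_exists:
  assumes "M \<noteq> {0}" shows "\<exists>\<phi>\<in>wandering. nrm \<phi> = 1"
proof -
  have "\<exists>n\<in>wandering. n \<noteq> 0"
  proof (rule ccontr)
    assume neg: "\<not> ?thesis"
    have "\<exists>k\<in>M. h = T_z k" if "h \<in> M" for h
      using wandering_decomposition[OF that] neg by force
    then have "h = 0" if "h \<in> M" for h using divisible_zero[OF order_refl _ that] by blast
    then show False using assms zero_mem by blast
  qed
  then obtain n where n: "n \<in> wandering" "n \<noteq> 0" by blast
  then have nM: "n \<in> M" by (simp add: wandering_def)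
  have p: "0 < nrm n" using nrm_eq_0[OF nM] nrm_nonneg[OF nM] n(2) by linarith
  have "scale (of_real (1 / nrm n)) n \<in> wandering"
    using n(1) by (auto simp: wandering_def scale_mem ip_scale T_mem)
  moreover have "nrm (scale (of_real (1 / nrm n)) n) = 1" using p by (simp add: nrm_scale[OF nM] norm_divide)
  ultimately show ?thesis by blast
qed

text \<open>Otherwise the part of \<open>\<psi>\<close> orthogonal to \<open>\<phi>\<close> could be normalized.\<close>

lemma wandering_one_dimensional:
  assumes \<phi>: "\<phi> \<in> wandering" "nrm \<phi> = 1" and \<psi>: "\<psi> \<in> wandering"
  shows "\<psi> = scale (ip \<psi> \<phi>) \<phi>"
proof (rule ccontr)
  assume ne: "\<psi> \<noteq> scale (ip \<psi> \<phi>) \<phi>"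
  have \<phi>M: "\<phi> \<in> M" and \<psi>M: "\<psi> \<in> M" using \<phi>(1) \<psi> by (auto simp: wandering_def)
  define \<eta> where "\<eta> = \<psi> - scale (ip \<psi> \<phi>) \<phi>"
  have \<eta>M: "\<eta> \<in> M" unfolding \<eta>_def by (intro diff_mem scale_mem \<phi>M \<psi>M)
  have \<eta>W: "\<eta> \<in> wandering"
    using \<phi>(1) \<psi> \<eta>M unfolding wandering_def \<eta>_def
    by (auto simp: ip_diff ip_scale scale_mem T_mem)
  have orth: "ip \<eta> \<phi> = 0"
    using ip_self[OF \<phi>M] \<phi>(2) by (simp add: \<eta>_def ip_diff ip_scale scale_mem \<phi>M \<psi>M)
  have "\<eta> \<noteq> 0" using ne by (simp add: \<eta>_def)
  then have p: "0 < nrm \<eta>" using nrm_eq_0[OF \<eta>M] nrm_nonneg[OF \<eta>M] by linarith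
  have "scale (of_real (1 / nrm \<eta>)) \<eta> \<in> wandering"
    using \<eta>W by (auto simp: wandering_def scale_mem ip_scale T_mem)
  moreover have "nrm (scale (of_real (1 / nrm \<eta>)) \<eta>) = 1" using p by (simp add: nrm_scale[OF \<eta>M] norm_divide)
  ultimately have "ip (scale (of_real (1 / nrm \<eta>)) \<eta>) \<phi> \<noteq> 0"
    by (rule no_orthogonal_wandering[OF _ _ \<phi>])
  then show False using orth by (simp add: ip_scale \<eta>M \<phi>M)
qed

text \<open>An element of \<open>M\<close> orthogonal to every \<open>z ^ i * \<phi>\<close> is divisible by \<open>z\<close> with a quotient of the same
  kind.\<close>

lemma orthogonal_to_wandering_zero:
  assumes \<phi>: "\<phi> \<in> wandering" "nrm \<phi> = 1" and h: "h \<in> M" "\<And>i. ip h (zp (int i) * \<phi>) = 0"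
  shows "h = 0"
proof (rule divisible_zero[of "{h \<in> M. \<forall>i. ip h (zp (int i) * \<phi>) = 0}"])
  fix h assume "h \<in> {h \<in> M. \<forall>i. ip h (zp (int i) * \<phi>) = 0}"
  then have h: "h \<in> M" "\<And>i. ip h (zp (int i) * \<phi>) = 0" by auto
  have \<phi>M: "\<phi> \<in> M" using \<phi>(1) by (simp add: wandering_def)
  obtain n k where nk: "n \<in> wandering" "k \<in> M" "h = n + T_z k" using wandering_decomposition[OF h(1)] by blast
  have nM: "n \<in> M" using nk(1) by (simp add: wandering_def)
  have "ip (T_z k) \<phi> = 0"
    using \<phi>(1) nk(2) ip_sym[OF T_mem[OF nk(2)] \<phi>M] by (simp add: wandering_def)
  moreover have "ip h \<phi> = 0" using h(2)[of 0] by simp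
  ultimately have "ip n \<phi> = 0" using ip_add[OF nM T_mem[OF nk(2)] \<phi>M] nk(3) by simp
  then have "n = 0" using wandering_one_dimensional[OF \<phi> nk(1)] by simp
  then have hk: "h = T_z k" using nk(3) by simp
  have "ip k (zp (int i) * \<phi>) = 0" for i
  proof -
    have "ip k (zp (int i) * \<phi>) = ip (zp (int 1) * k) (zp (int 1) * (zp (int i) * \<phi>))"
      by (rule ip_zp[symmetric]) (intro nk zp_mem \<phi>M)+
    also have "\<dots> = ip h (zp (int (Suc i)) * \<phi>)" unfolding hk zp_Suc by (simp add: T_z_zp)
    also have "\<dots> = 0" by (rule h(2))
    finally show ?thesis .
  qed
  then show "\<exists>k\<in>{h \<in> M. \<forall>i. ip h (zp (int i) * \<phi>) = 0}. h = T_z k" using nk(2) hk by blast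
qed (use h in auto)

text \<open>The coefficients of \<open>f\<close> along the orthonormal sequence \<open>z ^ i * \<phi>\<close> are square summable, so they are those of
  some \<open>g\<close> in \<open>H2\<close>; what remains of \<open>f\<close> after subtracting \<open>\<phi> * g\<close> is orthogonal to the sequence.\<close>

theorem wandering_generates:
  assumes \<phi>: "\<phi> \<in> wandering" "nrm \<phi> = 1" shows "M = {\<phi> * g | g. g \<in> H2}"
proof
  have \<phi>M: "\<phi> \<in> M" using \<phi>(1) by (simp add: wandering_def)
  show "{\<phi> * g | g. g \<in> H2} \<subseteq> M" using wandering_mult_H2(1)[OF \<phi>] by blast
  show "M \<subseteq> {\<phi> * g | g. g \<in> H2}"
  proof
    fix f assume f: "f \<in> M"
    obtain g where g: "g \<in> H2" "\<And>i. fourier g (int i) = ip f (zp (int i) * \<phi>)"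
      using power_series_H2[OF bessel[OF zp_mem[OF \<phi>M] wandering_orthonormal[OF \<phi>] f]] by blast
    note G = wandering_mult_H2[OF \<phi> g(1)]
    have ip_g: "ip (\<phi> * g) (zp (int i) * \<phi>) = ip f (zp (int i) * \<phi>)" for i
    proof -
      have "(\<lambda>n. ip (\<phi> * power_sum (\<lambda>i. fourier g (int i)) n) (zp (int i) * \<phi>)) \<longlonglongrightarrow> ip (\<phi> * g) (zp (int i) * \<phi>)"
        by (rule ip_lim[OF mult_power_sum_mem[OF \<phi>M] G(1) zp_mem[OF \<phi>M] G(3)])
      moreover have "ip (\<phi> * power_sum (\<lambda>i. fourier g (int i)) n) (zp (int i) * \<phi>) = fourier g (int i)"
        if "n \<ge> Suc i" for n
        unfolding mult_power_sum
        using ip_comb[OF zp_mem[OF \<phi>M] wandering_orthonormal[OF \<phi>], of "{..<n}"] that by simp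
      then have "(\<lambda>n. ip (\<phi> * power_sum (\<lambda>i. fourier g (int i)) n) (zp (int i) * \<phi>)) \<longlonglongrightarrow> fourier g (int i)"
        by (intro tendsto_eventually eventually_sequentiallyI[of "Suc i"])
      ultimately show ?thesis using LIMSEQ_unique g(2) by fastforce
    qed
    have "f - \<phi> * g = 0"
      by (rule orthogonal_to_wandering_zero[OF \<phi> diff_mem[OF f G(1)]])
         (simp add: ip_diff f G(1) zp_mem \<phi>M ip_g)
    then show "f \<in> {\<phi> * g | g. g \<in> H2}" using g(1) by auto
  qed
qed

end

theorem theorem4p1:
  fixes \<alpha> :: "l0 \<Rightarrow> real" and M :: "l0 set" and ip :: "l0 \<Rightarrow> l0 \<Rightarrow> complex"
  assumes "continuous_rotsym_norm \<alpha>"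
    and "hilbert_subspace M ip"
    and "M \<subseteq> Halpha \<alpha>"
    and "T_z ` M \<subseteq> M"
    and "\<forall>f\<in>M. ip_norm ip (T_z f) = ip_norm ip f"
  shows "\<exists>\<phi> \<in> H2 \<inter> Halpha \<alpha>.
    M = {\<phi> * g | g. g \<in> H2} \<and>
    (M \<noteq> {0} \<longrightarrow> (\<forall>g\<in>H2. ip_norm ip (\<phi> * g) = norm_L2 g))"
proof -
  interpret \<alpha>: continuous_rotsym_norm \<alpha> by fact
  interpret hilbert_subspace M ip by fact
  interpret shift_isometry M ip
    by unfold_locales (use assms \<alpha>.Halpha_subset_H1 in auto)
  show ?thesis
  proof (cases "M = {0}")
    case True
    have "0 \<in> H2"
      using HL2.zero_mem True M_H1 by (auto simp: H2_def H1_def)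
    moreover have "0 \<in> Halpha \<alpha>" using True assms(3) by auto
    moreover have "M = {0 * g | g. g \<in> H2}" using True \<open>0 \<in> H2\<close> by auto
    ultimately show ?thesis using True by blast
  next
    case False
    then obtain \<phi> where \<phi>: "\<phi> \<in> wandering" "nrm \<phi> = 1" using wandering_unit_exists by blast
    then have "\<phi> \<in> H2 \<inter> Halpha \<alpha>"
      using wandering_H2 assms(3) by (auto simp: wandering_def)
    then show ?thesis
      using wandering_generates[OF \<phi>] wandering_mult_H2(2)[OF \<phi>] by blast
  qed
qed

end
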